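(* Let $G$ be a $\mathsf D_\ell$-graded group for $\ell\ge4$. Then there are a commutative unital ring $K$ and a group homomorphism $Q\colon\mathrm{StO}(2\ell,K)\to G$ from the even orthogonal Steinberg group inducing isomorphisms between the root subgroups. Any other such homomorphism $Q'\colon\mathrm{StO}(2\ell,K')\to G$ (with $K'$ a commutative unital ring) is of the following type. Choose a ring isomorphism $F\colon K'\to K$ and elements $a_{-\ell},\dots,a_{-1},a_1,\dots,a_\ell\in K^*$ such that $a_ia_{-i}=a_ja_{-j}$ for all $i,j$, and let $Q'(t_{ij}(x))=Q\bigl(t_{ij}(F(x)\,a_i/a_j)\bigr)$ for all $i\ne\pm j$ and $x\in K'$. The tuple $(F,a_i)_i$ is uniquely determined by $Q'$ up to the change $a_i\mapsto a_i\,c^{\varepsilon_i}$ for $c\in K^*$, where $\varepsilon_i=1$ for $i>0$ and $\varepsilon_i=-1$ for $i<0$.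
   Context: Conventions: $[f,g]=fgf^{-1}g^{-1}$, ${}^{f}g=fgf^{-1}$; $K^*$ is the group of invertible elements of $K$. $\mathsf D_\ell=\{\pm\mathrm e_i\pm\mathrm e_j\mid1\le i<j\le\ell\}$, and $\mathrm e_{-i}=-\mathrm e_i$. For a root system $\Phi$ and linearly independent $\alpha,\beta\in\Phi$ let $]\alpha,\beta[\;=\Phi\cap(\mathbb R_{>0}\alpha+\mathbb R_{>0}\beta)$. A subset $\Sigma\subseteq\Phi$ is special closed if it is the intersection of $\Phi$ with a convex cone not containing opposite non-zero vectors; $\alpha\in\Sigma$ is extreme if it lies on an extreme ray of the conical convex hull of $\Sigma$. A group $G$ has $\Phi$-commutator relations if it has a family of subgroups $(G_\alpha)_{\alpha\in\Phi}$ (the root subgroups) such that $[G_\alpha,G_\beta]\le\langle G_\gamma\mid\gamma\in\,]\alpha,\beta[\,\rangle$ for all linearly independent $\alpha,\beta\in\Phi$, and $G_\alpha\cap\langle G_\beta\mid\beta\in\Sigma\setminus\{\alpha\}\rangle=1$ for all special closed $\Sigma\subseteq\Phi$ and all extreme $\alpha\in\Sigma$. An $\alpha$-Weyl element is an element $n\in G_\alpha G_{-\alpha}G_\alpha$ with ${}^nG_\beta=G_{s_\alpha(\beta)}$ for all $\beta\in\Phi$, where $s_\alpha$ is the reflection in $\alpha$. $G$ is $\Phi$-graded if moreover for every $\alpha\in\Phi$ there exists an $\alpha$-Weyl element. For a commutative unital ring $K$, the even orthogonal Steinberg group $\mathrm{StO}(2\ell,K)$ has generators $t_{ij}(x)$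 for $x\in K$ and $i,j\in\{-\ell,\dots,-1,1,\dots,\ell\}$ with $i\ne\pm j$, and relations: $t_{ij}(x)\,t_{ij}(x')=t_{ij}(x+x')$; $t_{ij}(x)=t_{-j,-i}(-x)$; $[t_{ij}(x),t_{kl}(y)]=1$ if $\{-i,j\}\cap\{k,-l\}=\varnothing$; $[t_{ij}(x),t_{jk}(y)]=t_{ik}(xy)$ if $i\ne\pm k$; $[t_{-i,j}(x),t_{ji}(y)]=1$. It is $\mathsf D_\ell$-graded with root subgroup $t_{ij}(K)$ for the root $\mathrm e_j-\mathrm e_i$. "Inducing isomorphisms between the root subgroups" means that $x\mapsto Q(t_{ij}(x))$ is an isomorphism of the additive group of the ring onto $G_{\mathrm e_j-\mathrm e_i}$ for all $i\ne\pm j$.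
   Formalization: The tuple (F, a_i) is shown unique exactly up to a_i ↦ a_i c with the same c ∈ K^* for all i, instead of a_i ↦ a_i c^{ε_i}; the latter is false, since it multiplies a_i/a_j by c² for i > 0 > j, while a common factor c leaves Q' unchanged. *)

theory Defs
  imports
    "HOL-Analysis.Analysis"
    "HOL-Algebra.Generated_Groups"
    "HOL-Algebra.QuotRing"
begin

section \<open>Groups graded by root systems\<close>

definition root_interval :: "'v::euclidean_space set \<Rightarrow> 'v \<Rightarrow> 'v \<Rightarrow> 'v set" where
  "root_interval \<Phi> \<alpha> \<beta> = \<Phi> \<inter> {a *\<^sub>R \<alpha> + b *\<^sub>R \<beta> | a b. a > 0 \<and> b > 0}"

text \<open>A \<^const>\<open>convex_cone\<close> contains \<open>0\<close>, which is harmless since \<open>0\<close> is not a root.\<close>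

definition special_closed :: "'v::euclidean_space set \<Rightarrow> 'v set \<Rightarrow> bool" where
  "special_closed \<Phi> \<Sigma> \<longleftrightarrow>
     (\<exists>C. convex_cone C \<and> (\<forall>x\<in>C. - x \<in> C \<longrightarrow> x = 0) \<and> \<Sigma> = \<Phi> \<inter> C)"

definition extreme_ray_of :: "'v::euclidean_space set \<Rightarrow> 'v set \<Rightarrow> bool" where
  "extreme_ray_of R C \<longleftrightarrow> R face_of C \<and> (\<exists>v. v \<noteq> 0 \<and> R = {c *\<^sub>R v | c. c \<ge> 0})"

definition extreme_root :: "'v::euclidean_space set \<Rightarrow> 'v \<Rightarrow> bool" where
  "extreme_root \<Sigma> \<alpha> \<longleftrightarrow> \<alpha> \<in> \<Sigma> \<and> (\<exists>R. extreme_ray_of R (convex_cone hull \<Sigma>) \<and> \<alpha> \<in> R)"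

definition root_reflection :: "'v::euclidean_space \<Rightarrow> 'v \<Rightarrow> 'v" where
  "root_reflection \<alpha> \<beta> = \<beta> - (2 * (\<beta> \<bullet> \<alpha>) / (\<alpha> \<bullet> \<alpha>)) *\<^sub>R \<alpha>"

definition group_commutator :: "('a, 'm) monoid_scheme \<Rightarrow> 'a \<Rightarrow> 'a \<Rightarrow> 'a" where
  "group_commutator G f g = f \<otimes>\<^bsub>G\<^esub> g \<otimes>\<^bsub>G\<^esub> inv\<^bsub>G\<^esub> f \<otimes>\<^bsub>G\<^esub> inv\<^bsub>G\<^esub> g"

definition mutual_commutator :: "('a, 'm) monoid_scheme \<Rightarrow> 'a set \<Rightarrow> 'a set \<Rightarrow> 'a set" where
  "mutual_commutator G A B = generate G {group_commutator G f g | f g. f \<in> A \<and> g \<in> B}"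

text \<open>In the following, \<open>X \<alpha>\<close> is the root subgroup for the root \<open>\<alpha>\<close>; the values of \<open>X\<close> outside
  \<open>\<Phi>\<close> are irrelevant.  The condition \<open>\<alpha> \<noteq> \<beta>\<close> is needed because \<^term>\<open>independent {\<alpha>, \<beta>}\<close> is a
  property of the set \<open>{\<alpha>, \<beta>}\<close>.\<close>

definition commutator_relations ::
    "('a, 'm) monoid_scheme \<Rightarrow> 'v::euclidean_space set \<Rightarrow> ('v \<Rightarrow> 'a set) \<Rightarrow> bool" where
  "commutator_relations G \<Phi> X \<longleftrightarrow>
     (\<forall>\<alpha>\<in>\<Phi>. subgroup (X \<alpha>) G) \<and>
     (\<forall>\<alpha>\<in>\<Phi>. \<forall>\<beta>\<in>\<Phi>. \<alpha> \<noteq> \<beta> \<and> independent {\<alpha>, \<beta>} \<longrightarrow>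
        mutual_commutator G (X \<alpha>) (X \<beta>) \<subseteq> generate G (\<Union>\<gamma>\<in>root_interval \<Phi> \<alpha> \<beta>. X \<gamma>)) \<and>
     (\<forall>\<Sigma> \<alpha>. special_closed \<Phi> \<Sigma> \<and> extreme_root \<Sigma> \<alpha> \<longrightarrow>
        X \<alpha> \<inter> generate G (\<Union>\<beta>\<in>\<Sigma> - {\<alpha>}. X \<beta>) = {\<one>\<^bsub>G\<^esub>})"

definition weyl_element ::
    "('a, 'm) monoid_scheme \<Rightarrow> 'v::euclidean_space set \<Rightarrow> ('v \<Rightarrow> 'a set) \<Rightarrow> 'v \<Rightarrow> 'a \<Rightarrow> bool" where
  "weyl_element G \<Phi> X \<alpha> n \<longleftrightarrow>
     n \<in> X \<alpha> <#>\<^bsub>G\<^esub> X (- \<alpha>) <#>\<^bsub>G\<^esub> X \<alpha> \<and>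
     (\<forall>\<beta>\<in>\<Phi>. (\<lambda>g. n \<otimes>\<^bsub>G\<^esub> g \<otimes>\<^bsub>G\<^esub> inv\<^bsub>G\<^esub> n) ` X \<beta> = X (root_reflection \<alpha> \<beta>))"

definition graded_group ::
    "('a, 'm) monoid_scheme \<Rightarrow> 'v::euclidean_space set \<Rightarrow> ('v \<Rightarrow> 'a set) \<Rightarrow> bool" where
  "graded_group G \<Phi> X \<longleftrightarrow>
     group G \<and> commutator_relations G \<Phi> X \<and> (\<forall>\<alpha>\<in>\<Phi>. \<exists>n. weyl_element G \<Phi> X \<alpha> n)"


section \<open>The root system of type D\<close>

text \<open>The rank \<open>\<ell>\<close> is the cardinality of the index type \<open>'n\<close>, and \<open>'n signed_index\<close> plays the role
  of \<open>{-\<ell>, \<dots>, -1, 1, \<dots>, \<ell>}\<close>.\<close>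

datatype 'n signed_index = Pos 'n | Neg 'n

instantiation signed_index :: (type) uminus
begin

fun uminus_signed_index :: "'a signed_index \<Rightarrow> 'a signed_index" where
  "- Pos i = Neg i"
| "- Neg i = Pos i"

instance ..

end

fun basis_vec :: "'n::finite signed_index \<Rightarrow> real ^ 'n" where
  "basis_vec (Pos i) = axis i 1"
| "basis_vec (Neg i) = - axis i 1"

definition D_roots :: "(real ^ 'n::finite) set" where
  "D_roots = {s *\<^sub>R axis i 1 + t *\<^sub>R axis j 1 | s t i j. s \<in> {1, -1} \<and> t \<in> {1, -1} \<and> i \<noteq> j}"

lemma minus_minus_signed_index [simp]: "- (- i) = (i :: 'n signed_index)"
  by (cases i) auto

lemma basis_vec_uminus: "basis_vec (- i) = - basis_vec i"
  by (cases i) auto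

lemma D_roots_eq: "D_roots = {basis_vec j - basis_vec i | i j. i \<noteq> j \<and> i \<noteq> - j}"
proof (intro Set.set_eqI iffI)
  fix v :: "real ^ 'n" assume "v \<in> D_roots"
  then obtain s t i j where v: "v = s *\<^sub>R axis i 1 + t *\<^sub>R axis j 1" "i \<noteq> j"
    and st: "s = 1 \<or> s = -1" "t = 1 \<or> t = -1"
    unfolding D_roots_def by auto
  define p where "p = (if s = 1 then Neg i else Pos i)"
  define q where "q = (if t = 1 then Pos j else Neg j)"
  have "v = basis_vec q - basis_vec p" "p \<noteq> q" "p \<noteq> - q"
    using v st by (auto simp: p_def q_def)
  then show "v \<in> {basis_vec j - basis_vec i | i j. i \<noteq> j \<and> i \<noteq> - j}" by blast
next
  fix v :: "real ^ 'n" assume "v \<in> {basis_vec j - basis_vec i | i j. i \<noteq> j \<and> i \<noteq> - j}"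
  then obtain p q where pq: "v = basis_vec q - basis_vec p" "p \<noteq> q" "p \<noteq> - q" by auto
  obtain i s where p: "- basis_vec p = s *\<^sub>R axis i 1" "s \<in> {1, -1}" "p \<in> {Pos i, Neg i}"
  proof (cases p)
    case (Pos i)
    then show ?thesis using that[of "-1" i] by simp
  next
    case (Neg i)
    then show ?thesis using that[of 1 i] by simp
  qed
  obtain j t where q: "basis_vec q = t *\<^sub>R axis j 1" "t \<in> {1, -1}" "q \<in> {Pos j, Neg j}"
  proof (cases q)
    case (Pos i)
    then show ?thesis using that[of 1 i] by simp
  next
    case (Neg i)
    then show ?thesis using that[of "-1" i] by simp
  qed
  have "i \<noteq> j" using pq p q by auto
  moreover have "v = s *\<^sub>R axis i 1 + t *\<^sub>R axis j 1"
    using pq(1) p(1) q(1) by (metis uminus_add_conv_diff)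
  ultimately show "v \<in> D_roots" unfolding D_roots_def using p(2) q(2) by blast
qed


section \<open>Groups given by generators and relations\<close>

text \<open>A word is a list of letters; \<open>(g, True)\<close> stands for the generator \<open>g\<close> and \<open>(g, False)\<close> for
  its inverse.  A relation \<open>u = v\<close> is a pair of words.\<close>

type_synonym 'g letters = "('g \<times> bool) list"

definition inverse_word :: "'g letters \<Rightarrow> 'g letters" where
  "inverse_word w = rev (map (\<lambda>(g, b). (g, \<not> b)) w)"

definition words :: "'g set \<Rightarrow> 'g letters set" where
  "words S = lists (S \<times> UNIV)"

inductive_set presentation_rel :: "'g set \<Rightarrow> ('g letters \<times> 'g letters) set \<Rightarrow> ('g letters \<times> 'g letters) set"
  for S and R where
  refl: "w \<in> words S \<Longrightarrow> (w, w) \<in> presentation_rel S R"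
| sym: "(u, v) \<in> presentation_rel S R \<Longrightarrow> (v, u) \<in> presentation_rel S R"
| trans: "(u, v) \<in> presentation_rel S R \<Longrightarrow> (v, w) \<in> presentation_rel S R \<Longrightarrow> (u, w) \<in> presentation_rel S R"
| cong: "(u, v) \<in> presentation_rel S R \<Longrightarrow> (u', v') \<in> presentation_rel S R \<Longrightarrow>
    (u @ u', v @ v') \<in> presentation_rel S R"
| cancel: "g \<in> S \<Longrightarrow> ([(g, b), (g, \<not> b)], []) \<in> presentation_rel S R"
| rel: "(u, v) \<in> R \<Longrightarrow> u \<in> words S \<Longrightarrow> v \<in> words S \<Longrightarrow> (u, v) \<in> presentation_rel S R"

definition presented_group :: "'g set \<Rightarrow> ('g letters \<times> 'g letters) set \<Rightarrow> 'g letters set monoid" where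
  "presented_group S R =
     \<lparr> carrier = words S // presentation_rel S R,
       mult = (\<lambda>A B. \<Union>u\<in>A. \<Union>v\<in>B. presentation_rel S R `` {u @ v}),
       one = presentation_rel S R `` {[]} \<rparr>"

lemma presentation_rel_words:
  "(u, v) \<in> presentation_rel S R \<Longrightarrow> u \<in> words S \<and> v \<in> words S"
  by (induction rule: presentation_rel.induct) (auto simp: words_def)

lemma equiv_presentation_rel: "equiv (words S) (presentation_rel S R)"
proof (rule equivI)
  show "presentation_rel S R \<subseteq> words S \<times> words S"
    using presentation_rel_words by fastforce
  show "refl_on (words S) (presentation_rel S R)"
    by (auto intro: refl_onI presentation_rel.refl)
  show "sym (presentation_rel S R)"
    by (auto intro: symI presentation_rel.sym)
  show "trans (presentation_rel S R)"
    by (auto intro: transI presentation_rel.trans)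
qed

lemma presented_group_mult:
  assumes "u \<in> words S" "v \<in> words S"
  shows "presentation_rel S R `` {u} \<otimes>\<^bsub>presented_group S R\<^esub> presentation_rel S R `` {v}
    = presentation_rel S R `` {u @ v}"
proof -
  have "congruent2 (presentation_rel S R) (presentation_rel S R)
      (\<lambda>u v. presentation_rel S R `` {u @ v})"
    using equiv_class_eq[OF equiv_presentation_rel]
    by (intro congruent2I') (blast intro: presentation_rel.cong)
  from UN_equiv_class2[OF equiv_presentation_rel equiv_presentation_rel this assms]
  show ?thesis by (simp add: presented_group_def)
qed

lemma inverse_word_rel:
  "w \<in> words S \<Longrightarrow> (inverse_word w @ w, []) \<in> presentation_rel S R"
proof (induction w)
  case Nil
  show ?case by (auto simp: inverse_word_def words_def intro!: presentation_rel.refl)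
next
  case (Cons x w)
  obtain g b where x: "x = (g, b)" by (cases x)
  have g: "g \<in> S" and w: "w \<in> words S" using Cons.prems by (auto simp: x words_def)
  have iw: "inverse_word w \<in> words S"
    using w by (auto simp: words_def inverse_word_def)
  have "([(g, \<not> b), (g, b)], []) \<in> presentation_rel S R"
    using presentation_rel.cancel[OF g, of "\<not> b"] by simp
  then have "(inverse_word w @ ([(g, \<not> b), (g, b)] @ w), inverse_word w @ ([] @ w))
      \<in> presentation_rel S R"
    by (intro presentation_rel.cong presentation_rel.refl w iw)
  then have "(inverse_word w @ ([(g, \<not> b), (g, b)] @ w), []) \<in> presentation_rel S R"
    using presentation_rel.trans Cons.IH[OF w] by fastforce
  then show ?case by (simp add: x inverse_word_def)
qed

lemma group_presented_group: "group (presented_group S R)"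
proof (rule groupI)
  let ?G = "presented_group S R" and ?c = "\<lambda>w. presentation_rel S R `` {w}"
  note m = presented_group_mult
  have carr: "A \<in> carrier ?G \<longleftrightarrow> (\<exists>w\<in>words S. A = ?c w)" for A
    by (auto simp: presented_group_def quotient_def)
  have one: "\<one>\<^bsub>?G\<^esub> = ?c []" by (simp add: presented_group_def)
  have nil: "[] \<in> words S" by (simp add: words_def)
  have app: "u @ v \<in> words S" if "u \<in> words S" "v \<in> words S" for u v
    using that by (auto simp: words_def)
  show "\<one>\<^bsub>?G\<^esub> \<in> carrier ?G" using nil one carr by auto
  show "x \<otimes>\<^bsub>?G\<^esub> y \<in> carrier ?G" if "x \<in> carrier ?G" "y \<in> carrier ?G" for x y
    using that app m unfolding carr by metis
  show "x \<otimes>\<^bsub>?G\<^esub> y \<otimes>\<^bsub>?G\<^esub> z = x \<otimes>\<^bsub>?G\<^esub> (y \<otimes>\<^bsub>?G\<^esub> z)"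
    if "x \<in> carrier ?G" "y \<in> carrier ?G" "z \<in> carrier ?G" for x y z
    using that app m unfolding carr by (metis append_assoc)
  show "\<one>\<^bsub>?G\<^esub> \<otimes>\<^bsub>?G\<^esub> x = x" if "x \<in> carrier ?G" for x
    using that nil m unfolding carr one by fastforce
  show "\<exists>y\<in>carrier ?G. y \<otimes>\<^bsub>?G\<^esub> x = \<one>\<^bsub>?G\<^esub>" if "x \<in> carrier ?G" for x
  proof -
    from that obtain w where w: "w \<in> words S" "x = ?c w" using carr by auto
    have iw: "inverse_word w \<in> words S"
      using w(1) by (auto simp: words_def inverse_word_def)
    have "?c (inverse_word w) \<otimes>\<^bsub>?G\<^esub> x = ?c (inverse_word w @ w)"
      using m[OF iw w(1)] w(2) by simp
    also have "\<dots> = ?c []"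
      by (rule equiv_class_eq[OF equiv_presentation_rel inverse_word_rel[OF w(1)]])
    finally show ?thesis using one carr iw by metis
  qed
qed


section \<open>The even orthogonal Steinberg group\<close>

type_synonym ('n, 'k) sto_gen = "'n signed_index \<times> 'n signed_index \<times> 'k"

definition sto_gens :: "('k, 'm) ring_scheme \<Rightarrow> ('n, 'k) sto_gen set" where
  "sto_gens K = {(i, j, x) | i j x. i \<noteq> j \<and> i \<noteq> - j \<and> x \<in> carrier K}"

definition t_word :: "'n signed_index \<Rightarrow> 'n signed_index \<Rightarrow> 'k \<Rightarrow> ('n, 'k) sto_gen letters" where
  "t_word i j x = [((i, j, x), True)]"

definition commutator_word :: "'g letters \<Rightarrow> 'g letters \<Rightarrow> 'g letters" where
  "commutator_word u v = u @ v @ inverse_word u @ inverse_word v"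

definition sto_rels ::
    "('k, 'm) ring_scheme \<Rightarrow> (('n, 'k) sto_gen letters \<times> ('n, 'k) sto_gen letters) set" where
  "sto_rels K =
     {(t_word i j x @ t_word i j x', t_word i j (x \<oplus>\<^bsub>K\<^esub> x')) | i j x x'.
        i \<noteq> j \<and> i \<noteq> - j \<and> x \<in> carrier K \<and> x' \<in> carrier K} \<union>
     {(t_word i j x, t_word (- j) (- i) (\<ominus>\<^bsub>K\<^esub> x)) | i j x.
        i \<noteq> j \<and> i \<noteq> - j \<and> x \<in> carrier K} \<union>
     {(commutator_word (t_word i j x) (t_word k l y), []) | i j k l x y.
        i \<noteq> j \<and> i \<noteq> - j \<and> k \<noteq> l \<and> k \<noteq> - l \<and> {- i, j} \<inter> {k, - l} = {} \<and>
        x \<in> carrier K \<and> y \<in> carrier K} \<union>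
     {(commutator_word (t_word i j x) (t_word j k y), t_word i k (x \<otimes>\<^bsub>K\<^esub> y)) | i j k x y.
        i \<noteq> j \<and> i \<noteq> - j \<and> j \<noteq> k \<and> j \<noteq> - k \<and> i \<noteq> k \<and> i \<noteq> - k \<and>
        x \<in> carrier K \<and> y \<in> carrier K} \<union>
     {(commutator_word (t_word (- i) j x) (t_word j i y), []) | i j x y.
        i \<noteq> j \<and> i \<noteq> - j \<and> x \<in> carrier K \<and> y \<in> carrier K}"

definition StO :: "('k, 'm) ring_scheme \<Rightarrow> ('n, 'k) sto_gen letters set monoid" where
  "StO K = presented_group (sto_gens K) (sto_rels K)"

definition sto_t ::
    "('k, 'm) ring_scheme \<Rightarrow> 'n signed_index \<Rightarrow> 'n signed_index \<Rightarrow> 'k \<Rightarrow> ('n, 'k) sto_gen letters set"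
  where "sto_t K i j x = presentation_rel (sto_gens K) (sto_rels K) `` {t_word i j x}"

lemma group_StO: "group (StO K)"
  unfolding StO_def by (rule group_presented_group)


section \<open>Coordinatizations and their changes\<close>

definition coordinatization ::
    "('a, 'm) monoid_scheme \<Rightarrow> (real ^ 'n::finite \<Rightarrow> 'a set) \<Rightarrow> 'k ring \<Rightarrow>
     (('n, 'k) sto_gen letters set \<Rightarrow> 'a) \<Rightarrow> bool" where
  "coordinatization G X K Q \<longleftrightarrow>
     cring K \<and> Q \<in> hom (StO K) G \<and>
     (\<forall>i j. i \<noteq> j \<and> i \<noteq> - j \<longrightarrow>
        (\<lambda>x. Q (sto_t K i j x)) \<in> iso (add_monoid K) (G\<lparr>carrier := X (basis_vec j - basis_vec i)\<rparr>))"

definition coordinate_change ::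
    "'l ring \<Rightarrow> 'k ring \<Rightarrow> ('l \<Rightarrow> 'k) \<Rightarrow> ('n signed_index \<Rightarrow> 'k) \<Rightarrow> bool" where
  "coordinate_change K' K F a \<longleftrightarrow>
     F \<in> ring_iso K' K \<and> (\<forall>i. a i \<in> Units K) \<and>
     (\<forall>i j. a i \<otimes>\<^bsub>K\<^esub> a (- i) = a j \<otimes>\<^bsub>K\<^esub> a (- j))"

definition changes_into ::
    "'l ring \<Rightarrow> 'k ring \<Rightarrow> ('l \<Rightarrow> 'k) \<Rightarrow> ('n signed_index \<Rightarrow> 'k) \<Rightarrow>
     (('n, 'k) sto_gen letters set \<Rightarrow> 'a) \<Rightarrow> (('n, 'l) sto_gen letters set \<Rightarrow> 'a) \<Rightarrow> bool" where
  "changes_into K' K F a Q Q' \<longleftrightarrow>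
     (\<forall>i j. \<forall>x\<in>carrier K'. i \<noteq> j \<and> i \<noteq> - j \<longrightarrow>
        Q' (sto_t K' i j x) = Q (sto_t K i j (F x \<otimes>\<^bsub>K\<^esub> (a i \<otimes>\<^bsub>K\<^esub> inv\<^bsub>K\<^esub> (a j)))))"

text \<open>The parameters \<open>a\<close> of a coordinate change enter only through the quotients \<open>a i / a j\<close> with
  \<open>i \<noteq> \<plusminus>j\<close>, for all signs of \<open>i\<close> and \<open>j\<close>.  These are preserved by the substitution
  \<open>a i \<mapsto> a i * c\<close> with the same unit \<open>c\<close> for positive and negative \<open>i\<close>.  The substitution
  \<open>a (Pos i) \<mapsto> a (Pos i) * c\<close>, \<open>a (Neg i) \<mapsto> a (Neg i) / c\<close> also preserves the condition on the
  products \<open>a i * a (- i)\<close>, but it multiplies \<open>a (Pos i) / a (Neg j)\<close> by the square of \<open>c\<close>, so it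
  describes a different homomorphism unless the square of \<open>c\<close> is \<open>1\<close>.\<close>

definition rescaled ::
    "'k ring \<Rightarrow> ('n signed_index \<Rightarrow> 'k) \<Rightarrow> ('n signed_index \<Rightarrow> 'k) \<Rightarrow> bool" where
  "rescaled K a b \<longleftrightarrow> (\<exists>c\<in>Units K. \<forall>i. b i = a i \<otimes>\<^bsub>K\<^esub> c)"

end

(*
Write G_ij for the root subgroup of e_j - e_i.  The commutators G_ij x G_jk -> G_ik (for i, j, k of
different absolute values) are biadditive and associative, and a Weyl element n = a b a' provides
an element a' of G_ij composition with which is bijective on both sides.  So the G_ij behave like
the Hom groups of a category on the signed indices with a partial composition.

Fix an index r.  The families of maps G_ir -> G_ir commuting with all G_ij form a ring K, and for
i <> +-r each such family is determined by its value on a generator of G_ir, which may be any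
element.  For orthogonal y in G_jk, z in G_k(-j) and any x in G_(-j)r the identity
[y, [z, x]] = [z, [y, x]] forces K to be commutative.  The same identity shows that identifying
G_jk with G_(-k)(-j) multiplies coordinates by minus a coboundary, so that a rescaling of the
generators of the G_ir yields the Steinberg relations.

Two coordinate systems differ by maps psi_ij with psi_ij(x) psi_jk(y) = psi_ik(x y).  The units
psi_ij(1) form a 1-cocycle, hence psi_ij(1) = a_i / a_j, and psi_ij(x) / psi_ij(1) is an isomorphism
of rings independent of i and j.
*)
theory Submission
  imports Defs
begin

section \<open>Signed indices and abstract bracket systems\<close>

text \<open>The composition is partial: it needs three different absolute values, and there is no
  group G_ii or G_i(-i). In a category the natural endomorphisms of Hom(-, r) are the endomorphisms
  of r, by Yoneda; these are missing here, so the natural families themselves serve as scalars. The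
  same gap forces every statement that involves i twice, or i together with -i, to go through a
  further index. This is what rank four is spent on. Associativity and the swap identity are one
  commutator identity, [x, [z, y]] = [z, [x, y]], valid when x commutes with z and [x, y] commutes
  with [z, y]. The scalars directly coordinatize only the G_ij with i and j different from +-r. The
  column G_ir is then measured by its generators, the row G_rj by left division by them, and -r by
  the identification of G_jk with G_(-k)(-j). If the coboundary is D_j / D_k, a rescaling by a_i
  removes it when a_i a_(-i) D_i is constant, which is possible because D_(-i) = D_i. The condition
  on the products a_i a_(-i) in a change of coordinates has the same origin: it says that the sign
  rule of the flip is preserved.\<close>

definition apart :: "'n signed_index \<Rightarrow> 'n signed_index \<Rightarrow> bool" where
  "apart i j \<longleftrightarrow> i \<noteq> j \<and> i \<noteq> - j"

lemma uminus_signed_index_neq [simp]: "- i \<noteq> (i :: 'n signed_index)" "i \<noteq> - i"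
  by (cases i; simp)+

lemma uminus_signed_index_eq_iff [simp]: "- i = - j \<longleftrightarrow> i = (j :: 'n signed_index)"
  by (metis minus_minus_signed_index)

lemma apart_commute: "apart i j \<longleftrightarrow> apart j i"
  unfolding apart_def by (metis minus_minus_signed_index)

lemma apart_uminus [simp]: "apart (- i) j \<longleftrightarrow> apart i j" "apart i (- j) \<longleftrightarrow> apart i j"
  unfolding apart_def by (metis minus_minus_signed_index)+

lemma not_apart_self [simp]: "\<not> apart i i"
  by (simp add: apart_def)

lemma not_apart_cases: "\<not> apart i j \<Longrightarrow> (i = j \<Longrightarrow> P) \<Longrightarrow> (i = - j \<Longrightarrow> P) \<Longrightarrow> P"
  by (auto simp: apart_def)

lemma apart_or_eq: "i \<noteq> - r \<Longrightarrow> apart i r \<or> i = r"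
  by (auto simp: apart_def)

text \<open>Not being apart means having the same absolute value, which is an equivalence relation
  with classes \<open>{i, - i}\<close>. The case distinctions below are about these classes.\<close>

lemma not_apart_trans: "\<not> apart i j \<Longrightarrow> apart i k \<longleftrightarrow> apart j k"
  by (auto elim: not_apart_cases)

fun index_of :: "'n signed_index \<Rightarrow> 'n" where
  "index_of (Pos i) = i"
| "index_of (Neg i) = i"

lemma apart_iff: "apart i j \<longleftrightarrow> index_of i \<noteq> index_of j"
  by (cases i; cases j) (auto simp: apart_def)

text \<open>Three indices occupy at most three absolute values, so rank four leaves one free. The
  hypothesis on the rank acts only through this statement.\<close>

lemma apart_exists:
  assumes "4 \<le> CARD('n::finite)"
  shows "\<exists>l :: 'n signed_index. apart l i \<and> apart l j \<and> apart l k"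
proof -
  have "card {index_of i, index_of j, index_of k} \<le> 3"
    by (simp add: card_insert_if)
  then have "{index_of i, index_of j, index_of k} \<noteq> UNIV"
    using assms by auto
  then obtain m where "m \<notin> {index_of i, index_of j, index_of k}" by auto
  then show ?thesis by (intro exI[of _ "Pos m"]) (auto simp: apart_iff)
qed

text \<open>In \<open>br_swap\<close> the right-hand side uses \<open>y \<in> H (- k) (- j)\<close> and \<open>z \<in> H j (- k)\<close>, by \<open>H_flip\<close>.  This is
  the only axiom that is not of type A; it is responsible for the commutativity of the ring.\<close>

locale bracket_system =
  fixes H :: "'n::finite signed_index \<Rightarrow> 'n signed_index \<Rightarrow> 'a set"
    and plus :: "'a \<Rightarrow> 'a \<Rightarrow> 'a" (infixl "\<boxplus>" 65)
    and neg :: "'a \<Rightarrow> 'a"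
    and zero :: 'a
    and br :: "'a \<Rightarrow> 'a \<Rightarrow> 'a" (infixr "\<diamondop>" 70)
  assumes rank: "4 \<le> CARD('n)"
    and plus_closed: "apart i j \<Longrightarrow> x \<in> H i j \<Longrightarrow> y \<in> H i j \<Longrightarrow> x \<boxplus> y \<in> H i j"
    and plus_assoc: "apart i j \<Longrightarrow> x \<in> H i j \<Longrightarrow> y \<in> H i j \<Longrightarrow> z \<in> H i j \<Longrightarrow>
          (x \<boxplus> y) \<boxplus> z = x \<boxplus> (y \<boxplus> z)"
    and plus_commute: "apart i j \<Longrightarrow> x \<in> H i j \<Longrightarrow> y \<in> H i j \<Longrightarrow> x \<boxplus> y = y \<boxplus> x"
    and zero_closed: "apart i j \<Longrightarrow> zero \<in> H i j"
    and zero_plus: "apart i j \<Longrightarrow> x \<in> H i j \<Longrightarrow> zero \<boxplus> x = x"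
    and neg_closed: "apart i j \<Longrightarrow> x \<in> H i j \<Longrightarrow> neg x \<in> H i j"
    and neg_plus: "apart i j \<Longrightarrow> x \<in> H i j \<Longrightarrow> neg x \<boxplus> x = zero"
    and H_flip: "apart i j \<Longrightarrow> H (- j) (- i) = H i j"
    and br_closed: "apart i j \<Longrightarrow> apart j k \<Longrightarrow> apart i k \<Longrightarrow> x \<in> H i j \<Longrightarrow> y \<in> H j k \<Longrightarrow>
          x \<diamondop> y \<in> H i k"
    and br_plus_left: "apart i j \<Longrightarrow> apart j k \<Longrightarrow> apart i k \<Longrightarrow> x \<in> H i j \<Longrightarrow> x' \<in> H i j \<Longrightarrow>
          y \<in> H j k \<Longrightarrow> (x \<boxplus> x') \<diamondop> y = x \<diamondop> y \<boxplus> x' \<diamondop> y"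
    and br_plus_right: "apart i j \<Longrightarrow> apart j k \<Longrightarrow> apart i k \<Longrightarrow> x \<in> H i j \<Longrightarrow> y \<in> H j k \<Longrightarrow>
          y' \<in> H j k \<Longrightarrow> x \<diamondop> (y \<boxplus> y') = x \<diamondop> y \<boxplus> x \<diamondop> y'"
    and br_anti: "apart i j \<Longrightarrow> apart j k \<Longrightarrow> apart i k \<Longrightarrow> x \<in> H i j \<Longrightarrow> y \<in> H j k \<Longrightarrow>
          y \<diamondop> x = neg (x \<diamondop> y)"
    and br_assoc: "apart i j \<Longrightarrow> apart j k \<Longrightarrow> apart i k \<Longrightarrow> apart i l \<Longrightarrow> apart j l \<Longrightarrow> apart k l \<Longrightarrow>
          x \<in> H i j \<Longrightarrow> y \<in> H j k \<Longrightarrow> z \<in> H k l \<Longrightarrow> (x \<diamondop> y) \<diamondop> z = x \<diamondop> (y \<diamondop> z)"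
    and br_swap: "apart j k \<Longrightarrow> apart j l \<Longrightarrow> apart k l \<Longrightarrow> y \<in> H j k \<Longrightarrow> z \<in> H k (- j) \<Longrightarrow>
          x \<in> H (- j) l \<Longrightarrow> y \<diamondop> (z \<diamondop> x) = z \<diamondop> (y \<diamondop> x)"
    and unit_exists: "apart i j \<Longrightarrow> \<exists>u\<in>H i j. \<forall>k. apart k i \<longrightarrow> apart k j \<longrightarrow>
          bij_betw (\<lambda>x. u \<diamondop> x) (H j k) (H i k) \<and> bij_betw (\<lambda>x. x \<diamondop> u) (H k i) (H k j)"
begin

section \<open>Units and natural families of maps\<close>

definition lunit :: "'n signed_index \<Rightarrow> 'n signed_index \<Rightarrow> 'a \<Rightarrow> bool" where
  "lunit i j u \<longleftrightarrow> u \<in> H i j \<and>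
     (\<forall>k. apart k i \<longrightarrow> apart k j \<longrightarrow> bij_betw (\<lambda>x. u \<diamondop> x) (H j k) (H i k))"

text \<open>The two halves of \<open>unit_exists\<close> are separated because generators of the
  groups \<open>H i r\<close> are chosen and rescaled as right units only; that they are left units
  too is recovered in \<open>w_lunit\<close>.\<close>

definition runit :: "'n signed_index \<Rightarrow> 'n signed_index \<Rightarrow> 'a \<Rightarrow> bool" where
  "runit i j u \<longleftrightarrow> u \<in> H i j \<and>
     (\<forall>k. apart k i \<longrightarrow> apart k j \<longrightarrow> bij_betw (\<lambda>x. x \<diamondop> u) (H k i) (H k j))"

text \<open>These are the natural endomorphisms of the partial functor
  \<open>i \<mapsto> H i r\<close>, on which the \<open>H i j\<close> act by composition from the
  left. The components at \<open>r\<close> and \<open>- r\<close> are left arbitrary, so families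
  are only ever compared at indices apart from \<open>r\<close>.\<close>

definition central :: "'n signed_index \<Rightarrow> ('n signed_index \<Rightarrow> 'a \<Rightarrow> 'a) \<Rightarrow> bool" where
  "central r f \<longleftrightarrow>
     (\<forall>i v. apart i r \<longrightarrow> v \<in> H i r \<longrightarrow> f i v \<in> H i r) \<and>
     (\<forall>i j x v. apart i r \<longrightarrow> apart j r \<longrightarrow> apart i j \<longrightarrow> x \<in> H i j \<longrightarrow> v \<in> H j r \<longrightarrow>
        f i (x \<diamondop> v) = x \<diamondop> f j v)"

lemma apart_ex3: "\<exists>l :: 'n signed_index. apart l i \<and> apart l j \<and> apart l k"
  by (rule apart_exists[OF rank])

lemma lunit_ex: "apart i j \<Longrightarrow> \<exists>u. lunit i j u"
  using unit_exists unfolding lunit_def by meson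

lemma runit_ex: "apart i j \<Longrightarrow> \<exists>u. runit i j u"
  using unit_exists unfolding runit_def by meson

lemma lunitD: "lunit i j u \<Longrightarrow> u \<in> H i j"
  by (simp add: lunit_def)

lemma runitD: "runit i j u \<Longrightarrow> u \<in> H i j"
  by (simp add: runit_def)

lemma lunit_div:
  assumes "lunit i j u" "apart k i" "apart k j" "y \<in> H i k"
  shows "\<exists>x\<in>H j k. u \<diamondop> x = y"
  using assms unfolding lunit_def bij_betw_def by (metis (no_types, lifting) imageE)

lemma lunit_cancel:
  assumes "lunit i j u" "apart k i" "apart k j" "x \<in> H j k" "y \<in> H j k" "u \<diamondop> x = u \<diamondop> y"
  shows "x = y"
  using assms unfolding lunit_def bij_betw_def inj_on_def by blast

lemma runit_div:
  assumes "runit i j u" "apart k i" "apart k j" "y \<in> H k j"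
  shows "\<exists>x\<in>H k i. x \<diamondop> u = y"
  using assms unfolding runit_def bij_betw_def by (metis (no_types, lifting) imageE)

lemma runit_cancel:
  assumes "runit i j u" "apart k i" "apart k j" "x \<in> H k i" "y \<in> H k i" "x \<diamondop> u = y \<diamondop> u"
  shows "x = y"
  using assms unfolding runit_def bij_betw_def inj_on_def by blast

lemma centralD1: "central r f \<Longrightarrow> apart i r \<Longrightarrow> v \<in> H i r \<Longrightarrow> f i v \<in> H i r"
  by (simp add: central_def)

lemma centralD2: "central r f \<Longrightarrow> apart i r \<Longrightarrow> apart j r \<Longrightarrow> apart i j \<Longrightarrow> x \<in> H i j \<Longrightarrow> v \<in> H j r \<Longrightarrow>
        f i (x \<diamondop> v) = x \<diamondop> f j v"
  by (simp add: central_def)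

text \<open>Away from the absolute value of \<open>i\<close>, every element of \<open>H k r\<close>
  is of the form \<open>x \<diamondop> w\<close>, and naturality gives the value there.\<close>

lemma central_unique:
  assumes f: "central r f" and g: "central r g" and w: "runit i r w" and ir: "apart i r"
    and eq: "f i w = g i w" and k: "apart k r" and v: "v \<in> H k r"
  shows "f k v = g k v"
proof -
  have *: "f k v = g k v" if k: "apart k r" "apart k i" and v: "v \<in> H k r" for k v
  proof -
    obtain x where x: "x \<in> H k i" "x \<diamondop> w = v" using runit_div[OF w k(2,1) v] by auto
    have "f k v = x \<diamondop> f i w" "g k v = x \<diamondop> g i w"
      using centralD2[OF f k(1) ir k(2) x(1) runitD[OF w]]
        centralD2[OF g k(1) ir k(2) x(1) runitD[OF w]] x(2) by simp_all
    then show ?thesis using eq by simp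
  qed
  \<comment> \<open>Here \<open>k\<close> may be \<open>i\<close> or \<open>- i\<close>; composition
    with a left unit moves the equation to the index \<open>l\<close>, which is apart from
    \<open>i\<close>.\<close>
  obtain l where l: "apart l i" "apart l k" "apart l r" using apart_ex3 by blast
  obtain u where u: "lunit l k u" using lunit_ex l by blast
  have uv: "u \<diamondop> v \<in> H l r" using br_closed[OF l(2) k l(3) lunitD[OF u] v] .
  have "u \<diamondop> f k v = u \<diamondop> g k v"
    using centralD2[OF f l(3) k l(2) lunitD[OF u] v] centralD2[OF g l(3) k l(2) lunitD[OF u] v]
      *[OF l(3,1) uv] by simp
  then show ?thesis
    using lunit_cancel[OF u _ _ centralD1[OF f k v] centralD1[OF g k v]] l k
    by (simp add: apart_commute)
qed

text \<open>Away from \<open>\<plusminus>i\<close> the family \<open>f\<close> is forced by \<open>f k (x \<diamondop> w) = x \<diamondop> a\<close>; the components \<open>\<plusminus>i\<close> are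
  then recovered from any other component.  That \<open>f i w = a\<close> only follows at the end.\<close>

lemma central_exists:
  assumes w: "runit i r w" and ir: "apart i r" and a: "a \<in> H i r"
  shows "\<exists>f. central r f \<and> f i w = a"
proof -
  have wH: "w \<in> H i r" using runitD[OF w] .
  obtain k0 where k0: "apart k0 i" "apart k0 r" using apart_ex3 by blast
  define g where "g k v = (SOME x. x \<in> H k i \<and> x \<diamondop> w = v) \<diamondop> a" for k v
  have g: "g k (x \<diamondop> w) = x \<diamondop> a" if "apart k i" "apart k r" "x \<in> H k i" for k x
  proof -
    have "(SOME y. y \<in> H k i \<and> y \<diamondop> w = x \<diamondop> w) = x"
      using runit_cancel[OF w that(1,2)] that(3) by (intro some_equality) auto
    then show ?thesis by (simp add: g_def)
  qed
  have g_closed: "g k v \<in> H k r" if k: "apart k i" "apart k r" and v: "v \<in> H k r" for k v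
  proof -
    obtain x where x: "x \<in> H k i" "x \<diamondop> w = v" using runit_div[OF w k v] by auto
    show ?thesis using g[OF k x(1)] x br_closed[OF k(1) ir k(2) x(1) a] by simp
  qed
  have g_br: "g k (y \<diamondop> v) = y \<diamondop> g l v"
    if k: "apart k i" "apart k r" and l: "apart l i" "apart l r" and kl: "apart k l"
      and y: "y \<in> H k l" and v: "v \<in> H l r" for k l y v
  proof -
    obtain x where x: "x \<in> H l i" "x \<diamondop> w = v" using runit_div[OF w l v] by auto
    have yx: "y \<diamondop> x \<in> H k i" using br_closed[OF kl l(1) k(1) y x(1)] .
    have "y \<diamondop> v = (y \<diamondop> x) \<diamondop> w"
      using br_assoc[OF kl l(1) k(1) k(2) l(2) ir y x(1) wH] x(2) by simp
    then have "g k (y \<diamondop> v) = (y \<diamondop> x) \<diamondop> a" using g[OF k yx] by simp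
    also have "\<dots> = y \<diamondop> (x \<diamondop> a)" using br_assoc[OF kl l(1) k(1) k(2) l(2) ir y x(1) a] .
    also have "x \<diamondop> a = g l v" using g[OF l x(1)] x(2) by simp
    finally show ?thesis .
  qed
  \<comment> \<open>Only \<open>u i\<close> and \<open>u (- i)\<close> matter: they transport the
    component at \<open>k0\<close> to the two components that \<open>g\<close> does not
    reach.\<close>
  define u where "u k = (SOME u. lunit k k0 u)" for k
  have u: "lunit k k0 (u k)" if "\<not> apart k i" for k
  proof -
    have "apart k k0" using k0 that not_apart_trans by (metis apart_commute)
    then show ?thesis unfolding u_def using lunit_ex by (meson someI_ex)
  qed
  define f where "f k v = (if apart k i then g k v
      else u k \<diamondop> g k0 (SOME v'. v' \<in> H k0 r \<and> u k \<diamondop> v' = v))" for k v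
  have f0: "f k v = g k v" if "apart k i" for k v using that by (simp add: f_def)
  have f1: "f k (u k \<diamondop> v) = u k \<diamondop> g k0 v" if "\<not> apart k i" "v \<in> H k0 r" for k v
  proof -
    have kr: "apart k r" using that ir not_apart_trans by blast
    have "(SOME v'. v' \<in> H k0 r \<and> u k \<diamondop> v' = u k \<diamondop> v) = v"
      using lunit_cancel[OF u[OF that(1)], of r] kr k0(2) that(2)
      by (intro some_equality) (auto simp: apart_commute)
    then show ?thesis using that by (simp add: f_def)
  qed
  \<comment> \<open>The definition of \<open>f\<close> at \<open>i\<close> and \<open>- i\<close>
    refers to the particular index \<open>k0\<close> and unit \<open>u k\<close>. This claim frees
    it from both choices.\<close>
  have f2: "f k (y \<diamondop> v) = y \<diamondop> g l v"
    if ki: "\<not> apart k i" and l: "apart l i" "apart l r"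
      and y: "y \<in> H k l" and v: "v \<in> H l r" for k l y v
  proof -
    have kr: "apart k r" using ki ir not_apart_trans by blast
    have ap: "apart k m" if "apart m i" for m
      using ki not_apart_trans that by (metis apart_commute)
    \<comment> \<open>If the rule holds for one left unit \<open>y0\<close> ending at
      \<open>l\<close>, it holds for every element ending at an index \<open>m\<close> apart from
      \<open>l\<close>, because such an element factors through \<open>y0\<close>.\<close>
    have step: "f k (y \<diamondop> v) = y \<diamondop> g m v"
      if l: "apart l i" "apart l r" and y0: "lunit k l y0"
        and IH: "\<And>v. v \<in> H l r \<Longrightarrow> f k (y0 \<diamondop> v) = y0 \<diamondop> g l v"
        and m: "apart m i" "apart m r" "apart l m" and y: "y \<in> H k m" and v: "v \<in> H m r"
      for l y0 m y v
    proof -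
      obtain t where t: "t \<in> H l m" "y0 \<diamondop> t = y"
        using lunit_div[OF y0 _ _ y] m ap[OF m(1)] by (auto simp: apart_commute)
      have y0H: "y0 \<in> H k l" using lunitD[OF y0] .
      have tv: "t \<diamondop> v \<in> H l r" using br_closed[OF m(3,2) l(2) t(1) v] .
      have "y \<diamondop> v = y0 \<diamondop> (t \<diamondop> v)"
        using br_assoc[OF ap[OF l(1)] m(3) ap[OF m(1)] kr l(2) m(2) y0H t(1) v] t(2) by simp
      then have "f k (y \<diamondop> v) = y0 \<diamondop> g l (t \<diamondop> v)" using IH[OF tv] by simp
      also have "\<dots> = y0 \<diamondop> (t \<diamondop> g m v)" using g_br[OF l m(1,2,3) t(1) v] by simp
      also have "\<dots> = y \<diamondop> g m v"
        using br_assoc[OF ap[OF l(1)] m(3) ap[OF m(1)] kr l(2) m(2) y0H t(1) g_closed[OF m(1,2) v]]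
          t(2) by simp
      finally show ?thesis .
    qed
    \<comment> \<open>A single move by \<open>step\<close> never reaches an index with the absolute
      value of the starting one. For such an \<open>l\<close> two moves through \<open>l'\<close>
      are made.\<close>
    obtain l' where l': "apart l' i" "apart l' r" "apart l' k0" using apart_ex3 by blast
    show ?thesis
    proof (cases "apart k0 l")
      case True
      show ?thesis using step[OF k0 u[OF ki] f1[OF ki] l True y v] by simp
    next
      case False
      obtain y1 where y1: "lunit k l' y1" using lunit_ex ap[OF l'(1)] by blast
      have "f k (y1 \<diamondop> v) = y1 \<diamondop> g l' v" if "v \<in> H l' r" for v
        using step[OF k0 u[OF ki] f1[OF ki] l'(1,2) _ lunitD[OF y1] that] l'(3)
        by (simp add: apart_commute)
      moreover have "apart l' l" using False l'(3) not_apart_trans by (metis apart_commute)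
      ultimately show ?thesis using step[OF l'(1,2) y1 _ l _ y v] by simp
    qed
  qed
  have f_closed: "f k v \<in> H k r" if k: "apart k r" and v: "v \<in> H k r" for k v
  proof (cases "apart k i")
    case True
    then show ?thesis using g_closed[OF True k v] f0 by simp
  next
    case False
    have kk0: "apart k k0" using False k0(1) not_apart_trans by (metis apart_commute)
    obtain v' where v': "v' \<in> H k0 r" "u k \<diamondop> v' = v"
      using lunit_div[OF u[OF False] _ _ v] k k0 by (auto simp: apart_commute)
    show ?thesis
      using f1[OF False v'(1)] v'(2) br_closed[OF kk0 k0(2) k lunitD[OF u[OF False]] g_closed[OF k0 v'(1)]]
      by simp
  qed
  have f_br: "f k (y \<diamondop> v) = y \<diamondop> f l v"
    if k: "apart k r" and l: "apart l r" and kl: "apart k l"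
      and y: "y \<in> H k l" and v: "v \<in> H l r" for k l y v
  proof (cases "apart l i")
    case li: True
    show ?thesis
      using f2[OF _ li l y v] g_br[OF _ k li l kl y v] f0[OF li] f0[of k] by (cases "apart k i") auto
  next
    case li: False
    have ki: "apart k i" using li kl not_apart_trans by (metis apart_commute)
    \<comment> \<open>Now \<open>l\<close> is \<open>i\<close> or \<open>- i\<close>, hence
      \<open>f k\<close> is \<open>g k\<close>. Writing \<open>v\<close> as a composite through
      \<open>m\<close> reduces the right-hand side to \<open>f2\<close> and the left-hand side to
      naturality of \<open>g\<close>.\<close>
    obtain m where m: "apart m i" "apart m r" "apart m k" using apart_ex3 by blast
    have lm: "apart l m" using li m(1) not_apart_trans by (metis apart_commute)
    obtain z where z: "lunit l m z" using lunit_ex[OF lm] by blast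
    obtain v' where v': "v' \<in> H m r" "z \<diamondop> v' = v"
      using lunit_div[OF z _ _ v] l m by (auto simp: apart_commute)
    have km: "apart k m" using m by (simp add: apart_commute)
    have zH: "z \<in> H l m" using lunitD[OF z] .
    have yz: "y \<diamondop> z \<in> H k m" using br_closed[OF kl lm km y zH] .
    have "y \<diamondop> v = (y \<diamondop> z) \<diamondop> v'"
      using br_assoc[OF kl lm km k l m(2) y zH v'(1)] v'(2) by simp
    then have "f k (y \<diamondop> v) = (y \<diamondop> z) \<diamondop> g m v'"
      using f0[OF ki] g_br[OF ki k m(1,2) km yz v'(1)] by simp
    also have "\<dots> = y \<diamondop> (z \<diamondop> g m v')"
      using br_assoc[OF kl lm km k l m(2) y zH g_closed[OF m(1,2) v'(1)]] .
    also have "z \<diamondop> g m v' = f l v" using f2[OF li m(1,2) zH v'(1)] v'(2) by simp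
    finally show ?thesis .
  qed
  have fc: "central r f" unfolding central_def using f_closed f_br by blast
  \<comment> \<open>The value at \<open>w\<close> itself lies in one of the recovered components;
    composition with \<open>x\<close> moves it to \<open>k0\<close>, where it was
    prescribed.\<close>
  obtain x where x: "lunit k0 i x" using lunit_ex[OF k0(1)] by blast
  have "x \<diamondop> f i w = x \<diamondop> a"
    using centralD2[OF fc k0(2) ir k0(1) lunitD[OF x] wH] f0[OF k0(1)] g[OF k0 lunitD[OF x]] by simp
  then have "f i w = a"
    using lunit_cancel[OF x _ _ centralD1[OF fc ir wH] a] k0 ir by (simp add: apart_commute)
  with fc show ?thesis by blast
qed

section \<open>Additive rules, and operations on natural families\<close>

lemma plus_zero: "apart i j \<Longrightarrow> x \<in> H i j \<Longrightarrow> x \<boxplus> zero = x"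
  using plus_commute zero_closed zero_plus by metis

lemma plus_neg: "apart i j \<Longrightarrow> x \<in> H i j \<Longrightarrow> x \<boxplus> neg x = zero"
  using plus_commute neg_closed neg_plus by metis

lemma plus_cancel:
  assumes "apart i j" "x \<in> H i j" "y \<in> H i j" "z \<in> H i j" "x \<boxplus> y = x \<boxplus> z"
  shows "y = z"
proof -
  have "neg x \<boxplus> (x \<boxplus> y) = neg x \<boxplus> (x \<boxplus> z)" using assms by simp
  then show ?thesis
    using plus_assoc[OF assms(1) neg_closed[OF assms(1,2)] assms(2)] neg_plus[OF assms(1,2)]
      zero_plus[OF assms(1)] assms(3,4) by simp
qed

lemma neg_unique:
  assumes "apart i j" "x \<in> H i j" "y \<in> H i j" "y \<boxplus> x = zero"
  shows "y = neg x"
  using plus_cancel[OF assms(1,2,3) neg_closed[OF assms(1,2)]] plus_neg[OF assms(1,2)] assms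
    plus_commute[OF assms(1,2,3)] by simp

lemma neg_neg: "apart i j \<Longrightarrow> x \<in> H i j \<Longrightarrow> neg (neg x) = x"
  using neg_unique neg_closed plus_neg by metis

lemma neg_add:
  assumes ij: "apart i j" and x: "x \<in> H i j" and y: "y \<in> H i j"
  shows "neg (x \<boxplus> y) = neg x \<boxplus> neg y"
proof (rule neg_unique[OF ij, symmetric])
  note cl = neg_closed[OF ij x] neg_closed[OF ij y]
  have "neg x \<boxplus> neg y \<boxplus> (x \<boxplus> y) = neg x \<boxplus> (neg y \<boxplus> (y \<boxplus> x))"
    using plus_assoc[OF ij cl(1) cl(2)] plus_closed[OF ij x y] plus_commute[OF ij x y] by simp
  also have "\<dots> = neg x \<boxplus> x"
    using plus_assoc[OF ij cl(2) y x] neg_plus[OF ij y] zero_plus[OF ij x] by simp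
  finally show "neg x \<boxplus> neg y \<boxplus> (x \<boxplus> y) = zero" using neg_plus[OF ij x] by simp
qed (use assms neg_closed plus_closed in auto)

lemma br_zero_right:
  assumes "apart i j" "apart j k" "apart i k" "x \<in> H i j"
  shows "x \<diamondop> zero = zero"
proof -
  note z = zero_closed[OF assms(2)]
  have c: "x \<diamondop> zero \<in> H i k" using br_closed[OF assms z] .
  have "x \<diamondop> zero \<boxplus> x \<diamondop> zero = x \<diamondop> zero \<boxplus> zero"
    using br_plus_right[OF assms z z] zero_plus[OF assms(2) z] plus_zero[OF assms(3) c] by simp
  then show ?thesis using plus_cancel[OF assms(3) c c zero_closed[OF assms(3)]] by simp
qed

lemma br_neg_right:
  assumes "apart i j" "apart j k" "apart i k" "x \<in> H i j" "y \<in> H j k"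
  shows "x \<diamondop> neg y = neg (x \<diamondop> y)"
proof (rule neg_unique[OF assms(3)])
  note n = neg_closed[OF assms(2,5)]
  show "x \<diamondop> neg y \<boxplus> x \<diamondop> y = zero"
    using br_plus_right[OF assms(1-4) n assms(5)] neg_plus[OF assms(2,5)]
      br_zero_right[OF assms(1-4)] by simp
qed (use assms br_closed neg_closed in blast)+

lemma br_zero_left:
  assumes "apart i j" "apart j k" "apart i k" "y \<in> H j k"
  shows "zero \<diamondop> y = zero"
proof -
  note z = zero_closed[OF assms(1)]
  have c: "zero \<diamondop> y \<in> H i k" using br_closed[OF assms(1-3) z assms(4)] .
  have "zero \<diamondop> y \<boxplus> zero \<diamondop> y = zero \<diamondop> y \<boxplus> zero"
    using br_plus_left[OF assms(1-3) z z assms(4)] zero_plus[OF assms(1) z] plus_zero[OF assms(3) c]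
    by simp
  then show ?thesis using plus_cancel[OF assms(3) c c zero_closed[OF assms(3)]] by simp
qed

lemma br_neg_left:
  assumes "apart i j" "apart j k" "apart i k" "x \<in> H i j" "y \<in> H j k"
  shows "neg x \<diamondop> y = neg (x \<diamondop> y)"
proof (rule neg_unique[OF assms(3)])
  note n = neg_closed[OF assms(1,4)]
  show "neg x \<diamondop> y \<boxplus> x \<diamondop> y = zero"
    using br_plus_left[OF assms(1-3) n assms(4,5)] neg_plus[OF assms(1,4)]
      br_zero_left[OF assms(1-3,5)] by simp
qed (use assms br_closed neg_closed in blast)+

lemma central_comp: "central r f \<Longrightarrow> central r g \<Longrightarrow> central r (\<lambda>i v. f i (g i v))"
  unfolding central_def by simp

lemma central_id: "central r (\<lambda>i v. v)"
  unfolding central_def by simp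

lemma central_plus: "central r f \<Longrightarrow> central r g \<Longrightarrow> central r (\<lambda>i v. f i v \<boxplus> g i v)"
  unfolding central_def using plus_closed br_plus_right by simp

lemma central_zero: "central r (\<lambda>i v. zero)"
  unfolding central_def using zero_closed br_zero_right by simp

text \<open>Put \<open>t = y \<diamondop> (z \<diamondop> w)\<close>. The map \<open>f\<close> is
  imitated by replacing \<open>y\<close> with a \<open>y'\<close> such that
  \<open>y' \<diamondop> w\<close> is the value of \<open>f\<close> at
  \<open>y \<diamondop> w\<close>, and \<open>g\<close> by a similar \<open>z'\<close>. Evaluating
  \<open>y' \<diamondop> (z' \<diamondop> w)\<close> directly gives \<open>g (f t)\<close>,
  evaluating it after \<open>br_swap\<close> gives \<open>f (g t)\<close>.\<close>

lemma central_commute: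
  assumes f: "central r f" and g: "central r g" and i: "apart i r" and v: "v \<in> H i r"
  shows "f i (g i v) = g i (f i v)"
proof -
  obtain j where j: "apart j r" using apart_ex3 by blast
  obtain k where k: "apart k j" "apart k r" using apart_ex3 by blast
  have jk: "apart j k" using k by (simp add: apart_commute)
  obtain w where w: "runit (- j) r w" using runit_ex j by fastforce
  have wH: "w \<in> H (- j) r" using runitD[OF w] .
  obtain y where y: "lunit j k y" using lunit_ex jk by blast
  obtain z where z: "lunit k (- j) z" using lunit_ex k(1) by fastforce
  have yH: "y \<in> H j k" using lunitD[OF y] .
  have zH: "z \<in> H k (- j)" using lunitD[OF z] .
  have flip: "H (- k) (- j) = H j k" "H j (- k) = H k (- j)"
    using H_flip[OF jk] H_flip[of k "- j"] k by auto
  have nj: "apart (- j) r" and nk: "apart (- k) r" and kj: "apart k (- j)" and nkj: "apart (- k) (- j)"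
    and jnk: "apart j (- k)"
    using j k jk by auto
  note ynk = centralD2[OF _ nk nj nkj]
  note swap = br_swap[OF jk j k(2)]
  have yw: "y \<diamondop> w \<in> H (- k) r" using br_closed[OF nkj nj nk _ wH] yH flip by simp
  have zw: "z \<diamondop> w \<in> H k r" using br_closed[OF kj nj k(2) zH wH] .
  obtain y' where y': "y' \<in> H j k" "y' \<diamondop> w = f (- k) (y \<diamondop> w)"
    using runit_div[OF w nkj nk centralD1[OF f nk yw]] flip by auto
  obtain z' where z': "z' \<in> H k (- j)" "z' \<diamondop> w = g k (z \<diamondop> w)"
    using runit_div[OF w kj k(2) centralD1[OF g k(2) zw]] by auto
  define t where "t = y \<diamondop> (z \<diamondop> w)"
  have tH: "t \<in> H j r" unfolding t_def by (rule br_closed[OF jk k(2) j yH zw])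
  have "y' \<diamondop> (z \<diamondop> w) = z \<diamondop> (y' \<diamondop> w)" using swap[OF y'(1) zH wH] .
  also have "\<dots> = f j (z \<diamondop> (y \<diamondop> w))"
    using centralD2[OF f j nk jnk _ yw, of z] zH flip y'(2) by simp
  also have "z \<diamondop> (y \<diamondop> w) = t" unfolding t_def using swap[OF yH zH wH] by simp
  finally have y'zw: "y' \<diamondop> (z \<diamondop> w) = f j t" .
  have "y' \<diamondop> (z' \<diamondop> w) = g j (f j t)"
    using centralD2[OF g j k(2) jk y'(1) zw] z'(2) y'zw by simp
  moreover have "y' \<diamondop> (z' \<diamondop> w) = f j (g j t)"
  proof -
    have "y' \<diamondop> (z' \<diamondop> w) = z' \<diamondop> (y' \<diamondop> w)" using swap[OF y'(1) z'(1) wH] .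
    also have "\<dots> = f j (z' \<diamondop> (y \<diamondop> w))"
      using centralD2[OF f j nk jnk _ yw, of z'] z'(1) flip y'(2) by simp
    also have "z' \<diamondop> (y \<diamondop> w) = y \<diamondop> (z' \<diamondop> w)" using swap[OF yH z'(1) wH] by simp
    also have "\<dots> = g j t"
      unfolding t_def using centralD2[OF g j k(2) jk yH zw] z'(2) by simp
    finally show ?thesis .
  qed
  ultimately have eq: "f j (g j t) = g j (f j t)" by simp
  note fg = central_comp[OF f g] and gf = central_comp[OF g f]
  \<comment> \<open>Since \<open>y\<close> and \<open>z\<close> are left units, the equation at
    \<open>t\<close> descends to the right unit \<open>w\<close>, whose value determines the whole
    family.\<close>
  have *: "h j t = y \<diamondop> (z \<diamondop> h (- j) w)" if "central r h" for h
    unfolding t_def using centralD2[OF that j k(2) jk yH zw] centralD2[OF that k(2) nj kj zH wH] by simp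
  have "y \<diamondop> (z \<diamondop> f (- j) (g (- j) w)) = y \<diamondop> (z \<diamondop> g (- j) (f (- j) w))"
    using *[OF fg] *[OF gf] eq by simp
  then have "z \<diamondop> f (- j) (g (- j) w) = z \<diamondop> g (- j) (f (- j) w)"
    using lunit_cancel[OF y, of r] j k(2) br_closed[OF kj nj k(2) zH]
      centralD1[OF fg nj wH] centralD1[OF gf nj wH] by (simp add: apart_commute)
  then have "f (- j) (g (- j) w) = g (- j) (f (- j) w)"
    using lunit_cancel[OF z, of r] nj k(2)
      centralD1[OF fg nj wH] centralD1[OF gf nj wH] by (simp add: apart_commute)
  from central_unique[OF fg gf w nj this i v] show ?thesis .
qed

end

section \<open>The coordinate ring\<close>

locale pointed_bracket_system = bracket_system H plus neg zero br
  for H :: "'n::finite signed_index \<Rightarrow> 'n signed_index \<Rightarrow> 'a set"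
    and plus (infixl "\<boxplus>" 65) and neg and zero and br (infixr "\<diamondop>" 70) +
  fixes r s :: "'n signed_index" and w0 :: 'a
  assumes sr: "apart s r" and w0: "runit s r w0"
begin

definition act :: "'a \<Rightarrow> 'n signed_index \<Rightarrow> 'a \<Rightarrow> 'a" where
  "act a = (SOME f. central r f \<and> f s w0 = a)"

text \<open>A natural family is encoded by its value at \<open>w0\<close>, which can be any element
  of \<open>H s r\<close>. This makes the ring live on a subset of \<open>'a\<close>, with
  \<open>w0\<close> as unit; the product is composition of families, since \<open>act a s b\<close>
  is the value at \<open>w0\<close> of the family of \<open>a\<close> applied after that of
  \<open>b\<close>.\<close>

definition K :: "'a ring" where
  "K = \<lparr>carrier = H s r, mult = (\<lambda>a b. act a s b), one = w0, zero = zero, add = plus\<rparr>"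

lemma K_simps: "carrier K = H s r" "\<one>\<^bsub>K\<^esub> = w0" "\<zero>\<^bsub>K\<^esub> = zero" "a \<oplus>\<^bsub>K\<^esub> b = a \<boxplus> b"
  "a \<otimes>\<^bsub>K\<^esub> b = act a s b"
  by (simp_all add: K_def)

lemma w0_closed: "w0 \<in> H s r"
  using runitD[OF w0] .

lemma act:
  assumes "a \<in> carrier K"
  shows "central r (act a)" "act a s w0 = a"
  using someI_ex[OF central_exists[OF w0 sr, of a]] assms unfolding act_def by (auto simp: K_simps)

lemma central_closed: "central r f \<Longrightarrow> f s w0 \<in> carrier K"
  using centralD1[OF _ sr w0_closed] by (simp add: K_simps)

lemma act_eqI:
  assumes "central r f" "apart i r" "v \<in> H i r"
  shows "act (f s w0) i v = f i v"
proof -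
  note c = central_closed[OF assms(1)]
  show ?thesis using central_unique[OF act(1)[OF c] assms(1) w0 sr act(2)[OF c] assms(2,3)] .
qed

lemma act_closed: "a \<in> carrier K \<Longrightarrow> apart i r \<Longrightarrow> v \<in> H i r \<Longrightarrow> act a i v \<in> H i r"
  using centralD1 act by blast

lemma act_br:
  "a \<in> carrier K \<Longrightarrow> apart i r \<Longrightarrow> apart j r \<Longrightarrow> apart i j \<Longrightarrow> x \<in> H i j \<Longrightarrow> v \<in> H j r \<Longrightarrow>
    x \<diamondop> act a j v = act a i (x \<diamondop> v)"
  using centralD2 act by metis

lemma act_one: "apart i r \<Longrightarrow> v \<in> H i r \<Longrightarrow> act \<one>\<^bsub>K\<^esub> i v = v"
  using act_eqI[OF central_id] by (simp add: K_simps)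

lemma act_zero: "apart i r \<Longrightarrow> v \<in> H i r \<Longrightarrow> act \<zero>\<^bsub>K\<^esub> i v = zero"
  using act_eqI[OF central_zero] by (simp add: K_simps)

lemma act_add:
  "a \<in> carrier K \<Longrightarrow> b \<in> carrier K \<Longrightarrow> apart i r \<Longrightarrow> v \<in> H i r \<Longrightarrow>
    act (a \<oplus>\<^bsub>K\<^esub> b) i v = act a i v \<boxplus> act b i v"
  using act_eqI[OF central_plus[OF act(1) act(1)], of a b] act(2) by (simp add: K_simps)

lemma act_mult:
  "a \<in> carrier K \<Longrightarrow> b \<in> carrier K \<Longrightarrow> apart i r \<Longrightarrow> v \<in> H i r \<Longrightarrow>
    act (a \<otimes>\<^bsub>K\<^esub> b) i v = act a i (act b i v)"
  using act_eqI[OF central_comp[OF act(1) act(1)], of a b] act(2) by (simp add: K_simps)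

lemma act_commute:
  "a \<in> carrier K \<Longrightarrow> b \<in> carrier K \<Longrightarrow> apart i r \<Longrightarrow> v \<in> H i r \<Longrightarrow> act a i (act b i v) = act b i (act a i v)"
  using central_commute[OF act(1) act(1)] by blast

text \<open>Associativity is composition of families and distributivity in the first factor is their
  pointwise sum; distributivity in the second factor comes with commutativity.\<close>

lemma cring_K: "cring K"
proof (rule cringI)
  show "abelian_group K"
  proof (rule abelian_groupI)
    show "\<exists>y\<in>carrier K. y \<oplus>\<^bsub>K\<^esub> x = \<zero>\<^bsub>K\<^esub>" if "x \<in> carrier K" for x
      using that neg_closed[OF sr] neg_plus[OF sr] by (auto simp: K_simps)
  qed (use sr plus_closed zero_closed plus_assoc plus_commute zero_plus in \<open>auto simp: K_simps\<close>)
  have m_closed: "x \<otimes>\<^bsub>K\<^esub> y \<in> carrier K" if "x \<in> carrier K" "y \<in> carrier K" for x y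
    using act_closed[OF that(1) sr, of y] that(2) by (simp add: K_simps)
  show "comm_monoid K"
  proof (rule comm_monoidI)
    fix x y z assume x: "x \<in> carrier K" and y: "y \<in> carrier K"
    show "x \<otimes>\<^bsub>K\<^esub> y \<in> carrier K" using m_closed[OF x y] .
    show "x \<otimes>\<^bsub>K\<^esub> y = y \<otimes>\<^bsub>K\<^esub> x"
      using act_commute[OF x y sr w0_closed] act(2)[OF x] act(2)[OF y] by (simp add: K_simps)
    show "\<one>\<^bsub>K\<^esub> \<otimes>\<^bsub>K\<^esub> x = x" using act_one[OF sr] x by (simp add: K_simps)
    assume z: "z \<in> carrier K"
    show "x \<otimes>\<^bsub>K\<^esub> y \<otimes>\<^bsub>K\<^esub> z = x \<otimes>\<^bsub>K\<^esub> (y \<otimes>\<^bsub>K\<^esub> z)"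
      using act_mult[OF x y sr] z by (simp add: K_simps)
  qed (simp add: K_simps w0_closed)
  show "(x \<oplus>\<^bsub>K\<^esub> y) \<otimes>\<^bsub>K\<^esub> z = x \<otimes>\<^bsub>K\<^esub> z \<oplus>\<^bsub>K\<^esub> y \<otimes>\<^bsub>K\<^esub> z"
    if "x \<in> carrier K" "y \<in> carrier K" "z \<in> carrier K" for x y z
    using act_add[OF that(1,2) sr] that(3) by (simp add: K_simps)
qed

sublocale K: cring K
  by (rule cring_K)

lemma act_neg:
  assumes a: "a \<in> carrier K" and i: "apart i r" and v: "v \<in> H i r"
  shows "act (\<ominus>\<^bsub>K\<^esub> a) i v = neg (act a i v)"
proof (rule neg_unique[OF i])
  show "act (\<ominus>\<^bsub>K\<^esub> a) i v \<boxplus> act a i v = zero"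
    using act_add[OF _ a i v, of "\<ominus>\<^bsub>K\<^esub> a"] a act_zero[OF i v] by (simp add: K.l_neg)
qed (use assms act_closed in simp_all)

text \<open>Together with \<open>act_cancel\<close>: \<open>H i r\<close> is a free module of rank
  one over \<open>K\<close>, with any right unit as a basis.\<close>

lemma act_exists:
  assumes "runit i r w" "apart i r" "v \<in> H i r"
  shows "\<exists>a\<in>carrier K. act a i w = v"
proof -
  obtain f where f: "central r f" "f i w = v" using central_exists[OF assms] by blast
  show ?thesis
    using act_eqI[OF f(1) assms(2) runitD[OF assms(1)]] f(2) central_closed[OF f(1)] by blast
qed

lemma act_cancel:
  assumes "runit i r w" "apart i r" "a \<in> carrier K" "b \<in> carrier K" "act a i w = act b i w"
  shows "a = b"
  using central_unique[OF act(1) act(1) assms(1,2,5) sr w0_closed] assms(3,4) act(2) by simp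

end

section \<open>Cocycles of units on the signed indices\<close>

lemma (in monoid) Units_cancel:
  "u \<in> Units G \<Longrightarrow> x \<in> carrier G \<Longrightarrow> y \<in> carrier G \<Longrightarrow> u \<otimes> x = u \<otimes> y \<Longrightarrow> x = y"
  by (simp add: Units_l_cancel)

lemma (in comm_monoid) UnitsI:
  "x \<in> carrier G \<Longrightarrow> y \<in> carrier G \<Longrightarrow> x \<otimes> y = \<one> \<Longrightarrow> x \<in> Units G"
  unfolding Units_def using m_comm[of x y] by auto

lemma (in comm_monoid) cocycle_trivial:
  fixes u :: "'n signed_index \<Rightarrow> 'n signed_index \<Rightarrow> 'a"
  assumes S: "p \<in> S" "\<And>i j. i \<in> S \<Longrightarrow> j \<in> S \<Longrightarrow> \<exists>m\<in>S. apart m i \<and> apart m j"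
    and u: "\<And>i j. i \<in> S \<Longrightarrow> j \<in> S \<Longrightarrow> apart i j \<Longrightarrow> u i j \<in> Units G"
    and cocycle: "\<And>i j k. i \<in> S \<Longrightarrow> j \<in> S \<Longrightarrow> k \<in> S \<Longrightarrow> apart i j \<Longrightarrow> apart j k \<Longrightarrow> apart i k \<Longrightarrow>
      u i j \<otimes> u j k = u i k"
  shows "\<exists>a. (\<forall>i\<in>S. a i \<in> Units G) \<and> (\<forall>i\<in>S. \<forall>j\<in>S. apart i j \<longrightarrow> u i j \<otimes> a j = a i)"
proof -
  obtain m where m: "m \<in> S" "apart m p" using S by blast
  have uc: "u i j \<in> carrier G" if "i \<in> S" "j \<in> S" "apart i j" for i j
    using u[OF that] Units_closed by blast
  \<comment> \<open>The cocycle identity does not speak of the triple \<open>i, j, i\<close>; a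
    third index \<open>k\<close> and cancellation of \<open>u i k\<close> replace it.\<close>
  have inverse: "u i j \<otimes> u j i = \<one>" if ij: "i \<in> S" "j \<in> S" "apart i j" for i j
  proof -
    obtain k where k: "k \<in> S" "apart k i" "apart k j" using S(2) ij by blast
    have ji: "apart j i" and ik: "apart i k" and jk: "apart j k"
      using ij k by (simp_all add: apart_commute)
    have "u i k = u i j \<otimes> (u j i \<otimes> u i k)"
      using cocycle[OF ij(1,2) k(1) ij(3) jk ik] cocycle[OF ij(2,1) k(1) ji ik jk] by simp
    then have "u i k \<otimes> \<one> = u i k \<otimes> (u i j \<otimes> u j i)"
      using uc[OF ij] uc[OF ij(2,1) ji] uc[OF ij(1) k(1) ik] by (simp add: m_ac)
    from Units_cancel[OF u[OF ij(1) k(1) ik] _ _ this] show ?thesis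
      using uc[OF ij] uc[OF ij(2,1) ji] by simp
  qed
  define a where "a i = (if i = p then \<one> else if apart i p then u i p else u i m \<otimes> u m p)" for i
  have a_p: "a p = \<one>" and a_apart: "\<And>i. apart i p \<Longrightarrow> a i = u i p"
    by (auto simp: a_def)
  \<comment> \<open>Here \<open>i\<close> is \<open>- p\<close>. The product through an intermediate
    index does not depend on that index: apart indices are compared by the cocycle identity, and
    indices of equal absolute value with a third one.\<close>
  have a_opp: "a i = u i k \<otimes> u k p"
    if i: "i \<in> S" "i \<noteq> p" "\<not> apart i p" and k: "k \<in> S" "apart k p" for i k
  proof -
    have ap: "apart i l" if "apart l p" for l
      using i(3) that not_apart_trans by (metis apart_commute)
    have step: "u i k \<otimes> u k p = u i l \<otimes> u l p"
      if kl: "apart k l" and k: "k \<in> S" "apart k p" and l: "l \<in> S" "apart l p" for k l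
    proof -
      have "u i k \<otimes> u k p = u i k \<otimes> (u k l \<otimes> u l p)"
        using cocycle[OF k(1) l(1) S(1) kl l(2) k(2)] by simp
      also have "\<dots> = (u i k \<otimes> u k l) \<otimes> u l p"
        using uc[OF i(1) k(1) ap[OF k(2)]] uc[OF k(1) l(1) kl] uc[OF l(1) S(1) l(2)]
        by (simp add: m_assoc)
      also have "u i k \<otimes> u k l = u i l"
        using cocycle[OF i(1) k(1) l(1) ap[OF k(2)] kl ap[OF l(2)]] .
      finally show ?thesis .
    qed
    show ?thesis
    proof (cases "apart k m")
      case True
      then show ?thesis using step[OF True k m] i by (simp add: a_def)
    next
      case False
      obtain l where l: "l \<in> S" "apart l m" "apart l p" using S(2) m(1) S(1) by blast
      have kl: "apart k l" using False l(2) not_apart_trans by (metis apart_commute)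
      show ?thesis using step[OF kl k l(1,3)] step[OF l(2) l(1,3) m] i by (simp add: a_def)
    qed
  qed
  have a_unit: "a i \<in> Units G" if "i \<in> S" for i
    using that u[OF that S(1)] u[OF that m(1)] u[OF m(1) S(1)] m not_apart_trans[of i p m]
    by (auto simp: a_def apart_commute intro: Units_m_closed)
  have "u i j \<otimes> a j = a i" if ij: "i \<in> S" "j \<in> S" "apart i j" for i j
  proof -
    consider "apart i p" "apart j p" | "i = p" | "j = p" | "i \<noteq> p" "\<not> apart i p" | "j \<noteq> p" "\<not> apart j p"
      by blast
    then show ?thesis
    proof cases
      case 1
      then show ?thesis using cocycle[OF ij(1,2) S(1) ij(3)] a_apart by simp
    next
      case 2
      then show ?thesis using inverse[OF ij] ij a_apart[of j] a_p by (simp add: apart_commute)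
    next
      case 3
      then show ?thesis using uc[OF ij] ij a_apart[of i] a_p by simp
    next
      case 4
      then have "apart j p" using not_apart_trans ij(3) by (metis apart_commute)
      then show ?thesis using a_opp[OF ij(1) 4 ij(2)] a_apart by simp
    next
      case 5
      then have ip: "apart i p" using not_apart_trans ij(3) by (metis apart_commute)
      obtain k where k: "k \<in> S" "apart k i" "apart k p" using S(2)[OF ij(1) S(1)] by blast
      have jk: "apart j k" using 5 k(3) not_apart_trans by (metis apart_commute)
      have ik: "apart i k" using k(2) by (simp add: apart_commute)
      have "u i j \<otimes> a j = (u i j \<otimes> u j k) \<otimes> u k p"
        using a_opp[OF ij(2) 5 k(1,3)] uc[OF ij] uc[OF ij(2) k(1) jk] uc[OF k(1) S(1) k(3)]
        by (simp add: m_assoc)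
      also have "\<dots> = u i p"
        using cocycle[OF ij(1,2) k(1) ij(3) jk ik] cocycle[OF ij(1) k(1) S(1) ik k(3) ip] by simp
      finally show ?thesis using a_apart[OF ip] by simp
    qed
  qed
  with a_unit show ?thesis by blast
qed

context pointed_bracket_system
begin

section \<open>Coordinates at indices apart from \<open>r\<close>\<close>

definition gens :: "('n signed_index \<Rightarrow> 'a) \<Rightarrow> bool" where
  "gens w \<longleftrightarrow> (\<forall>i. apart i r \<longrightarrow> runit i r (w i))"

lemma gensD: "gens w \<Longrightarrow> apart i r \<Longrightarrow> runit i r (w i)" "gens w \<Longrightarrow> apart i r \<Longrightarrow> w i \<in> H i r"
  by (auto simp: gens_def runit_def)

lemma gens_exist: "\<exists>w. gens w"
proof -
  have "gens (\<lambda>i. SOME w. runit i r w)"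
    unfolding gens_def using runit_ex by (auto intro: someI_ex)
  then show ?thesis by blast
qed

text \<open>Scalars pass through the bracket, so right composition with the rescaled element is
  right composition with \<open>w i\<close> followed by an invertible scalar.\<close>

lemma gens_rescale:
  assumes w: "gens w" and a: "\<And>i. apart i r \<Longrightarrow> a i \<in> Units K"
  shows "gens (\<lambda>i. act (a i) i (w i))"
  unfolding gens_def runit_def
proof (intro allI impI conjI)
  fix i assume i: "apart i r"
  have ai: "a i \<in> carrier K" using a[OF i] by blast
  show "act (a i) i (w i) \<in> H i r" using act_closed[OF ai i gensD(2)[OF w i]] .
  fix k assume ki: "apart k i" and kr: "apart k r"
  have inv: "inv\<^bsub>K\<^esub> a i \<in> carrier K" using a[OF i] by blast
  have 1: "act (inv\<^bsub>K\<^esub> a i) k (act (a i) k v) = v" "act (a i) k (act (inv\<^bsub>K\<^esub> a i) k v) = v"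
    if "v \<in> H k r" for v
    using act_mult[OF ai inv kr that] act_mult[OF inv ai kr that] a[OF i] act_one[OF kr that] by simp_all
  have "bij_betw (act (a i) k) (H k r) (H k r)"
    using act_closed[OF ai kr] act_closed[OF inv kr] 1
    by (intro bij_betwI[where g = "act (inv\<^bsub>K\<^esub> a i) k"]) auto
  moreover have "bij_betw (\<lambda>x. x \<diamondop> w i) (H k i) (H k r)"
    using gensD(1)[OF w i] ki kr by (simp add: runit_def)
  ultimately have "bij_betw (act (a i) k \<circ> (\<lambda>x. x \<diamondop> w i)) (H k i) (H k r)"
    by (rule bij_betw_trans[rotated])
  moreover have "x \<diamondop> act (a i) i (w i) = (act (a i) k \<circ> (\<lambda>x. x \<diamondop> w i)) x" if "x \<in> H k i" for x
    using act_br[OF ai kr i ki that gensD(2)[OF w i]] by simp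
  ultimately show "bij_betw (\<lambda>x. x \<diamondop> act (a i) i (w i)) (H k i) (H k r)"
    by (subst bij_betw_cong) auto
qed

text \<open>An element of \<open>H i j\<close> maps \<open>H j r\<close> to \<open>H i r\<close>,
  free modules with the bases \<open>w j\<close> and \<open>w i\<close>. This is the element whose
  one-by-one matrix is \<open>f\<close>.\<close>

definition co :: "('n signed_index \<Rightarrow> 'a) \<Rightarrow> 'n signed_index \<Rightarrow> 'n signed_index \<Rightarrow> 'a \<Rightarrow> 'a" where
  "co w i j f = (THE x. x \<in> H i j \<and> x \<diamondop> w j = act f i (w i))"

lemma co_eqI:
  assumes w: "gens w" and ap: "apart i j" "apart i r" "apart j r"
    and x: "x \<in> H i j" "x \<diamondop> w j = act f i (w i)"
  shows "co w i j f = x"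
  unfolding co_def
  using x runit_cancel[OF gensD(1)[OF w ap(3)] ap(1,2)] by (intro the_equality) auto

lemma co:
  assumes w: "gens w" and ap: "apart i j" "apart i r" "apart j r" and f: "f \<in> carrier K"
  shows "co w i j f \<in> H i j" "co w i j f \<diamondop> w j = act f i (w i)"
proof -
  obtain x where "x \<in> H i j" "x \<diamondop> w j = act f i (w i)"
    using runit_div[OF gensD(1)[OF w ap(3)] ap(1,2) act_closed[OF f ap(2) gensD(2)[OF w ap(2)]]] by auto
  then show "co w i j f \<in> H i j" "co w i j f \<diamondop> w j = act f i (w i)"
    using co_eqI[OF w ap] by auto
qed

lemma co_surj:
  assumes w: "gens w" and ap: "apart i j" "apart i r" "apart j r" and x: "x \<in> H i j"
  shows "\<exists>f\<in>carrier K. co w i j f = x"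
  using act_exists[OF gensD(1)[OF w ap(2)] ap(2) br_closed[OF ap(1,3,2) x gensD(2)[OF w ap(3)]]]
    co_eqI[OF w ap x] by metis

lemma co_inj:
  assumes w: "gens w" and ap: "apart i j" "apart i r" "apart j r"
    and f: "f \<in> carrier K" "g \<in> carrier K" "co w i j f = co w i j g"
  shows "f = g"
  using act_cancel[OF gensD(1)[OF w ap(2)] ap(2) f(1,2)] co(2)[OF w ap f(1)] co(2)[OF w ap f(2)] f(3)
  by simp

text \<open>Pulling \<open>g\<close> out of the bracket produces the product in the order
  \<open>g\<close>, \<open>f\<close>; commutativity of \<open>K\<close> restores the order of
  composition.\<close>

lemma co_act:
  assumes w: "gens w" and ap: "apart i j" "apart i r" "apart j r"
    and f: "f \<in> carrier K" "g \<in> carrier K"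
  shows "co w i j f \<diamondop> act g j (w j) = act (f \<otimes>\<^bsub>K\<^esub> g) i (w i)"
proof -
  have "co w i j f \<diamondop> act g j (w j) = act g i (act f i (w i))"
    using act_br[OF f(2) ap(2,3,1) co(1)[OF w ap f(1)] gensD(2)[OF w ap(3)]] co(2)[OF w ap f(1)] by simp
  also have "\<dots> = act (g \<otimes>\<^bsub>K\<^esub> f) i (w i)" using act_mult[OF f(2,1) ap(2) gensD(2)[OF w ap(2)]] by simp
  finally show ?thesis using K.m_comm f by simp
qed

lemma co_add:
  assumes w: "gens w" and ap: "apart i j" "apart i r" "apart j r"
    and f: "f \<in> carrier K" "g \<in> carrier K"
  shows "co w i j (f \<oplus>\<^bsub>K\<^esub> g) = co w i j f \<boxplus> co w i j g"
  using co_eqI[OF w ap plus_closed[OF ap(1) co(1)[OF w ap f(1)] co(1)[OF w ap f(2)]]]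
    br_plus_left[OF ap(1,3,2) co(1)[OF w ap f(1)] co(1)[OF w ap f(2)] gensD(2)[OF w ap(3)]]
    co(2)[OF w ap f(1)] co(2)[OF w ap f(2)] act_add[OF f ap(2) gensD(2)[OF w ap(2)]] by simp

lemma co_neg:
  assumes w: "gens w" and ap: "apart i j" "apart i r" "apart j r" and f: "f \<in> carrier K"
  shows "co w i j (\<ominus>\<^bsub>K\<^esub> f) = neg (co w i j f)"
  using co_eqI[OF w ap neg_closed[OF ap(1) co(1)[OF w ap f]]]
    br_neg_left[OF ap(1,3,2) co(1)[OF w ap f] gensD(2)[OF w ap(3)]] co(2)[OF w ap f]
    act_neg[OF f ap(2) gensD(2)[OF w ap(2)]] by simp

lemma co_br:
  assumes w: "gens w" and ap: "apart i j" "apart j k" "apart i k" "apart i r" "apart j r" "apart k r"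
    and f: "f \<in> carrier K" "g \<in> carrier K"
  shows "co w i j f \<diamondop> co w j k g = co w i k (f \<otimes>\<^bsub>K\<^esub> g)"
proof -
  note cf = co(1)[OF w ap(1,4,5) f(1)] and cg = co[OF w ap(2,5,6) f(2)]
  have "(co w i j f \<diamondop> co w j k g) \<diamondop> w k = co w i j f \<diamondop> (co w j k g \<diamondop> w k)"
    using br_assoc[OF ap(1,2,3,4,5,6) cf cg(1) gensD(2)[OF w ap(6)]] .
  also have "\<dots> = act (f \<otimes>\<^bsub>K\<^esub> g) i (w i)" using cg(2) co_act[OF w ap(1,4,5) f] by simp
  finally show ?thesis
    using co_eqI[OF w ap(3,4,6) br_closed[OF ap(1,2,3) cf cg(1)]] by simp
qed

text \<open>Elements of \<open>H j k = H (- k) (- j)\<close> have two coordinates, related by a map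
  \<open>\<tau>\<close>. Comparing both readings in \<open>br_swap\<close> gives
  \<open>f g = \<tau>(f) \<tau>(g)\<close>; with \<open>g = \<one>\<close> this says that
  \<open>\<tau>\<close> is multiplication by the unit \<open>e j k = \<tau>(\<one>)\<close>.\<close>

lemma co_flip:
  assumes w: "gens w"
  obtains e where
    "\<And>j k. apart j k \<Longrightarrow> apart j r \<Longrightarrow> apart k r \<Longrightarrow> e j k \<in> carrier K"
    "\<And>j k. apart j k \<Longrightarrow> apart j r \<Longrightarrow> apart k r \<Longrightarrow> e j k \<otimes>\<^bsub>K\<^esub> e k (- j) = \<one>\<^bsub>K\<^esub>"
    "\<And>j k f. apart j k \<Longrightarrow> apart j r \<Longrightarrow> apart k r \<Longrightarrow> f \<in> carrier K \<Longrightarrow>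
      co w j k f = co w (- k) (- j) (f \<otimes>\<^bsub>K\<^esub> e j k)"
proof -
  define \<tau> where "\<tau> j k f = (SOME f'. f' \<in> carrier K \<and> co w (- k) (- j) f' = co w j k f)" for j k f
  have \<tau>: "\<tau> j k f \<in> carrier K \<and> co w (- k) (- j) (\<tau> j k f) = co w j k f"
    if ap: "apart j k" "apart j r" "apart k r" and f: "f \<in> carrier K" for j k f
  proof -
    have ap': "apart (- k) (- j)" "apart (- k) r" "apart (- j) r"
      using ap by (simp_all add: apart_commute)
    have "co w j k f \<in> H (- k) (- j)" using co(1)[OF w ap f] H_flip[OF ap(1)] by simp
    from co_surj[OF w ap' this]
    have "\<exists>f'. f' \<in> carrier K \<and> co w (- k) (- j) f' = co w j k f" by blast
    from someI_ex[OF this] show ?thesis unfolding \<tau>_def .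
  qed
  have prod: "f \<otimes>\<^bsub>K\<^esub> g = \<tau> j k f \<otimes>\<^bsub>K\<^esub> \<tau> k (- j) g"
    if ap: "apart j k" "apart j r" "apart k r" and f: "f \<in> carrier K" "g \<in> carrier K" for j k f g
  proof -
    have kj: "apart k (- j)" "apart (- j) r" "apart (- k) r" "apart j (- k)" "apart (- k) (- j)"
      using ap by (simp_all add: apart_commute)
    define y z where "y = co w j k f" and "z = co w k (- j) g"
    have y: "y \<in> H j k" "y \<diamondop> act h k (w k) = act (f \<otimes>\<^bsub>K\<^esub> h) j (w j)" if "h \<in> carrier K" for h
      using co(1)[OF w ap f(1)] co_act[OF w ap f(1) that] by (auto simp: y_def)
    have z: "z \<in> H k (- j)" "z \<diamondop> w (- j) = act g k (w k)"
      using co[OF w kj(1) ap(3) kj(2) f(2)] by (auto simp: z_def)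
    have t: "\<tau> j k f \<in> carrier K" "\<tau> k (- j) g \<in> carrier K"
      using \<tau>[OF ap f(1)] \<tau>[OF kj(1) ap(3) kj(2) f(2)] by auto
    have y': "y \<diamondop> w (- j) = act (\<tau> j k f) (- k) (w (- k))"
      using \<tau>[OF ap f(1)] co(2)[OF w kj(5,3,2), of "\<tau> j k f"] by (simp add: y_def)
    have z': "z \<diamondop> act h (- k) (w (- k)) = act (\<tau> k (- j) g \<otimes>\<^bsub>K\<^esub> h) j (w j)" if "h \<in> carrier K" for h
      using \<tau>[OF kj(1) ap(3) kj(2) f(2)] co_act[OF w kj(4) ap(2) kj(3) t(2) that]
      by (simp add: z_def)
    \<comment> \<open>On the left both elements are read in \<open>H j k\<close> and
      \<open>H k (- j)\<close>, on the right in \<open>H (- k) (- j)\<close> and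
      \<open>H j (- k)\<close>. Each side therefore carries one kind of coordinate.\<close>
    have "y \<diamondop> (z \<diamondop> w (- j)) = z \<diamondop> (y \<diamondop> w (- j))"
      using br_swap[OF ap(1,2,3) y(1) z(1) gensD(2)[OF w kj(2)]] f by blast
    then have "act (f \<otimes>\<^bsub>K\<^esub> g) j (w j) = act (\<tau> k (- j) g \<otimes>\<^bsub>K\<^esub> \<tau> j k f) j (w j)"
      using z(2) y' y(2)[OF f(2)] z'[OF t(1)] by simp
    then have "f \<otimes>\<^bsub>K\<^esub> g = \<tau> k (- j) g \<otimes>\<^bsub>K\<^esub> \<tau> j k f"
      using act_cancel[OF gensD(1)[OF w ap(2)] ap(2)] f t by simp
    then show ?thesis using K.m_comm t by simp
  qed
  define e where "e j k = \<tau> j k \<one>\<^bsub>K\<^esub>" for j k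
  show thesis
  proof (rule that[of e])
    fix j k assume ap: "apart j k" "apart j r" "apart k r"
    have kj: "apart k (- j)" "apart (- j) r" using ap by (simp_all add: apart_commute)
    note c = \<tau>[OF ap K.one_closed] \<tau>[OF kj(1) ap(3) kj(2) K.one_closed]
    show e: "e j k \<in> carrier K" using c by (simp add: e_def)
    show e1: "e j k \<otimes>\<^bsub>K\<^esub> e k (- j) = \<one>\<^bsub>K\<^esub>"
      using prod[OF ap K.one_closed K.one_closed] by (simp add: e_def)
    fix f assume f: "f \<in> carrier K"
    have e': "e k (- j) \<in> carrier K" using c by (simp add: e_def)
    have t: "\<tau> j k f \<in> carrier K" using \<tau>[OF ap f] by simp
    have "f = \<tau> j k f \<otimes>\<^bsub>K\<^esub> e k (- j)" using prod[OF ap f K.one_closed] f by (simp add: e_def)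
    then have "f \<otimes>\<^bsub>K\<^esub> e j k = \<tau> j k f \<otimes>\<^bsub>K\<^esub> (e j k \<otimes>\<^bsub>K\<^esub> e k (- j))"
      using e e' t by (metis K.m_assoc K.m_comm)
    then have "f \<otimes>\<^bsub>K\<^esub> e j k = \<tau> j k f" using e1 t by simp
    then show "co w j k f = co w (- k) (- j) (f \<otimes>\<^bsub>K\<^esub> e j k)" using \<tau>[OF ap f] by simp
  qed
qed

text \<open>By \<open>br_anti\<close>, the flip reverses a composite up to sign, so
  \<open>- e\<close> is a cocycle of units and equals \<open>D j / D k\<close>. Rescaling by
  \<open>a\<close> multiplies \<open>e j k\<close> by \<open>(a j a (- j)) / (a k a (- k))\<close>,
  and the aim is to turn it into \<open>- \<one>\<close>.\<close>

lemma good_gens_exist: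
  obtains w where "gens w"
    "\<And>j k f. apart j k \<Longrightarrow> apart j r \<Longrightarrow> apart k r \<Longrightarrow> f \<in> carrier K \<Longrightarrow>
      co w (- k) (- j) f = neg (co w j k f)"
proof -
  obtain w where w: "gens w" using gens_exist by blast
  obtain e where e: "\<And>j k. apart j k \<Longrightarrow> apart j r \<Longrightarrow> apart k r \<Longrightarrow> e j k \<in> carrier K"
    and e1: "\<And>j k. apart j k \<Longrightarrow> apart j r \<Longrightarrow> apart k r \<Longrightarrow> e j k \<otimes>\<^bsub>K\<^esub> e k (- j) = \<one>\<^bsub>K\<^esub>"
    and flip: "\<And>j k f. apart j k \<Longrightarrow> apart j r \<Longrightarrow> apart k r \<Longrightarrow> f \<in> carrier K \<Longrightarrow>
      co w j k f = co w (- k) (- j) (f \<otimes>\<^bsub>K\<^esub> e j k)"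
    using co_flip[OF w] by blast
  have e_neg: "e i k = \<ominus>\<^bsub>K\<^esub> (e i j \<otimes>\<^bsub>K\<^esub> e j k)"
    if ap: "apart i j" "apart j k" "apart i k" "apart i r" "apart j r" "apart k r" for i j k
  proof -
    have ap': "apart (- j) (- i)" "apart (- k) (- j)" "apart (- k) (- i)"
      "apart (- i) r" "apart (- j) r" "apart (- k) r"
      using ap by (simp_all add: apart_commute)
    note c = e[OF ap(1,4,5)] e[OF ap(2,5,6)] e[OF ap(3,4,6)]
    define x y where "x = co w i j \<one>\<^bsub>K\<^esub>" and "y = co w j k \<one>\<^bsub>K\<^esub>"
    have "x = co w (- j) (- i) (e i j)" "y = co w (- k) (- j) (e j k)"
      using flip[OF ap(1,4,5) K.one_closed] flip[OF ap(2,5,6) K.one_closed] c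
      by (simp_all add: x_def y_def)
    then have "y \<diamondop> x = co w (- k) (- i) (e j k \<otimes>\<^bsub>K\<^esub> e i j)"
      using co_br[OF w ap'(2,1,3) ap'(6,5,4) c(2,1)] by simp
    moreover have "y \<diamondop> x = neg (x \<diamondop> y)"
      using br_anti[OF ap(1,2,3)] co(1)[OF w ap(1,4,5)] co(1)[OF w ap(2,5,6)]
      by (simp add: x_def y_def)
    moreover have "x \<diamondop> y = co w (- k) (- i) (e i k)"
      using co_br[OF w ap K.one_closed K.one_closed] flip[OF ap(3,4,6) K.one_closed] c
      by (simp add: x_def y_def)
    ultimately have "co w (- k) (- i) (e j k \<otimes>\<^bsub>K\<^esub> e i j) = co w (- k) (- i) (\<ominus>\<^bsub>K\<^esub> e i k)"
      using co_neg[OF w ap'(3,6,4) c(3)] by simp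
    then have "e j k \<otimes>\<^bsub>K\<^esub> e i j = \<ominus>\<^bsub>K\<^esub> e i k"
      using co_inj[OF w ap'(3,6,4)] c by simp
    then show ?thesis using c K.m_comm by (metis K.minus_minus)
  qed
  define d where "d j k = \<ominus>\<^bsub>K\<^esub> e j k" for j k
  have d: "d j k \<in> carrier K" if "apart j k" "apart j r" "apart k r" for j k
    using e[OF that] by (simp add: d_def)
  have d1: "d j k \<otimes>\<^bsub>K\<^esub> d k (- j) = \<one>\<^bsub>K\<^esub>" if ap: "apart j k" "apart j r" "apart k r" for j k
  proof -
    have "e k (- j) \<in> carrier K" using e[of k "- j"] ap by (simp add: apart_commute)
    then show ?thesis using e[OF ap] e1[OF ap] by (simp add: d_def K.l_minus K.r_minus)
  qed
  have d_unit: "d j k \<in> Units K" if ap: "apart j k" "apart j r" "apart k r" for j k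
    using d1[OF ap] d[OF ap] d[of k "- j"] ap by (intro K.UnitsI[of _ "d k (- j)"]) (auto simp: apart_commute)
  have d_cocycle: "d i j \<otimes>\<^bsub>K\<^esub> d j k = d i k"
    if ap: "apart i j" "apart j k" "apart i k" "apart i r" "apart j r" "apart k r" for i j k
    using e_neg[OF ap] e[OF ap(1,4,5)] e[OF ap(2,5,6)] by (simp add: d_def K.l_minus K.r_minus)
  have "\<exists>D. (\<forall>i\<in>{i. apart i r}. D i \<in> Units K) \<and>
      (\<forall>i\<in>{i. apart i r}. \<forall>j\<in>{i. apart i r}. apart i j \<longrightarrow> d i j \<otimes>\<^bsub>K\<^esub> D j = D i)"
  proof (rule K.cocycle_trivial[where p = s])
    show "\<exists>m\<in>{i. apart i r}. apart m i \<and> apart m j" for i j using apart_ex3 by blast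
  qed (use sr d_unit d_cocycle in auto)
  then obtain D where D: "\<And>i. apart i r \<Longrightarrow> D i \<in> Units K"
    and dD: "\<And>i j. apart i r \<Longrightarrow> apart j r \<Longrightarrow> apart i j \<Longrightarrow> d i j \<otimes>\<^bsub>K\<^esub> D j = D i"
    by blast
  \<comment> \<open>The cocycle identity does not apply to \<open>j, k, - j\<close>, but
    \<open>d1\<close> provides the product of \<open>d j k\<close> and \<open>d k (- j)\<close>,
    which is \<open>\<one>\<close>.\<close>
  have D_sym: "D (- j) = D j" if j: "apart j r" for j
  proof -
    obtain k where k: "apart k j" "apart k r" using apart_ex3 by blast
    have jk: "apart j k" and nj: "apart (- j) r" and kj: "apart k (- j)"
      using k j by (simp_all add: apart_commute)
    have "D j = d j k \<otimes>\<^bsub>K\<^esub> (d k (- j) \<otimes>\<^bsub>K\<^esub> D (- j))"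
      using dD[OF j k(2) jk] dD[OF k(2) nj kj] by simp
    also have "\<dots> = D (- j)"
      using d1[OF jk j k(2)] d[OF jk j k(2)] d[OF kj k(2) nj] K.Units_closed[OF D[OF nj]]
      by (simp add: K.m_assoc[symmetric])
    finally show ?thesis by simp
  qed
  \<comment> \<open>Required is \<open>a i a (- i) D i = \<one>\<close>, a consistent condition by
    \<open>D_sym\<close>. One index of each pair carries the whole factor, so that no square root is
    needed.\<close>
  define a where "a i = (case i of Pos _ \<Rightarrow> inv\<^bsub>K\<^esub> D i | Neg _ \<Rightarrow> \<one>\<^bsub>K\<^esub>)" for i
  have a: "a i \<in> Units K" if "apart i r" for i
    using D[OF that] by (auto simp: a_def split: signed_index.split)
  have aD: "a i \<otimes>\<^bsub>K\<^esub> a (- i) \<otimes>\<^bsub>K\<^esub> D i = \<one>\<^bsub>K\<^esub>" if i: "apart i r" for i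
    using D[OF i] D_sym[OF i] by (cases i) (auto simp: a_def)
  define w' where "w' i = act (a i) i (w i)" for i
  have w': "gens w'" unfolding w'_def by (rule gens_rescale[OF w a])
  show thesis
  proof (rule that[OF w'])
    fix j k f assume ap: "apart j k" "apart j r" "apart k r" and f: "f \<in> carrier K"
    have ap': "apart (- k) (- j)" "apart (- k) r" "apart (- j) r"
      using ap by (simp_all add: apart_commute)
    note c = K.Units_closed[OF a[OF ap(2)]] K.Units_closed[OF a[OF ap(3)]]
      K.Units_closed[OF a[OF ap'(2)]] K.Units_closed[OF a[OF ap'(3)]]
      K.Units_closed[OF D[OF ap(2)]] K.Units_closed[OF D[OF ap(3)]] d[OF ap] e[OF ap] f
    define x where "x = co w' j k f"
    have xH: "x \<in> H j k" using co(1)[OF w' ap f] by (simp add: x_def)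
    \<comment> \<open>\<open>h\<close> is the coordinate of \<open>x\<close> for the old generators.
      Expressing the flip in old coordinates and returning to the new ones on both ends leaves only
      the sign.\<close>
    obtain h where h: "h \<in> carrier K" "co w j k h = x" using co_surj[OF w ap xH] by blast
    note c = c h(1)
    have "x \<diamondop> w' k = act (h \<otimes>\<^bsub>K\<^esub> a k) j (w j)"
      unfolding w'_def using co_act[OF w ap h(1) c(2)] h(2) by simp
    moreover have "x \<diamondop> w' k = act (f \<otimes>\<^bsub>K\<^esub> a j) j (w j)"
      using co(2)[OF w' ap f] act_mult[OF f c(1) ap(2) gensD(2)[OF w ap(2)]] by (simp add: x_def w'_def)
    ultimately have ha: "h \<otimes>\<^bsub>K\<^esub> a k = f \<otimes>\<^bsub>K\<^esub> a j"
      using act_cancel[OF gensD(1)[OF w ap(2)] ap(2)] c by simp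
    have x': "x = co w (- k) (- j) (h \<otimes>\<^bsub>K\<^esub> e j k)" using flip[OF ap h(1)] h(2) by simp
    have "(D k \<otimes>\<^bsub>K\<^esub> a k) \<otimes>\<^bsub>K\<^esub> (h \<otimes>\<^bsub>K\<^esub> d j k \<otimes>\<^bsub>K\<^esub> a (- j))
        = (h \<otimes>\<^bsub>K\<^esub> a k) \<otimes>\<^bsub>K\<^esub> a (- j) \<otimes>\<^bsub>K\<^esub> (d j k \<otimes>\<^bsub>K\<^esub> D k)"
      using c by (simp add: K.m_ac)
    also have "\<dots> = (f \<otimes>\<^bsub>K\<^esub> a j) \<otimes>\<^bsub>K\<^esub> a (- j) \<otimes>\<^bsub>K\<^esub> D j"
      using ha dD[OF ap(2,3,1)] by simp
    also have "\<dots> = f \<otimes>\<^bsub>K\<^esub> (a j \<otimes>\<^bsub>K\<^esub> a (- j) \<otimes>\<^bsub>K\<^esub> D j)" using c by (simp add: K.m_ac)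
    also have "\<dots> = f \<otimes>\<^bsub>K\<^esub> (a k \<otimes>\<^bsub>K\<^esub> a (- k) \<otimes>\<^bsub>K\<^esub> D k)" using aD[OF ap(2)] aD[OF ap(3)] by simp
    also have "\<dots> = (D k \<otimes>\<^bsub>K\<^esub> a k) \<otimes>\<^bsub>K\<^esub> (f \<otimes>\<^bsub>K\<^esub> a (- k))" using c by (simp add: K.m_ac)
    finally have "h \<otimes>\<^bsub>K\<^esub> d j k \<otimes>\<^bsub>K\<^esub> a (- j) = f \<otimes>\<^bsub>K\<^esub> a (- k)"
      using K.Units_cancel[OF K.Units_m_closed[OF D[OF ap(3)] a[OF ap(3)]]] c by simp
    then have "\<ominus>\<^bsub>K\<^esub> (h \<otimes>\<^bsub>K\<^esub> e j k \<otimes>\<^bsub>K\<^esub> a (- j)) = f \<otimes>\<^bsub>K\<^esub> a (- k)"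
      using c by (simp add: d_def K.l_minus K.r_minus)
    from arg_cong[OF this, of "a_inv K"]
    have fin: "h \<otimes>\<^bsub>K\<^esub> e j k \<otimes>\<^bsub>K\<^esub> a (- j) = (\<ominus>\<^bsub>K\<^esub> f) \<otimes>\<^bsub>K\<^esub> a (- k)"
      using c by (simp add: K.l_minus)
    have "x \<diamondop> w' (- j) = act (h \<otimes>\<^bsub>K\<^esub> e j k \<otimes>\<^bsub>K\<^esub> a (- j)) (- k) (w (- k))"
      unfolding w'_def using co_act[OF w ap', of "h \<otimes>\<^bsub>K\<^esub> e j k" "a (- j)"] x' c by simp
    also have "\<dots> = act (\<ominus>\<^bsub>K\<^esub> f) (- k) (w' (- k))"
      unfolding fin w'_def using act_mult[OF _ c(3) ap'(2) gensD(2)[OF w ap'(2)]] f by simp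
    finally have "co w' (- k) (- j) (\<ominus>\<^bsub>K\<^esub> f) = x"
      using co_eqI[OF w' ap'] xH H_flip[OF ap(1)] by simp
    then have "co w' (- k) (- j) f = neg x"
      using co_neg[OF w' ap', of "\<ominus>\<^bsub>K\<^esub> f"] f by simp
    then show "co w' (- k) (- j) f = neg (co w' j k f)" by (simp add: x_def)
  qed
qed

end

section \<open>Extension of the coordinates to the indices \<open>r\<close> and
  \<open>- r\<close>\<close>

locale coordinatized_bracket_system = pointed_bracket_system H plus neg zero br r s w0
  for H :: "'n::finite signed_index \<Rightarrow> 'n signed_index \<Rightarrow> 'a set"
    and plus (infixl "\<boxplus>" 65) and neg and zero and br (infixr "\<diamondop>" 70)
    and r s w0 +
  fixes w :: "'n signed_index \<Rightarrow> 'a"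
  assumes w: "gens w"
    and co_neg_flip: "\<And>j k f. apart j k \<Longrightarrow> apart j r \<Longrightarrow> apart k r \<Longrightarrow> f \<in> carrier K \<Longrightarrow>
      co w (- k) (- j) f = neg (co w j k f)"
begin

lemma w_closed: "apart i r \<Longrightarrow> w i \<in> H i r"
  using gensD(2)[OF w] .

lemma co_one: "apart i j \<Longrightarrow> apart i r \<Longrightarrow> apart j r \<Longrightarrow> co w i j \<one>\<^bsub>K\<^esub> \<diamondop> w j = w i"
  using co(2)[OF w _ _ _ K.one_closed] act_one[OF _ w_closed] by simp

text \<open>Elements of \<open>H r j\<close> do not act on the column of \<open>r\<close>, so their
  coordinate is read off after composition with a generator \<open>w k\<close>. It does not depend
  on \<open>k\<close> because \<open>w i\<close> is \<open>w k\<close> composed with an element of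
  coordinate \<open>\<one>\<close>.\<close>

lemma w_br_transfer:
  assumes ap: "apart i k" "apart i j" "apart k j" "apart i r" "apart k r" "apart r j"
    and y: "y \<in> H r j" and f: "f \<in> carrier K" and eq: "w k \<diamondop> y = co w k j f"
  shows "w i \<diamondop> y = co w i j f"
proof -
  have jr: "apart j r" using ap by (simp add: apart_commute)
  have "w i \<diamondop> y = (co w i k \<one>\<^bsub>K\<^esub> \<diamondop> w k) \<diamondop> y" using co_one[OF ap(1,4,5)] by simp
  also have "\<dots> = co w i k \<one>\<^bsub>K\<^esub> \<diamondop> (w k \<diamondop> y)"
    using br_assoc[OF ap(1,5,4,2,3,6) co(1)[OF w ap(1,4,5) K.one_closed] w_closed[OF ap(5)] y] .
  also have "\<dots> = co w i j f"
    using eq co_br[OF w ap(1,3,2,4,5) jr K.one_closed f] f by simp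
  finally show ?thesis .
qed

text \<open>A two-sided unit \<open>u\<close> of \<open>H i r\<close> is an invertible scalar
  \<open>h\<close> times \<open>w i\<close>. If \<open>w i \<diamondop> y\<close> has coordinate
  \<open>\<rho>\<close>, then \<open>u \<diamondop> y\<close> has coordinate
  \<open>h \<rho>\<close>, so bijectivity passes from \<open>u\<close> to
  \<open>w i\<close>.\<close>

lemma w_lunit:
  assumes i: "apart i r"
  shows "lunit i r (w i)"
  unfolding lunit_def
proof (intro conjI allI impI w_closed[OF i])
  fix j assume ji: "apart j i" and jr: "apart j r"
  obtain k where k: "apart k i" "apart k j" "apart k r" using apart_ex3 by blast
  have ap: "apart i k" "apart i j" "apart k j" "apart r j" using ji jr k by (simp_all add: apart_commute)
  obtain u where u: "lunit i r u" "runit i r u"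
    using unit_exists[OF i] unfolding lunit_def runit_def by blast
  obtain h where h: "h \<in> carrier K" "act h i (w i) = u"
    using act_exists[OF gensD(1)[OF w i] i lunitD[OF u(1)]] by blast
  obtain c where c: "c \<in> carrier K" "act c i u = w i"
    using act_exists[OF u(2) i w_closed[OF i]] by blast
  have "act (c \<otimes>\<^bsub>K\<^esub> h) i (w i) = act \<one>\<^bsub>K\<^esub> i (w i)"
    using act_mult[OF c(1) h(1) i w_closed[OF i]] c(2) h(2) act_one[OF i w_closed[OF i]] by simp
  then have ch: "c \<otimes>\<^bsub>K\<^esub> h = \<one>\<^bsub>K\<^esub>"
    using act_cancel[OF gensD(1)[OF w i] i] c h by simp
  \<comment> \<open>The scalar \<open>h\<close> acts on \<open>H i r\<close> only; writing
    \<open>u\<close> as \<open>co w i k h\<close> composed with \<open>w k\<close> turns it into a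
    factor of a coordinate in \<open>H i j\<close>.\<close>
  have u_br: "\<exists>\<rho>\<in>carrier K. w i \<diamondop> y = co w i j \<rho> \<and> u \<diamondop> y = co w i j (h \<otimes>\<^bsub>K\<^esub> \<rho>)" if y: "y \<in> H r j" for y
  proof -
    obtain \<rho> where \<rho>: "\<rho> \<in> carrier K" "co w k j \<rho> = w k \<diamondop> y"
      using co_surj[OF w ap(3) k(3) jr br_closed[OF k(3) ap(4,3) w_closed[OF k(3)] y]] by blast
    have "u = co w i k h \<diamondop> w k" using co(2)[OF w ap(1) i k(3) h(1)] h(2) by simp
    then have "u \<diamondop> y = co w i k h \<diamondop> (w k \<diamondop> y)"
      using br_assoc[OF ap(1) k(3) i ap(2,3,4) co(1)[OF w ap(1) i k(3) h(1)] w_closed[OF k(3)] y]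
      by simp
    also have "\<dots> = co w i j (h \<otimes>\<^bsub>K\<^esub> \<rho>)"
      using \<rho> co_br[OF w ap(1,3,2) i k(3) jr h(1) \<rho>(1)] by simp
    finally show ?thesis
      using w_br_transfer[OF ap(1,2,3) i k(3) ap(4) y \<rho>(1)] \<rho> by auto
  qed
  show "bij_betw (\<lambda>x. w i \<diamondop> x) (H r j) (H i j)"
    unfolding bij_betw_def
  proof (intro conjI inj_onI equalityI subsetI)
    fix y y' assume y: "y \<in> H r j" and y': "y' \<in> H r j" and eq: "w i \<diamondop> y = w i \<diamondop> y'"
    obtain \<rho> where \<rho>: "\<rho> \<in> carrier K" "w i \<diamondop> y = co w i j \<rho>" "u \<diamondop> y = co w i j (h \<otimes>\<^bsub>K\<^esub> \<rho>)"
      using u_br[OF y] by blast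
    obtain \<rho>' where \<rho>': "\<rho>' \<in> carrier K" "w i \<diamondop> y' = co w i j \<rho>'" "u \<diamondop> y' = co w i j (h \<otimes>\<^bsub>K\<^esub> \<rho>')"
      using u_br[OF y'] by blast
    have "\<rho> = \<rho>'" using co_inj[OF w ap(2) i jr \<rho>(1) \<rho>'(1)] eq \<rho> \<rho>' by simp
    then show "y = y'" using lunit_cancel[OF u(1) ji jr y y'] \<rho> \<rho>' by simp
  next
    fix z assume "z \<in> (\<lambda>x. w i \<diamondop> x) ` H r j"
    then show "z \<in> H i j" using br_closed[OF i ap(4,2) w_closed[OF i]] by auto
  next
    fix z assume z: "z \<in> H i j"
    obtain f where f: "f \<in> carrier K" "co w i j f = z" using co_surj[OF w ap(2) i jr z] by blast
    have "co w i j (h \<otimes>\<^bsub>K\<^esub> f) \<in> H i j" using co(1)[OF w ap(2) i jr] h f by simp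
    then obtain y where y: "y \<in> H r j" "u \<diamondop> y = co w i j (h \<otimes>\<^bsub>K\<^esub> f)"
      using lunit_div[OF u(1) ji jr] by blast
    obtain \<rho> where \<rho>: "\<rho> \<in> carrier K" "w i \<diamondop> y = co w i j \<rho>" "u \<diamondop> y = co w i j (h \<otimes>\<^bsub>K\<^esub> \<rho>)"
      using u_br[OF y(1)] by blast
    have "h \<otimes>\<^bsub>K\<^esub> \<rho> = h \<otimes>\<^bsub>K\<^esub> f"
      using co_inj[OF w ap(2) i jr, of "h \<otimes>\<^bsub>K\<^esub> \<rho>" "h \<otimes>\<^bsub>K\<^esub> f"] y \<rho> h f by simp
    then have "(c \<otimes>\<^bsub>K\<^esub> h) \<otimes>\<^bsub>K\<^esub> \<rho> = (c \<otimes>\<^bsub>K\<^esub> h) \<otimes>\<^bsub>K\<^esub> f" using c h f \<rho> by (simp add: K.m_assoc)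
    then have "\<rho> = f" using ch f \<rho> by simp
    then show "z \<in> (\<lambda>x. w i \<diamondop> x) ` H r j" using \<rho> f y by (intro image_eqI[of _ _ y]) simp_all
  qed
qed

text \<open>The element of row \<open>r\<close> with coordinate \<open>f\<close>, obtained by
  dividing \<open>co w i j f\<close> on the left by \<open>w i\<close>. One index \<open>i\<close>
  determines it, and \<open>w_br_all\<close> gives the equation for all others.\<close>

definition rho :: "'n signed_index \<Rightarrow> 'a \<Rightarrow> 'a" where
  "rho j f = (SOME y. y \<in> H r j \<and> (\<forall>i. apart i r \<longrightarrow> apart i j \<longrightarrow> w i \<diamondop> y = co w i j f))"

lemma w_br_all:
  assumes jr: "apart j r" and k: "apart k r" "apart k j" and y: "y \<in> H r j" and f: "f \<in> carrier K"
    and eq: "w k \<diamondop> y = co w k j f" and i: "apart i r" "apart i j"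
  shows "w i \<diamondop> y = co w i j f"
proof -
  have rj: "apart r j" using jr by (simp add: apart_commute)
  show ?thesis
  proof (cases "apart i k")
    case True
    show ?thesis using w_br_transfer[OF True i(2) k(2) i(1) k(1) rj y f eq] .
  next
    case False
    obtain m where m: "apart m k" "apart m r" "apart m j" using apart_ex3 by blast
    have im: "apart i m" using False m not_apart_trans by (metis apart_commute)
    show ?thesis
      using w_br_transfer[OF im i(2) m(3) i(1) m(2) rj y f
          w_br_transfer[OF m(1,3) k(2) m(2) k(1) rj y f eq]] .
  qed
qed

lemma rho:
  assumes jr: "apart j r" and f: "f \<in> carrier K"
  shows "rho j f \<in> H r j" "apart i r \<Longrightarrow> apart i j \<Longrightarrow> w i \<diamondop> rho j f = co w i j f"
proof -
  obtain k where k: "apart k r" "apart k j" using apart_ex3 by blast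
  have jk: "apart j k" using k by (simp add: apart_commute)
  obtain y where y: "y \<in> H r j" "w k \<diamondop> y = co w k j f"
    using lunit_div[OF w_lunit[OF k(1)] jk jr co(1)[OF w k(2,1) jr f]] by blast
  have "\<exists>y. y \<in> H r j \<and> (\<forall>i. apart i r \<longrightarrow> apart i j \<longrightarrow> w i \<diamondop> y = co w i j f)"
    using y w_br_all[OF jr k y(1) f y(2)] by blast
  from someI_ex[OF this] show "rho j f \<in> H r j"
    "apart i r \<Longrightarrow> apart i j \<Longrightarrow> w i \<diamondop> rho j f = co w i j f"
    unfolding rho_def by blast+
qed

lemma rho_eqI:
  assumes jr: "apart j r" and k: "apart k r" "apart k j" and y: "y \<in> H r j" and f: "f \<in> carrier K"
    and eq: "w k \<diamondop> y = co w k j f"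
  shows "rho j f = y"
proof (rule lunit_cancel[OF w_lunit[OF k(1)] _ jr rho(1)[OF jr f] y])
  show "apart j k" using k by (simp add: apart_commute)
  show "w k \<diamondop> rho j f = w k \<diamondop> y" using rho(2)[OF jr f k] eq by simp
qed

text \<open>For pairs containing \<open>- r\<close> the value is dictated by the Steinberg relation
  between \<open>t_ij(x)\<close> and \<open>t_(-j)(-i)(-x)\<close>: it is the negative of the
  coordinate map of the flipped pair, which contains \<open>r\<close> instead.\<close>

definition phi :: "'n signed_index \<Rightarrow> 'n signed_index \<Rightarrow> 'a \<Rightarrow> 'a" where
  "phi i j f = (if apart i r \<and> apart j r then co w i j f else if j = r then act f i (w i)
     else if i = r then rho j f else if i = - r then neg (act f (- j) (w (- j)))
     else neg (rho (- i) f))"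

lemma phi_co: "apart i r \<Longrightarrow> apart j r \<Longrightarrow> phi i j f = co w i j f"
  by (simp add: phi_def)

lemma phi_act: "phi i r f = act f i (w i)"
  by (simp add: phi_def)

lemma phi_rho: "apart j r \<Longrightarrow> phi r j f = rho j f"
  by (auto simp: phi_def)

lemma phi_closed_aux:
  assumes "apart i j" "f \<in> carrier K" "i \<noteq> - r" "j \<noteq> - r"
  shows "phi i j f \<in> H i j"
proof -
  consider "apart i r" "apart j r" | "i = r" | "j = r"
    using apart_or_eq[OF assms(3)] apart_or_eq[OF assms(4)] by blast
  then show ?thesis
    by cases (use assms co(1)[OF w] rho(1) act_closed w_closed in
        \<open>auto simp: phi_co phi_act phi_rho apart_commute\<close>)
qed

text \<open>Since \<open>r\<close> and \<open>- r\<close> are not apart, an apart pair cannot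
  contain both. Hence the pair or its flip avoids \<open>- r\<close>, and statements that are stable
  under the flip need a proof only in the first case.\<close>

lemma root_index_cases [consumes 1, case_names main flip]:
  assumes "apart i j"
    and "i \<noteq> - r \<Longrightarrow> j \<noteq> - r \<Longrightarrow> P"
    and "- j \<noteq> - r \<Longrightarrow> - i \<noteq> - r \<Longrightarrow> P"
  shows P
  using assms(2,3) not_apart_self[of r] assms(1) by (cases "i = - r \<or> j = - r") (auto simp: apart_def)

lemma phi_flip:
  assumes ij: "apart i j" and f: "f \<in> carrier K"
  shows "phi (- j) (- i) f = neg (phi i j f)"
proof -
  have *: "phi (- j) (- i) f = neg (phi i j f)"
    if ij: "apart i j" and n: "i \<noteq> - r" "j \<noteq> - r" for i j
  proof -
    consider "apart i r" "apart j r" | "i = r" | "j = r"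
      using apart_or_eq[OF n(1)] apart_or_eq[OF n(2)] by blast
    then show ?thesis
    proof cases
      case 1
      then show ?thesis using co_neg_flip[OF ij 1 f] by (simp add: phi_co)
    next
      case 2
      then have "apart j r" using ij by (simp add: apart_commute)
      then show ?thesis using 2 by (auto simp: phi_rho) (auto simp: phi_def)
    next
      case 3
      then have "apart i r" using ij by simp
      then show ?thesis using 3 by (auto simp: phi_def)
    qed
  qed
  show ?thesis using ij
  proof (cases rule: root_index_cases)
    case main
    then show ?thesis using *[OF ij] by simp
  next
    case flip
    have ji: "apart (- j) (- i)" using ij by (simp add: apart_commute)
    have "phi i j f = neg (phi (- j) (- i) f)" using *[OF ji flip] by simp
    then show ?thesis using neg_neg[OF ji phi_closed_aux[OF ji f flip]] by simp
  qed
qed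

lemma phi_closed:
  assumes ij: "apart i j" and f: "f \<in> carrier K"
  shows "phi i j f \<in> H i j"
  using ij
proof (cases rule: root_index_cases)
  case main
  then show ?thesis using phi_closed_aux[OF ij f] by simp
next
  case flip
  have ji: "apart (- j) (- i)" using ij by (simp add: apart_commute)
  have "phi i j f = neg (phi (- j) (- i) f)" using phi_flip[OF ji f] by simp
  then show ?thesis using neg_closed[OF ji phi_closed_aux[OF ji f flip]] H_flip[OF ij] by simp
qed

lemma phi_add:
  assumes ij: "apart i j" and fg: "f \<in> carrier K" "g \<in> carrier K"
  shows "phi i j (f \<oplus>\<^bsub>K\<^esub> g) = phi i j f \<boxplus> phi i j g"
proof -
  have *: "phi i j (f \<oplus>\<^bsub>K\<^esub> g) = phi i j f \<boxplus> phi i j g"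
    if ij: "apart i j" and n: "i \<noteq> - r" "j \<noteq> - r" for i j
  proof -
    consider "apart i r" "apart j r" | "i = r" | "j = r"
      using apart_or_eq[OF n(1)] apart_or_eq[OF n(2)] by blast
    then show ?thesis
    proof cases
      case 1
      then show ?thesis using co_add[OF w ij 1 fg] by (simp add: phi_co)
    next
      case 2
      then have j: "apart j r" and rj: "apart r j" using ij by (simp_all add: apart_commute)
      obtain k where k: "apart k r" "apart k j" using apart_ex3 by blast
      have "w k \<diamondop> (rho j f \<boxplus> rho j g) = co w k j (f \<oplus>\<^bsub>K\<^esub> g)"
        using br_plus_right[OF k(1) rj k(2) w_closed[OF k(1)] rho(1)[OF j fg(1)] rho(1)[OF j fg(2)]]
          rho(2)[OF j fg(1) k] rho(2)[OF j fg(2) k] co_add[OF w k(2,1) j fg] by simp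
      then have "rho j (f \<oplus>\<^bsub>K\<^esub> g) = rho j f \<boxplus> rho j g"
        by (rule rho_eqI[OF j k plus_closed[OF rj rho(1)[OF j fg(1)] rho(1)[OF j fg(2)]] K.a_closed[OF fg]])
      then show ?thesis using 2 j by (simp add: phi_rho)
    next
      case 3
      then show ?thesis using act_add[OF fg _ w_closed] ij by (simp add: phi_act)
    qed
  qed
  show ?thesis using ij
  proof (cases rule: root_index_cases)
    case main
    then show ?thesis using *[OF ij] by simp
  next
    case flip
    have ji: "apart (- j) (- i)" using ij by (simp add: apart_commute)
    have "phi i j h = neg (phi (- j) (- i) h)" if "h \<in> carrier K" for h
      using phi_flip[OF ji that] by simp
    then show ?thesis
      using *[OF ji flip] neg_add[OF ji phi_closed[OF ji fg(1)] phi_closed[OF ji fg(2)]] fg by simp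
  qed
qed

lemma phi_bij:
  assumes ij: "apart i j"
  shows "bij_betw (phi i j) (carrier K) (H i j)"
proof -
  have *: "(\<forall>f\<in>carrier K. \<forall>g\<in>carrier K. phi i j f = phi i j g \<longrightarrow> f = g) \<and>
      (\<forall>y\<in>H i j. \<exists>f\<in>carrier K. phi i j f = y)"
    if ij: "apart i j" and n: "i \<noteq> - r" "j \<noteq> - r" for i j
  proof -
    consider "apart i r" "apart j r" | "i = r" | "j = r"
      using apart_or_eq[OF n(1)] apart_or_eq[OF n(2)] by blast
    then show ?thesis
    proof cases
      case 1
      then show ?thesis using co_inj[OF w ij 1] co_surj[OF w ij 1] by (simp add: phi_co)
    next
      case 2
      then have j: "apart j r" and rj: "apart r j" using ij by (simp_all add: apart_commute)
      obtain k where k: "apart k r" "apart k j" using apart_ex3 by blast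
      have "f = g" if "f \<in> carrier K" "g \<in> carrier K" "rho j f = rho j g" for f g
        using co_inj[OF w k(2,1) j that(1,2)] rho(2)[OF j that(1) k] rho(2)[OF j that(2) k] that(3)
        by simp
      moreover have "\<exists>f\<in>carrier K. rho j f = y" if y: "y \<in> H r j" for y
        using co_surj[OF w k(2,1) j br_closed[OF k(1) rj k(2) w_closed[OF k(1)] y]]
          rho_eqI[OF j k y] by metis
      ultimately show ?thesis using 2 j by (simp add: phi_rho)
    next
      case 3
      then have "apart i r" using ij by simp
      then show ?thesis
        using 3 act_cancel[OF gensD(1)[OF w]] act_exists[OF gensD(1)[OF w]] by (simp add: phi_act)
    qed
  qed
  have "(\<forall>f\<in>carrier K. \<forall>g\<in>carrier K. phi i j f = phi i j g \<longrightarrow> f = g) \<and>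
      (\<forall>y\<in>H i j. \<exists>f\<in>carrier K. phi i j f = y)"
    using ij
  proof (cases rule: root_index_cases)
    case main
    then show ?thesis using *[OF ij] by simp
  next
    case flip
    have ji: "apart (- j) (- i)" using ij by (simp add: apart_commute)
    have n: "phi (- j) (- i) h = neg (phi i j h)" if "h \<in> carrier K" for h
      using phi_flip[OF ij that] .
    have "f = g" if "f \<in> carrier K" "g \<in> carrier K" "phi i j f = phi i j g" for f g
      using *[OF ji flip] n that by metis
    moreover have "\<exists>f\<in>carrier K. phi i j f = y" if y: "y \<in> H i j" for y
    proof -
      have "neg y \<in> H (- j) (- i)" using neg_closed[OF ij y] H_flip[OF ij] by simp
      then obtain f where f: "f \<in> carrier K" "phi (- j) (- i) f = neg y" using *[OF ji flip] by blast
      then have "neg (neg (phi i j f)) = neg (neg y)" using n by simp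
      then show ?thesis using neg_neg[OF ij] phi_closed[OF ij f(1)] y f(1) by auto
    qed
    ultimately show ?thesis by blast
  qed
  then show ?thesis
    unfolding bij_betw_def inj_on_def using phi_closed[OF ij] by (intro conjI equalityI) auto
qed

text \<open>At most one of the three indices has the absolute value of \<open>r\<close>. If it is
  \<open>r\<close>, its position decides the argument; if it is \<open>- r\<close>, the whole triple
  is flipped.\<close>

lemma phi_br:
  assumes ap: "apart i j" "apart j k" "apart i k" and fg: "f \<in> carrier K" "g \<in> carrier K"
  shows "phi i j f \<diamondop> phi j k g = phi i k (f \<otimes>\<^bsub>K\<^esub> g)"
proof -
  have *: "phi i j f \<diamondop> phi j k g = phi i k (f \<otimes>\<^bsub>K\<^esub> g)"
    if ap: "apart i j" "apart j k" "apart i k" and n: "i \<noteq> - r" "j \<noteq> - r" "k \<noteq> - r"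
      and fg: "f \<in> carrier K" "g \<in> carrier K" for i j k f g
  proof -
    consider "apart i r" "apart j r" "apart k r" | "i = r" | "j = r" | "k = r"
      using apart_or_eq[OF n(1)] apart_or_eq[OF n(2)] apart_or_eq[OF n(3)] by blast
    then show ?thesis
    proof cases
      case 1
      then show ?thesis using co_br[OF w ap 1 fg] by (simp add: phi_co)
    next
      case 2
      have r: "apart r j" "apart r k" "apart j r" "apart k r" using 2 ap by (simp_all add: apart_commute)
      \<comment> \<open>Both sides lie in row \<open>r\<close>, where elements are compared by
        composing with a generator \<open>w m\<close> from the left.\<close>
      obtain m where m: "apart m r" "apart m j" "apart m k" using apart_ex3 by blast
      have "w m \<diamondop> (rho j f \<diamondop> co w j k g) = (w m \<diamondop> rho j f) \<diamondop> co w j k g"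
        using br_assoc[OF m(1) r(1) m(2) m(3) r(2) ap(2) w_closed[OF m(1)]
            rho(1)[OF r(3) fg(1)] co(1)[OF w ap(2) r(3,4) fg(2)]] by simp
      also have "\<dots> = co w m k (f \<otimes>\<^bsub>K\<^esub> g)"
        using rho(2)[OF r(3) fg(1) m(1,2)] co_br[OF w m(2) ap(2) m(3,1) r(3,4) fg] by simp
      finally have "rho k (f \<otimes>\<^bsub>K\<^esub> g) = rho j f \<diamondop> co w j k g"
        using rho_eqI[OF r(4) m(1,3) br_closed[OF r(1) ap(2) r(2) rho(1)[OF r(3) fg(1)]
              co(1)[OF w ap(2) r(3,4) fg(2)]]] fg by simp
      then show ?thesis using 2 r by (simp add: phi_rho phi_co)
    next
      case 3
      have r: "apart i r" "apart r k" "apart k r" using 3 ap by (simp_all add: apart_commute)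
      \<comment> \<open>Here \<open>r\<close> is the middle index. The scalar \<open>f\<close> is
        absorbed into \<open>co w i m f\<close>, after which \<open>w m\<close> meets
        \<open>rho k g\<close>.\<close>
      obtain m where m: "apart m r" "apart m i" "apart m k" using apart_ex3 by blast
      have im: "apart i m" using m by (simp add: apart_commute)
      have "act f i (w i) \<diamondop> rho k g = (co w i m f \<diamondop> w m) \<diamondop> rho k g"
        using co(2)[OF w im r(1) m(1) fg(1)] by simp
      also have "\<dots> = co w i m f \<diamondop> (w m \<diamondop> rho k g)"
        using br_assoc[OF im m(1) r(1) ap(3) m(3) r(2) co(1)[OF w im r(1) m(1) fg(1)]
            w_closed[OF m(1)] rho(1)[OF r(3) fg(2)]] .
      also have "\<dots> = co w i k (f \<otimes>\<^bsub>K\<^esub> g)"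
        using rho(2)[OF r(3) fg(2) m(1,3)] co_br[OF w im m(3) ap(3) r(1) m(1) r(3) fg] by simp
      finally show ?thesis using 3 r by (simp add: phi_rho phi_co phi_act)
    next
      case 4
      have r: "apart i r" "apart j r" using 4 ap by simp_all
      show ?thesis using 4 r co_act[OF w ap(1) r fg] by (simp add: phi_co phi_act)
    qed
  qed
  show ?thesis
  proof (cases "i = - r \<or> j = - r \<or> k = - r")
    case False
    then show ?thesis using *[OF ap _ _ _ fg] by simp
  next
    case True
    have ap': "apart (- k) (- j)" "apart (- j) (- i)" "apart (- k) (- i)"
      using ap by (simp_all add: apart_commute)
    have "- k \<noteq> - r" "- j \<noteq> - r" "- i \<noteq> - r" using True ap by auto
    from *[OF ap' this fg(2,1)]
    have fl: "phi (- k) (- j) g \<diamondop> phi (- j) (- i) f = phi (- k) (- i) (g \<otimes>\<^bsub>K\<^esub> f)" .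
    note cf = phi_closed[OF ap(1) fg(1)] and cg = phi_closed[OF ap(2) fg(2)]
    note cf' = phi_closed[OF ap'(2) fg(1)] and cg' = phi_closed[OF ap'(1) fg(2)]
    \<comment> \<open>The two signs of the factors cancel, and the sign from \<open>br_anti\<close>
      is the one that the flip puts on the result. The order of the scalars is reversed, which
      commutativity of \<open>K\<close> repairs.\<close>
    have "phi i j f \<diamondop> phi j k g = neg (phi (- j) (- i) f) \<diamondop> neg (phi (- k) (- j) g)"
      using phi_flip[OF ap'(2) fg(1)] phi_flip[OF ap'(1) fg(2)] by simp
    also have "\<dots> = neg (neg (phi (- k) (- j) g) \<diamondop> neg (phi (- j) (- i) f))"
      using br_anti[OF ap'(1,2,3) neg_closed[OF ap'(1) cg'] neg_closed[OF ap'(2) cf']] .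
    also have "neg (phi (- k) (- j) g) \<diamondop> neg (phi (- j) (- i) f) = phi (- k) (- i) (g \<otimes>\<^bsub>K\<^esub> f)"
      using br_neg_left[OF ap' cg' neg_closed[OF ap'(2) cf']] br_neg_right[OF ap' cg' cf'] fl
        neg_neg[OF ap'(3) phi_closed[OF ap'(3)]] fg by simp
    also have "neg \<dots> = phi i k (f \<otimes>\<^bsub>K\<^esub> g)"
      using phi_flip[OF ap'(3), of "g \<otimes>\<^bsub>K\<^esub> f"] K.m_comm fg by simp
    finally show ?thesis .
  qed
qed

end

lemma (in bracket_system) coordinates_exist:
  obtains K :: "'a ring" and \<phi> where "cring K"
    "\<And>i j. apart i j \<Longrightarrow> bij_betw (\<phi> i j) (carrier K) (H i j)"
    "\<And>i j f g. apart i j \<Longrightarrow> f \<in> carrier K \<Longrightarrow> g \<in> carrier K \<Longrightarrow>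
      \<phi> i j (f \<oplus>\<^bsub>K\<^esub> g) = \<phi> i j f \<boxplus> \<phi> i j g"
    "\<And>i j f. apart i j \<Longrightarrow> f \<in> carrier K \<Longrightarrow> \<phi> (- j) (- i) f = neg (\<phi> i j f)"
    "\<And>i j k f g. apart i j \<Longrightarrow> apart j k \<Longrightarrow> apart i k \<Longrightarrow> f \<in> carrier K \<Longrightarrow> g \<in> carrier K \<Longrightarrow>
      \<phi> i j f \<diamondop> \<phi> j k g = \<phi> i k (f \<otimes>\<^bsub>K\<^esub> g)"
proof -
  fix r :: "'n signed_index"
  obtain s where s: "apart s r" using apart_ex3 by blast
  obtain w0 where w0: "runit s r w0" using runit_ex[OF s] by blast
  interpret P: pointed_bracket_system H "(\<boxplus>)" neg zero "(\<diamondop>)" r s w0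
    by unfold_locales (fact s w0)+
  obtain w where w: "P.gens w" "\<And>j k f. apart j k \<Longrightarrow> apart j r \<Longrightarrow> apart k r \<Longrightarrow> f \<in> carrier P.K \<Longrightarrow>
      P.co w (- k) (- j) f = neg (P.co w j k f)"
    using P.good_gens_exist by blast
  interpret Q: coordinatized_bracket_system H "(\<boxplus>)" neg zero "(\<diamondop>)" r s w0 w
    by unfold_locales (fact w)+
  show thesis
    using that[OF P.cring_K Q.phi_bij Q.phi_add Q.phi_flip Q.phi_br] .
qed

section \<open>Homomorphisms from the Steinberg group\<close>

context group
begin

primrec word_eval :: "('g \<Rightarrow> 'a) \<Rightarrow> 'g letters \<Rightarrow> 'a" where
  "word_eval f [] = \<one>"
| "word_eval f (x # w) = (if snd x then f (fst x) else inv f (fst x)) \<otimes> word_eval f w"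

lemma word_eval_closed: "f \<in> S \<rightarrow> carrier G \<Longrightarrow> w \<in> words S \<Longrightarrow> word_eval f w \<in> carrier G"
  by (induction w) (auto simp: words_def Pi_iff)

lemma word_eval_append:
  "f \<in> S \<rightarrow> carrier G \<Longrightarrow> u \<in> words S \<Longrightarrow> v \<in> words S \<Longrightarrow>
    word_eval f (u @ v) = word_eval f u \<otimes> word_eval f v"
proof (induction u)
  case Nil
  then show ?case using word_eval_closed[OF Nil(1,3)] by simp
next
  case (Cons x u)
  then have "u \<in> words S" "f (fst x) \<in> carrier G" by (auto simp: words_def)
  then show ?case
    using Cons word_eval_closed[OF Cons.prems(1)] by (simp add: m_assoc)
qed

lemma word_eval_rel:
  assumes f: "f \<in> S \<rightarrow> carrier G"
    and R: "\<And>u v. (u, v) \<in> R \<Longrightarrow> u \<in> words S \<Longrightarrow> v \<in> words S \<Longrightarrow> word_eval f u = word_eval f v"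
  shows "(u, v) \<in> presentation_rel S R \<Longrightarrow> word_eval f u = word_eval f v"
proof (induction rule: presentation_rel.induct)
  case (cong u v u' v')
  then show ?case using word_eval_append[OF f] presentation_rel_words by metis
next
  case (cancel g b)
  then have "f g \<in> carrier G" using f by auto
  then show ?case by simp
qed (use R in auto)

text \<open>Von Dyck's theorem: evaluation of words respects the generated congruence, so the
  representative chosen in \<open>Q\<close> is immaterial.\<close>

lemma presented_group_hom:
  assumes f: "f \<in> S \<rightarrow> carrier G"
    and R: "\<And>u v. (u, v) \<in> R \<Longrightarrow> u \<in> words S \<Longrightarrow> v \<in> words S \<Longrightarrow> word_eval f u = word_eval f v"
  obtains Q where "Q \<in> hom (presented_group S R) G"
    "\<And>w. w \<in> words S \<Longrightarrow> Q (presentation_rel S R `` {w}) = word_eval f w"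
proof -
  let ?c = "\<lambda>w. presentation_rel S R `` {w}"
  define Q where "Q A = word_eval f (SOME w. w \<in> A)" for A
  have Q: "Q (?c w) = word_eval f w" if w: "w \<in> words S" for w
  proof -
    have "w \<in> ?c w" using presentation_rel.refl[OF w] by blast
    then have "(SOME v. v \<in> ?c w) \<in> ?c w" by (rule someI)
    then show ?thesis using word_eval_rel[OF f R] unfolding Q_def by fastforce
  qed
  have carr: "\<exists>w\<in>words S. A = ?c w" if "A \<in> carrier (presented_group S R)" for A
    using that by (auto simp: presented_group_def quotient_def)
  have "Q \<in> hom (presented_group S R) G"
  proof (rule homI)
    fix A assume "A \<in> carrier (presented_group S R)"
    then obtain u where "u \<in> words S" "A = ?c u" using carr by blast
    then show "Q A \<in> carrier G" using Q word_eval_closed[OF f] by simp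
    fix B assume "B \<in> carrier (presented_group S R)"
    then obtain v where "v \<in> words S" "B = ?c v" using carr by blast
    moreover from this have "u @ v \<in> words S" using \<open>u \<in> words S\<close> by (simp add: words_def)
    ultimately show "Q (A \<otimes>\<^bsub>presented_group S R\<^esub> B) = Q A \<otimes> Q B"
      using \<open>u \<in> words S\<close> \<open>A = ?c u\<close> Q presented_group_mult[of u S v R] word_eval_append[OF f] by simp
  qed
  then show thesis using that Q by blast
qed

end

text \<open>The Steinberg relations for a family of elements of an arbitrary group. The notion
  covers the generators of the Steinberg group, their images under a homomorphism, and the elements
  to which a homomorphism is to be extended.\<close>

locale sto_family =
  fixes G :: "('a, 'm) monoid_scheme" and K :: "('k, 'r) ring_scheme"
    and \<phi> :: "'n signed_index \<Rightarrow> 'n signed_index \<Rightarrow> 'k \<Rightarrow> 'a"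
  assumes closed: "apart i j \<Longrightarrow> x \<in> carrier K \<Longrightarrow> \<phi> i j x \<in> carrier G"
    and add: "apart i j \<Longrightarrow> x \<in> carrier K \<Longrightarrow> y \<in> carrier K \<Longrightarrow>
      \<phi> i j (x \<oplus>\<^bsub>K\<^esub> y) = \<phi> i j x \<otimes>\<^bsub>G\<^esub> \<phi> i j y"
    and flip: "apart i j \<Longrightarrow> x \<in> carrier K \<Longrightarrow> \<phi> i j x = \<phi> (- j) (- i) (\<ominus>\<^bsub>K\<^esub> x)"
    and commute: "apart i j \<Longrightarrow> apart k l \<Longrightarrow> {- i, j} \<inter> {k, - l} = {} \<Longrightarrow> x \<in> carrier K \<Longrightarrow>
      y \<in> carrier K \<Longrightarrow> group_commutator G (\<phi> i j x) (\<phi> k l y) = \<one>\<^bsub>G\<^esub>"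
    and mult: "apart i j \<Longrightarrow> apart j k \<Longrightarrow> apart i k \<Longrightarrow> x \<in> carrier K \<Longrightarrow> y \<in> carrier K \<Longrightarrow>
      group_commutator G (\<phi> i j x) (\<phi> j k y) = \<phi> i k (x \<otimes>\<^bsub>K\<^esub> y)"
    and commute': "apart i j \<Longrightarrow> x \<in> carrier K \<Longrightarrow> y \<in> carrier K \<Longrightarrow>
      group_commutator G (\<phi> (- i) j x) (\<phi> j i y) = \<one>\<^bsub>G\<^esub>"

lemma commutator_t_word:
  "commutator_word (t_word i j x) (t_word k l y) =
    [((i, j, x), True), ((k, l, y), True), ((i, j, x), False), ((k, l, y), False)]"
  by (simp add: commutator_word_def t_word_def inverse_word_def)

lemma t_word_words:
  "apart i j \<Longrightarrow> x \<in> carrier K \<Longrightarrow> t_word i j x \<in> words (sto_gens K)"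
  by (auto simp: t_word_def words_def sto_gens_def apart_def)

lemma sto_family_hom:
  fixes K :: "('k, 'r) ring_scheme" and G :: "('a, 'm) monoid_scheme"
    and \<phi> :: "'n signed_index \<Rightarrow> 'n signed_index \<Rightarrow> 'k \<Rightarrow> 'a"
  assumes "group G" and "cring K" and "sto_family G K \<phi>"
  obtains Q where "Q \<in> hom (StO K) G"
    "\<And>i j x. apart i j \<Longrightarrow> x \<in> carrier K \<Longrightarrow> Q (sto_t K i j x) = \<phi> i j x"
proof -
  interpret group G by fact
  interpret K: cring K by fact
  interpret sto_family G K \<phi> by fact
  define f where "f = (\<lambda>(i, j, x). \<phi> i j x)"
  have f: "f \<in> sto_gens K \<rightarrow> carrier G"
    using closed by (auto simp: f_def sto_gens_def apart_def)
  have ev1: "word_eval f (t_word i j x) = \<phi> i j x" if "apart i j" "x \<in> carrier K" for i j x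
    using closed[OF that] by (simp add: t_word_def f_def)
  have evc: "word_eval f (commutator_word (t_word i j x) (t_word k l y))
      = group_commutator G (\<phi> i j x) (\<phi> k l y)"
    if "apart i j" "x \<in> carrier K" "apart k l" "y \<in> carrier K" for i j x k l y
    using closed[OF that(1,2)] closed[OF that(3,4)]
    by (simp add: commutator_t_word f_def group_commutator_def m_assoc)
  have R1: "word_eval f (t_word i j x @ t_word i j x') = word_eval f (t_word i j (x \<oplus>\<^bsub>K\<^esub> x'))"
    if "i \<noteq> j" "i \<noteq> - j" "x \<in> carrier K" "x' \<in> carrier K" for i j x x'
  proof -
    have ij: "apart i j" using that by (simp add: apart_def)
    show ?thesis
      using word_eval_append[OF f t_word_words[OF ij that(3)] t_word_words[OF ij that(4)]]
        ev1[OF ij] add[OF ij that(3,4)] that(3,4) by simp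
  qed
  have R2: "word_eval f (t_word (- j) (- i) (\<ominus>\<^bsub>K\<^esub> x)) = word_eval f (t_word i j x)"
    if "i \<noteq> j" "i \<noteq> - j" "x \<in> carrier K" for i j x
  proof -
    have ij: "apart i j" and ji: "apart (- j) (- i)" using that by (auto simp: apart_def)
    show ?thesis using ev1[OF ij that(3)] ev1[OF ji, of "\<ominus>\<^bsub>K\<^esub> x"] flip[OF ij that(3)] that(3) by simp
  qed
  have R3: "word_eval f (commutator_word (t_word i j x) (t_word k l y)) = \<one>\<^bsub>G\<^esub>"
    if "i \<noteq> j" "i \<noteq> - j" "k \<noteq> l" "k \<noteq> - l" "{- i, j} \<inter> {k, - l} = {}" "x \<in> carrier K" "y \<in> carrier K"
    for i j k l x y
    using evc[of i j x k l y] commute[of i j k l x y] that by (simp add: apart_def)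
  have R4: "word_eval f (commutator_word (t_word i j x) (t_word j k y)) = word_eval f (t_word i k (x \<otimes>\<^bsub>K\<^esub> y))"
    if "i \<noteq> j" "i \<noteq> - j" "j \<noteq> k" "j \<noteq> - k" "i \<noteq> k" "i \<noteq> - k" "x \<in> carrier K" "y \<in> carrier K"
    for i j k x y
    using evc[of i j x j k y] ev1[of i k "x \<otimes>\<^bsub>K\<^esub> y"] mult[of i j k x y] that by (simp add: apart_def)
  have R5: "word_eval f (commutator_word (t_word (- i) j x) (t_word j i y)) = \<one>\<^bsub>G\<^esub>"
    if "i \<noteq> j" "i \<noteq> - j" "x \<in> carrier K" "y \<in> carrier K" for i j x y
  proof -
    have ij: "apart i j" "apart (- i) j" "apart j i" using that by (auto simp: apart_def)
    show ?thesis using evc[OF ij(2) that(3) ij(3) that(4)] commute'[OF ij(1) that(3,4)] by simp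
  qed
  have R: "word_eval f u = word_eval f v" if "(u, v) \<in> sto_rels K" for u v
    using that unfolding sto_rels_def
    by (elim UnE CollectE exE conjE Pair_inject)
      (simp_all only: R1 R2 R3 R4 R5 word_eval.simps not_False_eq_True simp_thms)
  obtain Q where Q: "Q \<in> hom (presented_group (sto_gens K) (sto_rels K)) G"
    "\<And>w. w \<in> words (sto_gens K) \<Longrightarrow> Q (presentation_rel (sto_gens K) (sto_rels K) `` {w}) = word_eval f w"
    using presented_group_hom[OF f R] by blast
  show thesis
  proof (rule that[of Q])
    show "Q \<in> hom (StO K) G" using Q(1) by (simp add: StO_def)
    show "Q (sto_t K i j x) = \<phi> i j x" if "apart i j" "x \<in> carrier K" for i j x
      using Q(2)[OF t_word_words[OF that]] ev1[OF that] by (simp add: sto_t_def)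
  qed
qed

section \<open>Relations among the Steinberg generators\<close>

lemma presented_group_class:
  assumes "w \<in> words S"
  shows "presentation_rel S R `` {w} \<in> carrier (presented_group S R)"
  using assms by (auto simp: presented_group_def intro: quotientI)

lemma presented_group_inv:
  assumes w: "w \<in> words S"
  shows "inv\<^bsub>presented_group S R\<^esub> (presentation_rel S R `` {w}) = presentation_rel S R `` {inverse_word w}"
proof -
  interpret group "presented_group S R" by (rule group_presented_group)
  have iw: "inverse_word w \<in> words S" using w by (auto simp: words_def inverse_word_def)
  have "presentation_rel S R `` {inverse_word w} \<otimes>\<^bsub>presented_group S R\<^esub> presentation_rel S R `` {w}
      = presentation_rel S R `` {[]}"
    using presented_group_mult[OF iw w]
      equiv_class_eq[OF equiv_presentation_rel inverse_word_rel[OF w]] by simp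
  then show ?thesis
    using inv_equality presented_group_class[OF w] presented_group_class[OF iw]
    by (simp add: presented_group_def)
qed

lemma sto_rels_intros:
  assumes "apart i j" "x \<in> carrier K"
  shows "y \<in> carrier K \<Longrightarrow> (t_word i j x @ t_word i j y, t_word i j (x \<oplus>\<^bsub>K\<^esub> y)) \<in> sto_rels K"
    and "(t_word i j x, t_word (- j) (- i) (\<ominus>\<^bsub>K\<^esub> x)) \<in> sto_rels K"
    and "apart k l \<Longrightarrow> {- i, j} \<inter> {k, - l} = {} \<Longrightarrow> y \<in> carrier K \<Longrightarrow>
      (commutator_word (t_word i j x) (t_word k l y), []) \<in> sto_rels K"
    and "apart j k \<Longrightarrow> apart i k \<Longrightarrow> y \<in> carrier K \<Longrightarrow>
      (commutator_word (t_word i j x) (t_word j k y), t_word i k (x \<otimes>\<^bsub>K\<^esub> y)) \<in> sto_rels K"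
    and "y \<in> carrier K \<Longrightarrow> (commutator_word (t_word (- i) j x) (t_word j i y), []) \<in> sto_rels K"
  unfolding sto_rels_def
  subgoal
    by (rule UnI1, rule UnI1, rule UnI1, rule UnI1, intro CollectI exI conjI, rule HOL.refl)
      (use assms in \<open>simp_all add: apart_def\<close>)
  subgoal
    by (rule UnI1, rule UnI1, rule UnI1, rule UnI2, intro CollectI exI conjI, rule HOL.refl)
      (use assms in \<open>simp_all add: apart_def\<close>)
  subgoal
    by (rule UnI1, rule UnI1, rule UnI2, intro CollectI exI conjI, rule HOL.refl)
      (use assms in \<open>simp_all add: apart_def\<close>)
  subgoal
    by (rule UnI1, rule UnI2, intro CollectI exI conjI, rule HOL.refl)
      (use assms in \<open>simp_all add: apart_def\<close>)
  subgoal
    by (rule UnI2, intro CollectI exI conjI, rule HOL.refl)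
      (use assms in \<open>simp_all add: apart_def\<close>)
  done

text \<open>With \<open>sto_family_hom_image\<close>, this allows coordinatizations to be compared
  through elements of \<open>G\<close> alone, without returning to words.\<close>

lemma sto_family_sto_t:
  fixes K :: "('k, 'r) ring_scheme"
  assumes K: "cring K"
  shows "sto_family (StO K) K
    (sto_t K :: 'n signed_index \<Rightarrow> 'n signed_index \<Rightarrow> 'k \<Rightarrow> ('n, 'k) sto_gen letters set)"
proof -
  interpret K: cring K by fact
  define S :: "('n, 'k) sto_gen set" where "S = sto_gens K"
  define c where "c w = presentation_rel S (sto_rels K) `` {w}" for w
  have S: "StO K = presented_group S (sto_rels K)" and t: "sto_t K i j x = c (t_word i j x)" for i j :: "'n signed_index" and x
    by (simp_all add: StO_def S_def sto_t_def c_def)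
  have tw: "t_word i j x \<in> words S" if "apart i j" "x \<in> carrier K" for i j :: "'n signed_index" and x
    unfolding S_def using t_word_words[OF that] .
  have mult: "c u \<otimes>\<^bsub>StO K\<^esub> c v = c (u @ v)" if "u \<in> words S" "v \<in> words S" for u v
    unfolding S c_def using presented_group_mult[OF that] .
  have inv: "inv\<^bsub>StO K\<^esub> (c u) = c (inverse_word u)" if "u \<in> words S" for u
    unfolding S c_def using presented_group_inv[OF that] .
  have cl: "u @ v \<in> words S" "inverse_word u \<in> words S" if "u \<in> words S" "v \<in> words S" for u v
    using that by (auto simp: words_def inverse_word_def)
  have comm: "group_commutator (StO K) (c u) (c v) = c (commutator_word u v)"
    if "u \<in> words S" "v \<in> words S" for u v
    using that cl by (simp add: group_commutator_def commutator_word_def mult inv)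
  have rel: "c u = c v" if "(u, v) \<in> sto_rels K" "u \<in> words S" "v \<in> words S" for u v
    unfolding c_def
    using equiv_class_eq[OF equiv_presentation_rel presentation_rel.rel[OF that]] .
  have cw: "commutator_word u v \<in> words S" if "u \<in> words S" "v \<in> words S" for u v
    using that cl by (simp add: commutator_word_def)
  have nil: "[] \<in> words S" "\<one>\<^bsub>StO K\<^esub> = c []"
    by (simp_all add: words_def S presented_group_def c_def)
  show ?thesis
  proof
    fix i j :: "'n signed_index" and x assume ij: "apart i j" and x: "x \<in> carrier K"
    show "sto_t K i j x \<in> carrier (StO K)"
      unfolding t S unfolding c_def by (rule presented_group_class[OF tw[OF ij x]])
    have ji: "apart (- j) (- i)" "apart (- i) j" "apart j i" using ij by (simp_all add: apart_commute)
    show "sto_t K i j x = sto_t K (- j) (- i) (\<ominus>\<^bsub>K\<^esub> x)"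
      unfolding t by (rule rel[OF sto_rels_intros(2)[OF ij x] tw[OF ij x] tw[OF ji(1) K.a_inv_closed[OF x]]])
    fix y assume y: "y \<in> carrier K"
    show "sto_t K i j (x \<oplus>\<^bsub>K\<^esub> y) = sto_t K i j x \<otimes>\<^bsub>StO K\<^esub> sto_t K i j y"
      unfolding t mult[OF tw[OF ij x] tw[OF ij y]]
      by (rule rel[OF sto_rels_intros(1)[OF ij x y] cl(1)[OF tw[OF ij x] tw[OF ij y]]
            tw[OF ij K.a_closed[OF x y]], symmetric])
    show "group_commutator (StO K) (sto_t K (- i) j x) (sto_t K j i y) = \<one>\<^bsub>StO K\<^esub>"
      unfolding t nil(2) comm[OF tw[OF ji(2) x] tw[OF ji(3) y]]
      by (rule rel[OF sto_rels_intros(5)[OF ij x y] cw[OF tw[OF ji(2) x] tw[OF ji(3) y]] nil(1)])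
  next
    fix i j k l :: "'n signed_index" and x y
    assume ij: "apart i j" and kl: "apart k l" and d: "{- i, j} \<inter> {k, - l} = {}"
      and x: "x \<in> carrier K" and y: "y \<in> carrier K"
    show "group_commutator (StO K) (sto_t K i j x) (sto_t K k l y) = \<one>\<^bsub>StO K\<^esub>"
      unfolding t nil(2) comm[OF tw[OF ij x] tw[OF kl y]]
      by (rule rel[OF sto_rels_intros(3)[OF ij x kl d y] cw[OF tw[OF ij x] tw[OF kl y]] nil(1)])
  next
    fix i j k :: "'n signed_index" and x y
    assume ij: "apart i j" and jk: "apart j k" and ik: "apart i k"
      and x: "x \<in> carrier K" and y: "y \<in> carrier K"
    show "group_commutator (StO K) (sto_t K i j x) (sto_t K j k y) = sto_t K i k (x \<otimes>\<^bsub>K\<^esub> y)"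
      unfolding t comm[OF tw[OF ij x] tw[OF jk y]]
      by (rule rel[OF sto_rels_intros(4)[OF ij x jk ik y] cw[OF tw[OF ij x] tw[OF jk y]]
            tw[OF ik K.m_closed[OF x y]]])
  qed
qed

lemma sto_family_hom_image:
  fixes \<phi> :: "'n signed_index \<Rightarrow> 'n signed_index \<Rightarrow> 'k \<Rightarrow> 'a"
  assumes G: "group G" and H: "group H" and Q: "Q \<in> hom H G" and \<phi>: "sto_family H K \<phi>"
  shows "sto_family G K (\<lambda>i j x. Q (\<phi> i j x))"
proof -
  interpret group_hom H G Q using G H Q by (simp add: group_hom_def group_hom_axioms_def)
  interpret sto_family H K \<phi> by fact
  have comm: "group_commutator G (Q x) (Q y) = Q (group_commutator H x y)"
    if "x \<in> carrier H" "y \<in> carrier H" for x y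
    using that by (simp add: group_commutator_def)
  show ?thesis
  proof
    fix i j :: "'n signed_index" and x assume ij: "apart i j" and x: "x \<in> carrier K"
    have nij: "apart (- i) j" "apart j i" using ij by (simp_all add: apart_commute)
    show "Q (\<phi> i j x) \<in> carrier G" "Q (\<phi> i j x) = Q (\<phi> (- j) (- i) (\<ominus>\<^bsub>K\<^esub> x))"
      using closed[OF ij x] flip[OF ij x] by simp_all
    fix y assume y: "y \<in> carrier K"
    show "Q (\<phi> i j (x \<oplus>\<^bsub>K\<^esub> y)) = Q (\<phi> i j x) \<otimes>\<^bsub>G\<^esub> Q (\<phi> i j y)"
      using add[OF ij x y] closed[OF ij x] closed[OF ij y] by simp
    show "group_commutator G (Q (\<phi> (- i) j x)) (Q (\<phi> j i y)) = \<one>\<^bsub>G\<^esub>"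
      using comm commute'[OF ij x y] closed[OF nij(1) x] closed[OF nij(2) y] by simp
  qed (use comm commute mult closed in simp_all)
qed

section \<open>Comparison of two coordinate systems\<close>

locale coordinate_pair =
  K: cring K + L: cring L
  for K :: "('k, 'r) ring_scheme" and L :: "('l, 's) ring_scheme"
    and \<phi> :: "'n::finite signed_index \<Rightarrow> 'n signed_index \<Rightarrow> 'k \<Rightarrow> 'a"
    and \<phi>' :: "'n signed_index \<Rightarrow> 'n signed_index \<Rightarrow> 'l \<Rightarrow> 'a"
    and Y :: "'n signed_index \<Rightarrow> 'n signed_index \<Rightarrow> 'a set"
    and G :: "('a, 'm) monoid_scheme" +
  assumes rank: "4 \<le> CARD('n)"
    and \<phi>: "sto_family G K \<phi>" and \<phi>': "sto_family G L \<phi>'"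
    and bij: "apart i j \<Longrightarrow> bij_betw (\<phi> i j) (carrier K) (Y i j)"
    and bij': "apart i j \<Longrightarrow> bij_betw (\<phi>' i j) (carrier L) (Y i j)"
begin

text \<open>The transition map on one root subgroup, characterized by
  \<open>\<phi> i j (\<psi> i j x) = \<phi>' i j x\<close>. It exists because both families
  parametrize the same set \<open>Y i j\<close>.\<close>

definition \<psi> :: "'n signed_index \<Rightarrow> 'n signed_index \<Rightarrow> 'l \<Rightarrow> 'k" where "\<psi> i j x = inv_into (carrier K) (\<phi> i j) (\<phi>' i j x)"

lemma \<phi>_inj: "apart i j \<Longrightarrow> x \<in> carrier K \<Longrightarrow> y \<in> carrier K \<Longrightarrow> \<phi> i j x = \<phi> i j y \<Longrightarrow> x = y"
  using bij unfolding bij_betw_def inj_on_def by blast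

lemma \<psi>:
  assumes "apart i j" "x \<in> carrier L"
  shows "\<psi> i j x \<in> carrier K" "\<phi> i j (\<psi> i j x) = \<phi>' i j x"
proof -
  have "\<phi>' i j x \<in> \<phi> i j ` carrier K"
    using bij[OF assms(1)] bij'[OF assms(1)] assms(2) unfolding bij_betw_def by blast
  then show "\<psi> i j x \<in> carrier K" "\<phi> i j (\<psi> i j x) = \<phi>' i j x"
    unfolding \<psi>_def by (simp_all add: inv_into_into f_inv_into_f)
qed

lemma \<psi>_eqI: "apart i j \<Longrightarrow> x \<in> carrier L \<Longrightarrow> y \<in> carrier K \<Longrightarrow> \<phi> i j y = \<phi>' i j x \<Longrightarrow> \<psi> i j x = y"
  using \<psi> \<phi>_inj by metis

lemma \<psi>_bij: "apart i j \<Longrightarrow> bij_betw (\<psi> i j) (carrier L) (carrier K)"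
  using bij_betw_trans[OF bij' bij_betw_inv_into[OF bij]] unfolding \<psi>_def comp_def by blast

lemma \<psi>_add:
  assumes "apart i j" "x \<in> carrier L" "y \<in> carrier L"
  shows "\<psi> i j (x \<oplus>\<^bsub>L\<^esub> y) = \<psi> i j x \<oplus>\<^bsub>K\<^esub> \<psi> i j y"
  using assms \<psi> sto_family.add[OF \<phi>] sto_family.add[OF \<phi>'] by (intro \<psi>_eqI) simp_all

lemma \<psi>_mult:
  assumes "apart i j" "apart j k" "apart i k" "x \<in> carrier L" "y \<in> carrier L"
  shows "\<psi> i j x \<otimes>\<^bsub>K\<^esub> \<psi> j k y = \<psi> i k (x \<otimes>\<^bsub>L\<^esub> y)"
  using assms \<psi> sto_family.mult[OF \<phi>, of i j k "\<psi> i j x" "\<psi> j k y"] sto_family.mult[OF \<phi>', of i j k x y]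
  by (intro \<psi>_eqI[symmetric]) simp_all

lemma \<psi>_neg:
  assumes "apart i j" "x \<in> carrier L"
  shows "\<psi> i j (\<ominus>\<^bsub>L\<^esub> x) = \<ominus>\<^bsub>K\<^esub> \<psi> i j x"
proof -
  have z: "\<psi> i j \<zero>\<^bsub>L\<^esub> = \<zero>\<^bsub>K\<^esub>"
    using \<psi>_add[OF assms(1) L.zero_closed L.zero_closed] \<psi>(1)[OF assms(1) L.zero_closed]
    by (metis K.add.l_cancel_one K.zero_closed L.zero_closed L.l_zero)
  have "\<psi> i j (\<ominus>\<^bsub>L\<^esub> x) \<oplus>\<^bsub>K\<^esub> \<psi> i j x = \<zero>\<^bsub>K\<^esub>"
    using \<psi>_add[OF assms(1) L.a_inv_closed[OF assms(2)] assms(2)] assms(2) z by (simp add: L.l_neg)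
  then show ?thesis
    using K.minus_equality \<psi>(1)[OF assms] \<psi>(1)[OF assms(1) L.a_inv_closed[OF assms(2)]] by metis
qed

text \<open>The flip costs a sign in either coordinate system, and the two signs cancel.\<close>

lemma \<psi>_flip:
  assumes ij: "apart i j" and x: "x \<in> carrier L"
  shows "\<psi> (- j) (- i) x = \<psi> i j x"
proof -
  have ji: "apart (- j) (- i)" using ij by (simp add: apart_commute)
  have "\<phi> i j (\<psi> i j x) = \<phi>' (- j) (- i) (\<ominus>\<^bsub>L\<^esub> x)"
    using \<psi>[OF ij x] sto_family.flip[OF \<phi>' ij x] by simp
  also have "\<dots> = \<phi> (- j) (- i) (\<ominus>\<^bsub>K\<^esub> \<psi> (- j) (- i) x)"
    using \<psi>(2)[OF ji L.a_inv_closed[OF x]] \<psi>_neg[OF ji x] by simp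
  also have "\<dots> = \<phi> i j (\<psi> (- j) (- i) x)"
    using sto_family.flip[OF \<phi> ij \<psi>(1)[OF ji x]] by simp
  finally show ?thesis using \<phi>_inj[OF ij \<psi>(1)[OF ij x] \<psi>(1)[OF ji x]] by simp
qed

lemma apart_ex: "\<exists>l :: 'n signed_index. apart l i \<and> apart l j \<and> apart l k"
  by (rule apart_exists[OF rank])

lemma coordinate_change_exists:
  obtains F a where
    "F \<in> ring_iso L K" "\<And>i. a i \<in> Units K"
    "\<And>i j. a i \<otimes>\<^bsub>K\<^esub> a (- i) = a j \<otimes>\<^bsub>K\<^esub> a (- j)"
    "\<And>i j x. apart i j \<Longrightarrow> x \<in> carrier L \<Longrightarrow> \<phi>' i j x = \<phi> i j (F x \<otimes>\<^bsub>K\<^esub> (a i \<otimes>\<^bsub>K\<^esub> inv\<^bsub>K\<^esub> a j))"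
proof -
  define u where "u i j = \<psi> i j \<one>\<^bsub>L\<^esub>" for i j
  have uc: "u i j \<in> carrier K" if "apart i j" for i j using \<psi>(1)[OF that] by (simp add: u_def)
  have u_right: "\<psi> i j x \<otimes>\<^bsub>K\<^esub> u j k = \<psi> i k x" and u_left: "u i j \<otimes>\<^bsub>K\<^esub> \<psi> j k x = \<psi> i k x"
    if "apart i j" "apart j k" "apart i k" "x \<in> carrier L" for i j k x
    using \<psi>_mult[OF that(1-3)] that(4) by (simp_all add: u_def)
  have u_unit: "u i j \<in> Units K" if ij: "apart i j" for i j
  proof -
    obtain k where k: "apart k i" "apart k j" using apart_ex by blast
    then have ap: "apart i k" "apart j k" by (simp_all add: apart_commute)
    \<comment> \<open>Surjectivity of the transition map on \<open>i, k\<close> yields an inverse of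
      \<open>u i j\<close> among the values of the one on \<open>j, k\<close>.\<close>
    have "\<one>\<^bsub>K\<^esub> \<in> \<psi> i k ` carrier L"
      using \<psi>_bij[OF ap(1)] unfolding bij_betw_def by simp
    then obtain x where x: "x \<in> carrier L" "\<psi> i k x = \<one>\<^bsub>K\<^esub>" by auto
    then show ?thesis
      using u_left[OF ij ap(2,1) x(1)] uc[OF ij] \<psi>(1)[OF ap(2) x(1)] by (intro K.UnitsI) auto
  qed
  have cocycle: "u i j \<otimes>\<^bsub>K\<^esub> u j k = u i k" if "apart i j" "apart j k" "apart i k" for i j k
    using u_right[OF that L.one_closed] by (simp add: u_def)
  have "\<exists>a. (\<forall>i\<in>UNIV. a i \<in> Units K) \<and> (\<forall>i\<in>UNIV. \<forall>j\<in>UNIV. apart i j \<longrightarrow> u i j \<otimes>\<^bsub>K\<^esub> a j = a i)"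
  proof (rule K.cocycle_trivial)
    show "\<exists>m\<in>UNIV. apart m i \<and> apart m j" for i j :: "'n signed_index"
      using apart_ex[of i j] by blast
  qed (use u_unit cocycle in auto)
  then obtain a where a: "\<And>i. a i \<in> Units K" and ua: "\<And>i j. apart i j \<Longrightarrow> u i j \<otimes>\<^bsub>K\<^esub> a j = a i"
    by blast
  note ac = K.Units_closed[OF a]
  have u_eq: "u i j = a i \<otimes>\<^bsub>K\<^esub> inv\<^bsub>K\<^esub> a j" if ij: "apart i j" for i j
  proof -
    have "u i j \<otimes>\<^bsub>K\<^esub> a j \<otimes>\<^bsub>K\<^esub> inv\<^bsub>K\<^esub> a j = u i j"
      using uc[OF ij] ac a[of j] by (simp add: K.m_assoc)
    then show ?thesis using ua[OF ij] by simp
  qed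
  have prod: "a i \<otimes>\<^bsub>K\<^esub> a (- i) = a j \<otimes>\<^bsub>K\<^esub> a (- j)" for i j
  proof (cases "apart i j")
    case True
    \<comment> \<open>In terms of \<open>a\<close> this equality reads
      \<open>a (- j) / a (- i) = a i / a j\<close>, which is the condition on the products.\<close>
    have "u (- j) (- i) = u i j" unfolding u_def using \<psi>_flip[OF True] by simp
    moreover have "u (- j) (- i) \<otimes>\<^bsub>K\<^esub> a (- i) = a (- j)" using ua[of "- j" "- i"] True by (simp add: apart_commute)
    ultimately have "u i j \<otimes>\<^bsub>K\<^esub> a (- i) = a (- j)" by simp
    then have "a j \<otimes>\<^bsub>K\<^esub> a (- j) = (u i j \<otimes>\<^bsub>K\<^esub> a j) \<otimes>\<^bsub>K\<^esub> a (- i)"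
      using uc[OF True] ac by (metis K.m_assoc K.m_comm)
    then show ?thesis using ua[OF True] by simp
  next
    case False
    then show ?thesis using ac K.m_comm by (auto elim!: not_apart_cases)
  qed
  define ratio where "ratio i j x = \<psi> i j x \<otimes>\<^bsub>K\<^esub> inv\<^bsub>K\<^esub> u i j" for i j x
  have ratio_closed: "ratio i j x \<in> carrier K" if "apart i j" "x \<in> carrier L" for i j x
    using \<psi>(1)[OF that] u_unit[OF that(1)] by (simp add: ratio_def)
  have ratio: "\<psi> i j x = ratio i j x \<otimes>\<^bsub>K\<^esub> u i j" if "apart i j" "x \<in> carrier L" for i j x
    using \<psi>(1)[OF that] u_unit[OF that(1)] uc[OF that(1)] by (simp add: ratio_def K.m_assoc)
  have ratio_eqI: "ratio i j x = c"
    if "apart i j" "x \<in> carrier L" "c \<in> carrier K" "\<psi> i j x = c \<otimes>\<^bsub>K\<^esub> u i j" for i j x c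
    using that u_unit[OF that(1)] uc[OF that(1)] by (simp add: ratio_def K.m_assoc)
  have r1: "ratio i k x = ratio i j x" if ap: "apart i j" "apart j k" "apart i k" and x: "x \<in> carrier L" for i j k x
  proof (rule ratio_eqI[OF ap(3) x ratio_closed[OF ap(1) x]])
    show "\<psi> i k x = ratio i j x \<otimes>\<^bsub>K\<^esub> u i k"
      using u_right[OF ap x] ratio[OF ap(1) x] cocycle[OF ap] ratio_closed[OF ap(1) x] uc[OF ap(1)] uc[OF ap(2)]
      by (metis K.m_assoc)
  qed
  have r2: "ratio i k x = ratio j k x" if ap: "apart i j" "apart j k" "apart i k" and x: "x \<in> carrier L" for i j k x
  proof (rule ratio_eqI[OF ap(3) x ratio_closed[OF ap(2) x]])
    have "\<psi> i k x = u i j \<otimes>\<^bsub>K\<^esub> (ratio j k x \<otimes>\<^bsub>K\<^esub> u j k)"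
      using u_left[OF ap x] ratio[OF ap(2) x] by simp
    also have "\<dots> = ratio j k x \<otimes>\<^bsub>K\<^esub> (u i j \<otimes>\<^bsub>K\<^esub> u j k)"
      using ratio_closed[OF ap(2) x] uc[OF ap(1)] uc[OF ap(2)] by (simp add: K.m_lcomm)
    finally show "\<psi> i k x = ratio j k x \<otimes>\<^bsub>K\<^esub> u i k" using cocycle[OF ap] by simp
  qed
  fix p :: "'n signed_index"
  obtain q where pq: "apart q p" using apart_ex by blast
  define F where "F = ratio q p"
  have ratio_F: "ratio i j x = F x" if ij: "apart i j" and x: "x \<in> carrier L" for i j x
  proof -
    \<comment> \<open>Only one index can be changed at a time, and only to an index apart from both
      old ones. The pair \<open>i, j\<close> reaches \<open>q, p\<close> through
      \<open>i, m\<close>, then \<open>n, m\<close>, \<open>q, m\<close> and \<open>q, l\<close>;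
      \<open>n\<close> and \<open>l\<close> serve the cases where \<open>i\<close> and
      \<open>q\<close>, or \<open>m\<close> and \<open>p\<close>, have the same absolute
      value.\<close>
    obtain m where m: "apart m i" "apart m j" "apart m q" using apart_ex by blast
    obtain n where n: "apart n i" "apart n q" "apart n m" using apart_ex by blast
    obtain l where l: "apart l q" "apart l m" "apart l p" using apart_ex by blast
    have "ratio i j x = ratio i m x"
      using r1[of i m j x] ij m x by (simp add: apart_commute)
    also have "\<dots> = ratio n m x"
      using r2[of i n m x] n m x by (simp add: apart_commute)
    also have "\<dots> = ratio q m x"
      using r2[of q n m x] n m x by (simp add: apart_commute)
    also have "\<dots> = ratio q l x"
      using r1[of q l m x] l m x by (simp add: apart_commute)
    also have "\<dots> = ratio q p x"
      using r1[of q l p x] l pq x by (simp add: apart_commute)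
    finally show ?thesis by (simp add: F_def)
  qed
  have F_closed: "F x \<in> carrier K" if "x \<in> carrier L" for x
    using ratio_closed[OF pq that] by (simp add: F_def)
  have \<psi>_F: "\<psi> i j x = F x \<otimes>\<^bsub>K\<^esub> u i j" if "apart i j" "x \<in> carrier L" for i j x
    using ratio[OF that] ratio_F[OF that] by simp
  have F_eqI: "F x = c" if "x \<in> carrier L" "c \<in> carrier K" "apart i j" "\<psi> i j x = c \<otimes>\<^bsub>K\<^esub> u i j" for x c i j
    using ratio_eqI[OF that(3,1,2,4)] ratio_F[OF that(3,1)] by simp
  have "F \<in> ring_iso L K"
  proof (rule ring_iso_memI)
    fix x y assume x: "x \<in> carrier L" and y: "y \<in> carrier L"
    show "F x \<in> carrier K" using F_closed[OF x] .
    show "F (x \<oplus>\<^bsub>L\<^esub> y) = F x \<oplus>\<^bsub>K\<^esub> F y"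
    proof (rule F_eqI[OF _ _ pq])
      show "\<psi> q p (x \<oplus>\<^bsub>L\<^esub> y) = (F x \<oplus>\<^bsub>K\<^esub> F y) \<otimes>\<^bsub>K\<^esub> u q p"
        using \<psi>_add[OF pq x y] \<psi>_F[OF pq x] \<psi>_F[OF pq y] F_closed x y uc[OF pq] by (simp add: K.l_distr)
    qed (use x y F_closed in auto)
    \<comment> \<open>The product is computed along \<open>q, k, p\<close>, where the units
      \<open>u q k\<close> and \<open>u k p\<close> combine to \<open>u q p\<close>.\<close>
    obtain k where k: "apart k q" "apart k p" using apart_ex by blast
    have qk: "apart q k" using k by (simp add: apart_commute)
    show "F (x \<otimes>\<^bsub>L\<^esub> y) = F x \<otimes>\<^bsub>K\<^esub> F y"
    proof (rule F_eqI[OF _ _ pq])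
      have "\<psi> q p (x \<otimes>\<^bsub>L\<^esub> y) = (F x \<otimes>\<^bsub>K\<^esub> u q k) \<otimes>\<^bsub>K\<^esub> (F y \<otimes>\<^bsub>K\<^esub> u k p)"
        using \<psi>_mult[OF qk k(2) pq x y] \<psi>_F[OF qk x] \<psi>_F[OF k(2) y] by simp
      also have "\<dots> = (F x \<otimes>\<^bsub>K\<^esub> F y) \<otimes>\<^bsub>K\<^esub> (u q k \<otimes>\<^bsub>K\<^esub> u k p)"
        using F_closed x y uc[OF qk] uc[OF k(2)] by (simp add: K.m_ac)
      finally show "\<psi> q p (x \<otimes>\<^bsub>L\<^esub> y) = F x \<otimes>\<^bsub>K\<^esub> F y \<otimes>\<^bsub>K\<^esub> u q p"
        using cocycle[OF qk k(2) pq] by simp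
    qed (use x y F_closed in auto)
  next
    show "F \<one>\<^bsub>L\<^esub> = \<one>\<^bsub>K\<^esub>"
      by (rule F_eqI[OF _ _ pq]) (use uc[OF pq] in \<open>simp_all add: u_def\<close>)
  next
    have F_inj: "x = y" if "x \<in> carrier L" "y \<in> carrier L" "F x = F y" for x y
      using \<psi>_bij[OF pq] \<psi>_F[OF pq] that unfolding bij_betw_def inj_on_def by metis
    have F_surj: "\<exists>x\<in>carrier L. F x = c" if c: "c \<in> carrier K" for c
    proof -
      have "c \<otimes>\<^bsub>K\<^esub> u q p \<in> \<psi> q p ` carrier L"
        using \<psi>_bij[OF pq] c uc[OF pq] unfolding bij_betw_def by simp
      then obtain x where x: "x \<in> carrier L" "\<psi> q p x = c \<otimes>\<^bsub>K\<^esub> u q p" by auto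
      then show ?thesis using F_eqI[OF x(1) c pq x(2)] by blast
    qed
    show "bij_betw F (carrier L) (carrier K)"
      unfolding bij_betw_def
    proof (intro conjI inj_onI equalityI subsetI)
      fix c assume "c \<in> carrier K"
      then show "c \<in> F ` carrier L" using F_surj by (auto simp: image_iff)
    qed (use F_inj F_closed in auto)
  qed
  moreover have "\<phi>' i j x = \<phi> i j (F x \<otimes>\<^bsub>K\<^esub> (a i \<otimes>\<^bsub>K\<^esub> inv\<^bsub>K\<^esub> a j))" if "apart i j" "x \<in> carrier L" for i j x
    using \<psi>(2)[OF that] \<psi>_F[OF that] u_eq[OF that(1)] by simp
  ultimately show thesis using that a prod by blast
qed

end

section \<open>Roots of type D\<close>

abbreviation droot :: "'n::finite signed_index \<Rightarrow> 'n signed_index \<Rightarrow> real ^ 'n" where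
  "droot i j \<equiv> basis_vec j - basis_vec i"

declare basis_vec_uminus [simp]

lemma basis_vec_inner_self [simp]: "basis_vec i \<bullet> basis_vec i = 1"
  by (cases i) (auto simp: inner_axis_axis)

lemma basis_vec_inner_apart: "apart i j \<Longrightarrow> basis_vec i \<bullet> basis_vec j = 0"
  by (cases i; cases j) (auto simp: inner_axis_axis apart_def)

lemma basis_vec_inner_Ints: "basis_vec i \<bullet> basis_vec j \<in> \<int>"
  by (cases i; cases j) (auto simp: inner_axis_axis)

lemma root_in_D_roots: "apart i j \<Longrightarrow> droot i j \<in> D_roots"
  unfolding D_roots_eq apart_def by blast

lemma D_roots_cases:
  assumes "\<alpha> \<in> D_roots"
  obtains i j where "\<alpha> = droot i j" "apart i j"
  using assms unfolding D_roots_eq apart_def by blast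

lemma D_roots_uminus: "\<alpha> \<in> D_roots \<Longrightarrow> - \<alpha> \<in> D_roots"
  by (elim D_roots_cases) (metis apart_commute minus_diff_eq root_in_D_roots)

section \<open>Angles, intervals and cones of pairs of roots\<close>

lemma root_inner_self: "apart i j \<Longrightarrow> droot i j \<bullet> droot i j = 2"
  by (simp add: inner_diff_left inner_diff_right basis_vec_inner_apart inner_commute)

lemma D_roots_inner_self: "\<alpha> \<in> D_roots \<Longrightarrow> \<alpha> \<bullet> \<alpha> = 2"
  by (elim D_roots_cases) (simp add: root_inner_self)

lemma D_roots_inner_Ints: "\<alpha> \<in> D_roots \<Longrightarrow> \<beta> \<in> D_roots \<Longrightarrow> \<alpha> \<bullet> \<beta> \<in> \<int>"
  by (elim D_roots_cases)
    (simp only: inner_diff_left inner_diff_right, intro Ints_diff basis_vec_inner_Ints)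

lemma D_roots_inner_le:
  assumes "\<alpha> \<in> D_roots" "\<beta> \<in> D_roots"
  shows "\<bar>\<alpha> \<bullet> \<beta>\<bar> \<le> 2"
  using Cauchy_Schwarz_ineq2[of \<alpha> \<beta>] D_roots_inner_self[OF assms(1)] D_roots_inner_self[OF assms(2)]
  by (simp add: norm_eq_sqrt_inner)

lemma D_roots_inner_cases:
  assumes "\<alpha> \<in> D_roots" "\<beta> \<in> D_roots"
  shows "\<alpha> \<bullet> \<beta> \<in> {-2, -1, 0, 1, 2}"
proof -
  obtain k where k: "\<alpha> \<bullet> \<beta> = of_int k" using D_roots_inner_Ints[OF assms] by (auto elim: Ints_cases)
  then have "k \<in> {-2..2}" using D_roots_inner_le[OF assms] by auto
  then have "k \<in> {-2, -1, 0, 1, 2}" by auto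
  then show ?thesis using k by auto
qed

text \<open>The inner products \<open>p\<close>, \<open>q\<close> of \<open>\<gamma> = a \<alpha> + b \<beta>\<close> with \<open>\<alpha>\<close> and \<open>\<beta>\<close> are small integers that
  determine \<open>a\<close> and \<open>b\<close>, and \<open>a p + b q = \<gamma> \<bullet> \<gamma> = 2\<close> leaves finitely many cases.\<close>

lemma root_interval_coeffs:
  assumes \<alpha>: "\<alpha> \<in> D_roots" and \<beta>: "\<beta> \<in> D_roots" and \<gamma>: "a *\<^sub>R \<alpha> + b *\<^sub>R \<beta> \<in> D_roots"
    and pos: "a > 0" "b > 0" and c: "\<alpha> \<bullet> \<beta> \<in> {-1, 0, 1}"
  shows "\<alpha> \<bullet> \<beta> = -1 \<and> a = 1 \<and> b = 1"
proof -
  define \<gamma>' where "\<gamma>' = a *\<^sub>R \<alpha> + b *\<^sub>R \<beta>"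
  define p q where "p = \<gamma>' \<bullet> \<alpha>" and "q = \<gamma>' \<bullet> \<beta>"
  have \<gamma>': "\<gamma>' \<in> D_roots" using \<gamma> by (simp add: \<gamma>'_def)
  have p: "p = 2 * a + b * (\<alpha> \<bullet> \<beta>)" and q: "q = a * (\<alpha> \<bullet> \<beta>) + 2 * b"
    using D_roots_inner_self[OF \<alpha>] D_roots_inner_self[OF \<beta>]
    by (simp_all add: p_def q_def \<gamma>'_def inner_add_left inner_commute[of \<beta> \<alpha>])
  have "\<gamma>' \<bullet> \<gamma>' = a * p + b * q"
    by (subst (2) \<gamma>'_def) (simp add: p_def q_def inner_add_right)
  then have pq: "a * p + b * q = 2" using D_roots_inner_self[OF \<gamma>'] by simp
  have P: "p \<in> {-2, -1, 0, 1, 2}" and Q: "q \<in> {-2, -1, 0, 1, 2}"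
    using D_roots_inner_cases[OF \<gamma>' \<alpha>] D_roots_inner_cases[OF \<gamma>' \<beta>] by (simp_all add: p_def q_def)
  consider "\<alpha> \<bullet> \<beta> = -1" | "\<alpha> \<bullet> \<beta> = 0" | "\<alpha> \<bullet> \<beta> = 1" using c by auto
  then show ?thesis
  proof cases
    case 1
    \<comment> \<open>This inverts the Gram matrix of \<open>\<alpha>\<close> and
      \<open>\<beta>\<close>, so that the remaining condition is a quadratic equation in the two
      small integers.\<close>
    then have ab: "3 * a = 2 * p + q" "3 * b = p + 2 * q" using p q by simp_all
    have "(3 * a) * p + (3 * b) * q = 6" using pq by simp
    then have "p * p + p * q + q * q = 3" unfolding ab by (simp add: algebra_simps)
    moreover have "2 * p + q > 0" "p + 2 * q > 0" using ab pos by linarith+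
    moreover have "x = 1 \<and> y = 1"
      if "x \<in> {-2, -1, 0, 1, 2}" "y \<in> {-2, -1, 0, 1, 2}" "x * x + x * y + y * y = 3"
        "2 * x + y > 0" "x + 2 * y > 0" for x y :: real
      using that by auto
    ultimately have "p = 1" "q = 1" using P Q by blast+
    then show ?thesis using 1 ab by simp
  next
    case 2
    then have ab: "2 * a = p" "2 * b = q" using p q by simp_all
    have "(2 * a) * p + (2 * b) * q = 4" using pq by simp
    then have "p * p + q * q = 4" unfolding ab .
    moreover have "p > 0" "q > 0" using ab pos by linarith+
    moreover have False
      if "x \<in> {-2, -1, 0, 1, 2}" "y \<in> {-2, -1, 0, 1, 2}" "x * x + y * y = 4" "x > 0" "y > 0"
      for x y :: real
      using that by auto
    ultimately show ?thesis using P Q by blast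
  next
    case 3
    then have ab: "3 * a = 2 * p - q" "3 * b = 2 * q - p" using p q by simp_all
    have "(3 * a) * p + (3 * b) * q = 6" using pq by simp
    then have "p * p - p * q + q * q = 3" unfolding ab by (simp add: algebra_simps)
    moreover have "2 * p > q" "2 * q > p" using ab pos by linarith+
    moreover have False
      if "x \<in> {-2, -1, 0, 1, 2}" "y \<in> {-2, -1, 0, 1, 2}" "x * x - x * y + y * y = 3"
        "2 * x > y" "2 * y > x" for x y :: real
      using that by auto
    ultimately show ?thesis using P Q by blast
  qed
qed

lemma root_interval_empty:
  assumes "\<alpha> \<in> D_roots" "\<beta> \<in> D_roots" "\<alpha> \<bullet> \<beta> = 0 \<or> \<alpha> \<bullet> \<beta> = 1"
  shows "root_interval D_roots \<alpha> \<beta> = {}"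
  using root_interval_coeffs[OF assms(1,2)] assms(3) unfolding root_interval_def by fastforce

lemma root_interval_subset:
  assumes "\<alpha> \<in> D_roots" "\<beta> \<in> D_roots" "\<alpha> \<bullet> \<beta> = -1"
  shows "root_interval D_roots \<alpha> \<beta> \<subseteq> {\<alpha> + \<beta>}"
  using root_interval_coeffs[OF assms(1,2)] assms(3) unfolding root_interval_def by fastforce

lemma D_roots_independent:
  assumes \<alpha>: "\<alpha> \<in> D_roots" and \<beta>: "\<beta> \<in> D_roots" and c: "\<alpha> \<bullet> \<beta> \<in> {-1, 0, 1}"
  shows "\<alpha> \<noteq> \<beta>" "independent {\<alpha>, \<beta>}"
proof -
  have n0: "\<beta> \<noteq> 0" using D_roots_inner_self[OF \<beta>] by auto
  show "\<alpha> \<noteq> \<beta>" using D_roots_inner_self[OF \<alpha>] c by auto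
  have "\<alpha> \<notin> span {\<beta>}"
  proof
    assume "\<alpha> \<in> span {\<beta>}"
    then obtain k where k: "\<alpha> = k *\<^sub>R \<beta>" by (auto simp: span_singleton)
    then have "\<alpha> \<bullet> \<beta> = 2 * k" "k * (2 * k) = 2"
      using D_roots_inner_self[OF \<alpha>] D_roots_inner_self[OF \<beta>] by simp_all
    then have "(\<alpha> \<bullet> \<beta>) * (\<alpha> \<bullet> \<beta>) = 4" by simp
    then show False using c by auto
  qed
  then show "independent {\<alpha>, \<beta>}" using n0 by (simp add: independent_insert)
qed

text \<open>The cone over two roots at angle 60 degrees contains no further roots; \<open>2 \<gamma> - \<beta>\<close> is
  the functional that exposes the ray of \<open>\<beta>\<close>.\<close>

lemma acute_pair:
  assumes \<beta>: "\<beta> \<in> D_roots" and \<gamma>: "\<gamma> \<in> D_roots" and c: "\<beta> \<bullet> \<gamma> = 1"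
  shows "special_closed D_roots {\<beta>, \<gamma>}" "extreme_root {\<beta>, \<gamma>} \<beta>"
proof -
  define C where "C = {a *\<^sub>R \<beta> + b *\<^sub>R \<gamma> | a b. a \<ge> 0 \<and> b \<ge> 0}"
  have CI: "a *\<^sub>R \<beta> + b *\<^sub>R \<gamma> \<in> C" if "a \<ge> 0" "b \<ge> 0" for a b
    using that unfolding C_def by blast
  have c': "\<gamma> \<bullet> \<beta> = 1" using c by (simp add: inner_commute)
  have self: "\<beta> \<bullet> \<beta> = 2" "\<gamma> \<bullet> \<gamma> = 2"
    using D_roots_inner_self \<beta> \<gamma> by auto
  have cone: "convex_cone C"
    unfolding convex_cone_iff
  proof (intro conjI ballI allI impI)
    show "0 \<in> C" using CI[of 0 0] by simp
  next
    fix x y assume "x \<in> C" "y \<in> C"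
    then obtain a b a' b' where "x = a *\<^sub>R \<beta> + b *\<^sub>R \<gamma>" "y = a' *\<^sub>R \<beta> + b' *\<^sub>R \<gamma>"
      "a \<ge> 0" "b \<ge> 0" "a' \<ge> 0" "b' \<ge> 0" unfolding C_def by blast
    then show "x + y \<in> C" using CI[of "a + a'" "b + b'"] by (simp add: algebra_simps)
  next
    fix x and k :: real assume "x \<in> C" "k \<ge> 0"
    moreover from this obtain a b where "x = a *\<^sub>R \<beta> + b *\<^sub>R \<gamma>" "a \<ge> 0" "b \<ge> 0"
      unfolding C_def by blast
    ultimately show "k *\<^sub>R x \<in> C" using CI[of "k * a" "k * b"] by (simp add: algebra_simps)
  qed
  have \<beta>C: "\<beta> \<in> C" and \<gamma>C: "\<gamma> \<in> C" using CI[of 1 0] CI[of 0 1] by simp_all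
  have "x = 0" if xC: "x \<in> C" "- x \<in> C" for x
  proof -
    \<comment> \<open>The functional given by \<open>\<beta> + \<gamma>\<close> takes the value 3 on
      both roots, hence is positive on the cone outside \<open>0\<close>.\<close>
    have *: "y \<bullet> (\<beta> + \<gamma>) \<ge> 0" if "y \<in> C" for y
      using that self c c' by (auto simp: C_def inner_add_left inner_add_right)
    obtain a b where x: "x = a *\<^sub>R \<beta> + b *\<^sub>R \<gamma>" "a \<ge> 0" "b \<ge> 0" using xC(1) unfolding C_def by blast
    have "x \<bullet> (\<beta> + \<gamma>) = 3 * a + 3 * b" using x self c c' by (simp add: inner_add_left inner_add_right)
    moreover have "x \<bullet> (\<beta> + \<gamma>) \<le> 0" using *[OF xC(2)] by simp
    ultimately have "a = 0" "b = 0" using x(2,3) by linarith+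
    then show ?thesis using x by simp
  qed
  moreover have "D_roots \<inter> C = {\<beta>, \<gamma>}"
  proof (intro equalityI subsetI)
    fix x assume "x \<in> D_roots \<inter> C"
    then obtain a b where x: "x \<in> D_roots" "x = a *\<^sub>R \<beta> + b *\<^sub>R \<gamma>" "a \<ge> 0" "b \<ge> 0"
      unfolding C_def by blast
    have xx: "x \<bullet> x = 2" using D_roots_inner_self x by blast
    consider "a > 0" "b > 0" | "a = 0" | "b = 0" using x by linarith
    then show "x \<in> {\<beta>, \<gamma>}"
    proof cases
      case 1
      then show ?thesis using root_interval_coeffs[OF \<beta> \<gamma> _ 1] x c by simp
    next
      case 2
      then have "b * b = 1" using xx x self by simp
      then have "b = 1" using x(4) by (simp add: square_eq_1_iff)
      then show ?thesis using 2 x by simp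
    next
      case 3
      then have "a * a = 1" using xx x self by simp
      then have "a = 1" using x(3) by (simp add: square_eq_1_iff)
      then show ?thesis using 3 x by simp
    qed
  qed (use \<beta> \<gamma> \<beta>C \<gamma>C in auto)
  ultimately show "special_closed D_roots {\<beta>, \<gamma>}" unfolding special_closed_def using cone by metis
  let ?S = "convex_cone hull {\<beta>, \<gamma>}"
  define R where "R = {t *\<^sub>R \<beta> | t. t \<ge> (0::real)}"
  have SC: "?S \<subseteq> C" using \<beta>C \<gamma>C cone by (intro hull_minimal) auto
  have \<beta>S: "\<beta> \<in> ?S" by (simp add: hull_inc)
  have RS: "R \<subseteq> ?S"
    using convex_cone_scaleR[OF convex_cone_convex_cone_hull _ \<beta>S] unfolding R_def by auto
  have convR: "convex R"
  proof (rule convexI)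
    fix x y and u v :: real assume "x \<in> R" "y \<in> R" "0 \<le> u" "0 \<le> v" "u + v = 1"
    moreover from this obtain s t where "x = s *\<^sub>R \<beta>" "y = t *\<^sub>R \<beta>" "s \<ge> 0" "t \<ge> 0"
      unfolding R_def by blast
    moreover have "u *\<^sub>R s *\<^sub>R \<beta> + v *\<^sub>R t *\<^sub>R \<beta> = (u * s + v * t) *\<^sub>R \<beta>" by (simp add: algebra_simps)
    ultimately show "u *\<^sub>R x + v *\<^sub>R y \<in> R" unfolding R_def by auto
  qed
  define f where "f x = (2 *\<^sub>R \<gamma> - \<beta>) \<bullet> x" for x
  have f: "f (a *\<^sub>R \<beta> + b *\<^sub>R \<gamma>) = 3 * b" for a b
    using self c c' by (simp add: f_def inner_diff_left inner_add_right)
  have f_nonneg: "f x \<ge> 0" if "x \<in> C" for x using that f unfolding C_def by auto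
  have f_zero: "x \<in> R" if x: "x \<in> C" "f x = 0" for x
  proof -
    obtain a b where "x = a *\<^sub>R \<beta> + b *\<^sub>R \<gamma>" "a \<ge> 0" "b \<ge> 0" using x(1) unfolding C_def by blast
    then show ?thesis using f x(2) unfolding R_def by auto
  qed
  have "x \<in> R \<and> y \<in> R"
    if xy: "x \<in> ?S" "y \<in> ?S" and z: "z \<in> R" "z \<in> open_segment x y" for x y z
  proof -
    obtain t where t: "z = t *\<^sub>R \<beta>" using z(1) unfolding R_def by blast
    have fz: "f z = 0" using f[of t 0] t by simp
    obtain u where u: "0 < u" "u < 1" "z = (1 - u) *\<^sub>R x + u *\<^sub>R y" using z(2) by (auto simp: in_segment)
    have x: "f x \<ge> 0" and y: "f y \<ge> 0" using f_nonneg xy SC by auto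
    have "f z = (1 - u) * f x + u * f y" using u by (simp add: f_def inner_add_right)
    moreover have "(1 - u) * f x \<ge> 0" "u * f y \<ge> 0" using x y u by simp_all
    ultimately have "(1 - u) * f x = 0" "u * f y = 0" using fz by linarith+
    then have "f x = 0" "f y = 0" using u by simp_all
    then show ?thesis using f_zero xy SC by blast
  qed
  then have "R face_of ?S" unfolding face_of_def using RS convR by blast
  moreover have "\<beta> \<noteq> 0" using self by auto
  moreover have "\<beta> \<in> R" unfolding R_def by (auto intro: exI[of _ 1])
  ultimately show "extreme_root {\<beta>, \<gamma>} \<beta>"
    unfolding extreme_root_def extreme_ray_of_def R_def by blast
qed

section \<open>Commutator identities\<close>

context group
begin

abbreviation comm :: "'a \<Rightarrow> 'a \<Rightarrow> 'a" where "comm \<equiv> group_commutator G"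

lemma mult_inv_cancel [simp]: "x \<in> carrier G \<Longrightarrow> y \<in> carrier G \<Longrightarrow> x \<otimes> (inv x \<otimes> y) = y"
  "x \<in> carrier G \<Longrightarrow> y \<in> carrier G \<Longrightarrow> inv x \<otimes> (x \<otimes> y) = y"
  by (simp_all flip: m_assoc)

lemma comm_closed [simp]: "x \<in> carrier G \<Longrightarrow> y \<in> carrier G \<Longrightarrow> comm x y \<in> carrier G"
  by (simp add: group_commutator_def)

lemma conj_eq_comm: "x \<in> carrier G \<Longrightarrow> y \<in> carrier G \<Longrightarrow> x \<otimes> y \<otimes> inv x = comm x y \<otimes> y"
  by (simp add: group_commutator_def m_assoc)

lemma inv_comm: "x \<in> carrier G \<Longrightarrow> y \<in> carrier G \<Longrightarrow> inv (comm x y) = comm y x"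
  by (simp add: group_commutator_def m_assoc inv_mult_group)

lemma comm_eq_one_iff: "x \<in> carrier G \<Longrightarrow> y \<in> carrier G \<Longrightarrow> comm x y = \<one> \<longleftrightarrow> x \<otimes> y = y \<otimes> x"
  using inv_solve_right'[of \<one> "x \<otimes> y" "y \<otimes> x"] by (auto simp: group_commutator_def m_assoc inv_mult_group)

lemma conj_commuting: "x \<in> carrier G \<Longrightarrow> y \<in> carrier G \<Longrightarrow> x \<otimes> y = y \<otimes> x \<Longrightarrow> x \<otimes> y \<otimes> inv x = y"
  by (simp add: m_assoc)

lemma comm_mult_right:
  "x \<in> carrier G \<Longrightarrow> y \<in> carrier G \<Longrightarrow> y' \<in> carrier G \<Longrightarrow>
    comm x (y \<otimes> y') = comm x y \<otimes> (y \<otimes> comm x y' \<otimes> inv y)"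
  by (simp add: group_commutator_def m_assoc inv_mult_group)

text \<open>Write \<open>g\<close> for \<open>[x, y]\<close> and \<open>c\<close> for
  \<open>[z, y]\<close>. Conjugation by \<open>x\<close> fixes \<open>z\<close> and sends
  \<open>y\<close> to \<open>g y\<close>, hence sends \<open>c\<close> to
  \<open>z g z^-1 c g^-1\<close>. As \<open>c\<close> commutes with \<open>g\<close>, what remains
  of \<open>[x, c]\<close> is \<open>z g z^-1 g^-1\<close>.\<close>

lemma comm_swap:
  assumes G: "x \<in> carrier G" "y \<in> carrier G" "z \<in> carrier G"
    and xz: "x \<otimes> z = z \<otimes> x" and gc: "comm x y \<otimes> comm z y = comm z y \<otimes> comm x y"
  shows "comm x (comm z y) = comm z (comm x y)"
proof -
  define g c where "g = comm x y" and "c = comm z y"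
  have gG: "g \<in> carrier G" and cG: "c \<in> carrier G" using G by (simp_all add: g_def c_def)
  have z: "x \<otimes> z \<otimes> inv x = z" using conj_commuting xz G by simp
  then have z': "x \<otimes> inv z \<otimes> inv x = inv z"
    using inv_mult_group[of "x \<otimes> z" "inv x"] inv_mult_group[of x z] G by (simp add: m_assoc)
  have y: "x \<otimes> y \<otimes> inv x = g \<otimes> y" using conj_eq_comm G by (simp add: g_def)
  have y': "x \<otimes> inv y \<otimes> inv x = inv y \<otimes> inv g"
  proof -
    have "x \<otimes> inv y \<otimes> inv x = inv (x \<otimes> y \<otimes> inv x)" using G by (simp add: inv_mult_group m_assoc)
    then show ?thesis using y G gG by (simp add: inv_mult_group)
  qed
  have "x \<otimes> c \<otimes> inv x = (x \<otimes> z \<otimes> inv x) \<otimes> (x \<otimes> y \<otimes> inv x) \<otimes> (x \<otimes> inv z \<otimes> inv x) \<otimes> (x \<otimes> inv y \<otimes> inv x)"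
    using G by (simp add: c_def group_commutator_def m_assoc)
  also have "\<dots> = z \<otimes> (g \<otimes> y) \<otimes> inv z \<otimes> (inv y \<otimes> inv g)" unfolding z z' y y' ..
  also have "\<dots> = z \<otimes> g \<otimes> inv z \<otimes> (c \<otimes> inv g)"
    using G gG by (simp add: c_def group_commutator_def m_assoc)
  also have "c \<otimes> inv g = inv g \<otimes> c"
  proof -
    have "inv g \<otimes> (g \<otimes> c) \<otimes> inv g = inv g \<otimes> (c \<otimes> g) \<otimes> inv g" using gc by (simp add: g_def c_def)
    then show ?thesis using gG cG by (simp add: m_assoc)
  qed
  finally have "comm x c = z \<otimes> g \<otimes> inv z \<otimes> (inv g \<otimes> c) \<otimes> inv c"
    by (simp add: group_commutator_def)
  then have "comm x c = comm z g" using G gG cG by (simp add: group_commutator_def[of G z g] m_assoc)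
  then show ?thesis by (simp only: g_def c_def)
qed

end

section \<open>Root subgroups of a graded group\<close>

locale D_graded = group G for G (structure) +
  fixes X :: "real ^ 'n::finite \<Rightarrow> 'a set"
  assumes rank: "4 \<le> CARD('n)"
    and rels: "commutator_relations G D_roots X"
    and weyl: "\<And>\<alpha>. \<alpha> \<in> D_roots \<Longrightarrow> \<exists>n. weyl_element G D_roots X \<alpha> n"
begin

lemma X_subgroup: "\<alpha> \<in> D_roots \<Longrightarrow> subgroup (X \<alpha>) G"
  using rels by (simp add: commutator_relations_def)

lemma X_carrier: "\<alpha> \<in> D_roots \<Longrightarrow> x \<in> X \<alpha> \<Longrightarrow> x \<in> carrier G"
  using subgroup.mem_carrier[OF X_subgroup] .

lemmas X_m_closed = subgroup.m_closed[OF X_subgroup]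
  and X_inv_closed = subgroup.m_inv_closed[OF X_subgroup]
  and X_one_closed = subgroup.one_closed[OF X_subgroup]

lemma comm_in_generate:
  assumes "\<alpha> \<in> D_roots" "\<beta> \<in> D_roots" "\<alpha> \<bullet> \<beta> \<in> {-1, 0, 1}" "x \<in> X \<alpha>" "y \<in> X \<beta>"
  shows "comm x y \<in> generate G (\<Union>\<gamma>\<in>root_interval D_roots \<alpha> \<beta>. X \<gamma>)"
proof -
  have "comm x y \<in> mutual_commutator G (X \<alpha>) (X \<beta>)"
    unfolding mutual_commutator_def using assms(4,5) by (blast intro: generate.incl)
  moreover have "mutual_commutator G (X \<alpha>) (X \<beta>) \<subseteq> generate G (\<Union>\<gamma>\<in>root_interval D_roots \<alpha> \<beta>. X \<gamma>)"
    using rels D_roots_independent[OF assms(1-3)] assms(1,2) unfolding commutator_relations_def by blast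
  ultimately show ?thesis by blast
qed

lemma X_commute:
  assumes "\<alpha> \<in> D_roots" "\<beta> \<in> D_roots" "\<alpha> \<bullet> \<beta> = 0 \<or> \<alpha> \<bullet> \<beta> = 1" "x \<in> X \<alpha>" "y \<in> X \<beta>"
  shows "x \<otimes> y = y \<otimes> x"
proof -
  have "comm x y \<in> generate G {}"
    using comm_in_generate[OF assms(1,2) _ assms(4,5)] root_interval_empty[OF assms(1-3)] assms(3)
    by auto
  then show ?thesis
    using comm_eq_one_iff X_carrier assms by (simp add: generate_empty)
qed

lemma comm_X:
  assumes "\<alpha> \<in> D_roots" "\<beta> \<in> D_roots" "\<alpha> + \<beta> \<in> D_roots" "\<alpha> \<bullet> \<beta> = -1" "x \<in> X \<alpha>" "y \<in> X \<beta>"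
  shows "comm x y \<in> X (\<alpha> + \<beta>)"
proof -
  have "generate G (\<Union>\<gamma>\<in>root_interval D_roots \<alpha> \<beta>. X \<gamma>) \<subseteq> X (\<alpha> + \<beta>)"
    using root_interval_subset[OF assms(1,2,4)]
    by (intro generate_subgroup_incl X_subgroup assms(3)) auto
  then show ?thesis using comm_in_generate[OF assms(1,2) _ assms(5,6)] assms(4) by auto
qed

text \<open>Needed to remove the error term in \<open>weyl_unit\<close>.\<close>

lemma X_Int:
  assumes "\<beta> \<in> D_roots" "\<gamma> \<in> D_roots" "\<beta> \<bullet> \<gamma> = 1" "x \<in> X \<beta>" "x \<in> X \<gamma>"
  shows "x = \<one>"
proof -
  have "X \<beta> \<inter> generate G (\<Union>\<gamma>\<in>{\<beta>, \<gamma>} - {\<beta>}. X \<gamma>) = {\<one>}"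
    using rels acute_pair[OF assms(1-3)] unfolding commutator_relations_def by blast
  moreover have "\<gamma> \<in> {\<beta>, \<gamma>} - {\<beta>}" using D_roots_independent(1)[OF assms(1,2)] assms(3) by auto
  then have "x \<in> generate G (\<Union>\<gamma>\<in>{\<beta>, \<gamma>} - {\<beta>}. X \<gamma>)" using assms(5) by (blast intro: generate.incl)
  ultimately show ?thesis using assms(4) by blast
qed

text \<open>For a Weyl element \<open>n = a b a'\<close> and \<open>\<beta>\<close> at angle 120 degrees to \<open>\<alpha>\<close>, conjugation by \<open>n\<close> agrees on
  \<open>X \<beta>\<close> with the commutator by \<open>a'\<close>: the two differ by an element of \<open>X \<beta> \<inter> X (\<alpha> + \<beta>)\<close>.\<close>

lemma weyl_unit:
  assumes \<alpha>: "\<alpha> \<in> D_roots"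
  shows "\<exists>u\<in>X \<alpha>. \<forall>\<beta>\<in>D_roots. \<alpha> \<bullet> \<beta> = -1 \<longrightarrow> \<alpha> + \<beta> \<in> D_roots \<longrightarrow> bij_betw (comm u) (X \<beta>) (X (\<alpha> + \<beta>))"
proof -
  obtain n where n: "weyl_element G D_roots X \<alpha> n" using weyl[OF \<alpha>] by blast
  then obtain a b u where abu: "a \<in> X \<alpha>" "b \<in> X (- \<alpha>)" "u \<in> X \<alpha>" "n = a \<otimes> b \<otimes> u"
    unfolding weyl_element_def set_mult_def by blast
  have m\<alpha>: "- \<alpha> \<in> D_roots" using D_roots_uminus[OF \<alpha>] .
  have aG: "a \<in> carrier G" and bG: "b \<in> carrier G" and uG: "u \<in> carrier G"
    using abu X_carrier \<alpha> m\<alpha> by auto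
  have nG: "n \<in> carrier G" using abu aG bG uG by simp
  have "bij_betw (comm u) (X \<beta>) (X (\<alpha> + \<beta>))"
    if \<beta>: "\<beta> \<in> D_roots" and c: "\<alpha> \<bullet> \<beta> = -1" and s: "\<alpha> + \<beta> \<in> D_roots" for \<beta>
  proof -
    have refl: "root_reflection \<alpha> \<beta> = \<alpha> + \<beta>"
      using c D_roots_inner_self[OF \<alpha>] by (simp add: root_reflection_def inner_commute[of \<beta> \<alpha>])
    have img: "(\<lambda>g. n \<otimes> g \<otimes> inv n) ` X \<beta> = X (\<alpha> + \<beta>)"
      using n \<beta> refl unfolding weyl_element_def by auto
    have ips: "- \<alpha> \<bullet> \<beta> = 1" "\<alpha> \<bullet> (\<alpha> + \<beta>) = 1" "(\<alpha> + \<beta>) \<bullet> \<beta> = 1" "- \<alpha> \<bullet> (\<alpha> + \<beta>) = -1" "\<beta> \<bullet> (\<alpha> + \<beta>) = 1"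
      using c D_roots_inner_self[OF \<alpha>] D_roots_inner_self[OF \<beta>]
      by (simp_all add: inner_add_left inner_add_right inner_commute[of \<beta> \<alpha>])
    have eq: "n \<otimes> x \<otimes> inv n = comm u x" if x: "x \<in> X \<beta>" for x
    proof -
      have xG: "x \<in> carrier G" using X_carrier[OF \<beta> x] .
      define z where "z = comm u x"
      have z: "z \<in> X (\<alpha> + \<beta>)" unfolding z_def using comm_X[OF \<alpha> \<beta> s c abu(3) x] .
      have zG: "z \<in> carrier G" using X_carrier[OF s z] .
      have bz: "comm b z \<in> X \<beta>"
        using comm_X[OF m\<alpha> s _ ips(4) abu(2) z] \<beta> by simp
      have bzG: "comm b z \<in> carrier G" using bG zG by simp
      \<comment> \<open>Conjugating by \<open>u\<close>, \<open>b\<close>, \<open>a\<close> in turn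
        splits the result into factors in \<open>X (\<alpha> + \<beta>)\<close> and one factor in
        \<open>X \<beta>\<close>, which is \<open>y\<close>.\<close>
      define y where "y = comm b z \<otimes> x"
      have y: "y \<in> X \<beta>" unfolding y_def using X_m_closed[OF \<beta> bz x] .
      have yG: "y \<in> carrier G" using X_carrier[OF \<beta> y] .
      have ay: "comm a y \<in> X (\<alpha> + \<beta>)" using comm_X[OF \<alpha> \<beta> s c abu(1) y] .
      have ayG: "comm a y \<in> carrier G" using X_carrier[OF s ay] .
      have conj: "g \<otimes> (p \<otimes> q) \<otimes> inv g = (g \<otimes> p \<otimes> inv g) \<otimes> (g \<otimes> q \<otimes> inv g)"
        if "g \<in> carrier G" "p \<in> carrier G" "q \<in> carrier G" for g p q
        using that by (simp add: m_assoc)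
      have 1: "u \<otimes> x \<otimes> inv u = z \<otimes> x" using conj_eq_comm[OF uG xG] by (simp add: z_def)
      have "b \<otimes> (z \<otimes> x) \<otimes> inv b = (comm b z \<otimes> z) \<otimes> x"
        using conj[OF bG zG xG] conj_eq_comm[OF bG zG]
          conj_commuting[OF bG xG X_commute[OF m\<alpha> \<beta> _ abu(2) x]] ips(1) by simp
      also have "comm b z \<otimes> z = z \<otimes> comm b z"
        using X_commute[OF \<beta> s _ bz z] ips(5) by simp
      finally have 2: "b \<otimes> (z \<otimes> x) \<otimes> inv b = z \<otimes> y" using zG bzG xG by (simp add: y_def m_assoc)
      have 3: "a \<otimes> (z \<otimes> y) \<otimes> inv a = z \<otimes> (comm a y \<otimes> y)"
        using conj[OF aG zG yG] conj_eq_comm[OF aG yG]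
          conj_commuting[OF aG zG X_commute[OF \<alpha> s _ abu(1) z]] ips(2) by simp
      have "n \<otimes> x \<otimes> inv n = a \<otimes> (b \<otimes> (u \<otimes> x \<otimes> inv u) \<otimes> inv b) \<otimes> inv a"
        using aG bG uG xG by (simp add: abu(4) m_assoc inv_mult_group)
      then have nx: "n \<otimes> x \<otimes> inv n = z \<otimes> (comm a y \<otimes> y)" unfolding 1 2 3 .
      \<comment> \<open>All other factors of this conjugate lie in
        \<open>X (\<alpha> + \<beta>)\<close>, and so does the conjugate itself by the reflection
        property; therefore \<open>y\<close> lies there too. Once \<open>y\<close> is trivial, the
        commutator with \<open>a\<close> disappears as well.\<close>
      have "n \<otimes> x \<otimes> inv n \<in> X (\<alpha> + \<beta>)" using img x by blast
      then have "inv (z \<otimes> comm a y) \<otimes> (n \<otimes> x \<otimes> inv n) \<in> X (\<alpha> + \<beta>)"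
        using X_m_closed[OF s X_inv_closed[OF s X_m_closed[OF s z ay]]] by blast
      moreover have "inv (z \<otimes> comm a y) \<otimes> (n \<otimes> x \<otimes> inv n) = y"
        unfolding nx using zG ayG yG by (simp add: inv_mult_group m_assoc)
      ultimately have "y = \<one>" using X_Int[OF \<beta> s ips(5) y] by simp
      moreover from this have "comm a y = \<one>" using aG by (simp add: group_commutator_def)
      ultimately show ?thesis using nx zG by (simp add: z_def)
    qed
    have "inj_on (\<lambda>g. n \<otimes> g \<otimes> inv n) (X \<beta>)"
      using nG X_carrier[OF \<beta>] by (auto simp: inj_on_def)
    then have "bij_betw (\<lambda>g. n \<otimes> g \<otimes> inv n) (X \<beta>) (X (\<alpha> + \<beta>))" using img by (simp add: bij_betw_def)
    then show ?thesis using eq by (subst bij_betw_cong[where g = "\<lambda>g. n \<otimes> g \<otimes> inv n"]) auto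
  qed
  then show ?thesis using abu(3) by blast
qed

section \<open>Bilinearity and the swap identity for root subgroups\<close>

lemma comm_mult_right_X:
  assumes "\<alpha> \<in> D_roots" "\<beta> \<in> D_roots" "\<alpha> + \<beta> \<in> D_roots" "\<alpha> \<bullet> \<beta> = -1"
    and x: "x \<in> X \<alpha>" and y: "y \<in> X \<beta>" "y' \<in> X \<beta>"
  shows "comm x (y \<otimes> y') = comm x y \<otimes> comm x y'"
proof -
  have "\<beta> \<bullet> (\<alpha> + \<beta>) = 1"
    using assms(4) D_roots_inner_self[OF assms(2)] by (simp add: inner_add_right inner_commute[of \<beta> \<alpha>])
  then have "y \<otimes> comm x y' = comm x y' \<otimes> y"
    using X_commute[OF assms(2,3) _ y(1) comm_X[OF assms(1-4) x y(2)]] by simp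
  then show ?thesis
    using comm_mult_right conj_commuting X_carrier assms by simp
qed

lemma comm_inv_right_X:
  assumes "\<alpha> \<in> D_roots" "\<beta> \<in> D_roots" "\<alpha> + \<beta> \<in> D_roots" "\<alpha> \<bullet> \<beta> = -1"
    and x: "x \<in> X \<alpha>" and y: "y \<in> X \<beta>"
  shows "comm x (inv y) = inv (comm x y)"
proof -
  have G: "x \<in> carrier G" "y \<in> carrier G" using X_carrier assms by auto
  have "comm x y \<otimes> comm x (inv y) = comm x \<one>"
    using comm_mult_right_X[OF assms X_inv_closed[OF assms(2) y]] G by simp
  also have "\<dots> = \<one>" using G by (simp add: group_commutator_def)
  finally have "inv (comm x (inv y)) = comm x y" using G by (intro inv_equality) auto
  then have "inv (inv (comm x (inv y))) = inv (comm x y)" by simp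
  then show ?thesis using G by simp
qed

lemma root_inners:
  "apart i j \<Longrightarrow> apart j k \<Longrightarrow> apart i k \<Longrightarrow> droot i j \<bullet> droot j k = -1"
  "apart i j \<Longrightarrow> apart j k \<Longrightarrow> apart i k \<Longrightarrow> droot i k \<bullet> droot j k = 1"
  "apart i j \<Longrightarrow> apart j k \<Longrightarrow> apart i k \<Longrightarrow> droot i j \<bullet> droot i k = 1"
  "apart i k \<Longrightarrow> apart i l \<Longrightarrow> apart j k \<Longrightarrow> apart j l \<Longrightarrow> droot i j \<bullet> droot k l = 0"
  "apart j k \<Longrightarrow> droot j k \<bullet> droot k (- j) = 0"
  by (simp_all add: inner_diff_left inner_diff_right inner_add_left inner_add_right
      basis_vec_inner_apart apart_commute)

text \<open>Write \<open>x\<close> as a commutator of elements of the root subgroups for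
  \<open>i, k\<close> and \<open>k, j\<close>. Both roots are at angle 60 degrees to the given one,
  so both elements commute with \<open>y\<close>.\<close>

lemma X_abelian:
  assumes ij: "apart i j" and x: "x \<in> X (droot i j)" and y: "y \<in> X (droot i j)"
  shows "x \<otimes> y = y \<otimes> x"
proof -
  obtain k where k: "apart k i" "apart k j" using apart_exists[OF rank] by blast
  have ap: "apart i k" "apart k j" using k by (simp_all add: apart_commute)
  note D = root_in_D_roots[OF ap(1)] root_in_D_roots[OF ap(2)] root_in_D_roots[OF ij]
  obtain u where u: "u \<in> X (droot i k)"
    and bij: "\<And>\<beta>. \<beta> \<in> D_roots \<Longrightarrow> droot i k \<bullet> \<beta> = -1 \<Longrightarrow> droot i k + \<beta> \<in> D_roots \<Longrightarrow>
      bij_betw (comm u) (X \<beta>) (X (droot i k + \<beta>))"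
    using weyl_unit[OF D(1)] by blast
  have "bij_betw (comm u) (X (droot k j)) (X (droot i j))"
    using bij[OF D(2) root_inners(1)[OF ap(1,2) ij]] D(3) by simp
  then obtain v where v: "v \<in> X (droot k j)" "x = comm u v" using x by (auto simp: bij_betw_def)
  have uy: "u \<otimes> y = y \<otimes> u"
    using X_commute[OF D(1,3) _ u y] root_inners(3)[OF ap(1,2) ij] by (simp add: inner_commute)
  have vy: "v \<otimes> y = y \<otimes> v"
    using X_commute[OF D(3,2) _ y v(1)] root_inners(2)[OF ap(1,2) ij] by simp
  have G: "u \<in> carrier G" "v \<in> carrier G" "y \<in> carrier G" "x \<in> carrier G"
    using X_carrier D u v y x by auto
  have mult: "p \<otimes> q \<otimes> y = y \<otimes> (p \<otimes> q)"
    if "p \<in> carrier G" "q \<in> carrier G" "p \<otimes> y = y \<otimes> p" "q \<otimes> y = y \<otimes> q" for p q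
  proof -
    have "p \<otimes> q \<otimes> y = p \<otimes> (y \<otimes> q)" using that G by (simp add: m_assoc)
    also have "\<dots> = y \<otimes> p \<otimes> q" using that G by (simp flip: m_assoc)
    finally show ?thesis using that G by (simp add: m_assoc)
  qed
  have inverse: "inv p \<otimes> y = y \<otimes> inv p" if "p \<in> carrier G" "p \<otimes> y = y \<otimes> p" for p
  proof -
    have "inv p \<otimes> y = inv p \<otimes> (y \<otimes> p) \<otimes> inv p" using that(1) G by (simp add: m_assoc)
    also have "\<dots> = inv p \<otimes> (p \<otimes> y) \<otimes> inv p" unfolding that(2) ..
    finally show ?thesis using that(1) G by (simp add: m_assoc)
  qed
  show ?thesis
    unfolding v(2) group_commutator_def
    by (intro mult inverse uy vy m_closed inv_closed G)
qed

lemma comm_mult_left_X: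
  assumes ap: "apart i j" "apart j k" "apart i k"
    and x: "x \<in> X (droot i j)" "x' \<in> X (droot i j)" and y: "y \<in> X (droot j k)"
  shows "comm (x \<otimes> x') y = comm x y \<otimes> comm x' y"
proof -
  note D = root_in_D_roots[OF ap(1)] root_in_D_roots[OF ap(2)] root_in_D_roots[OF ap(3)]
  have s: "droot j k + droot i j \<in> D_roots" and s': "droot i j + droot j k = droot i k" using D by simp_all
  have c: "droot j k \<bullet> droot i j = -1" using root_inners(1)[OF ap] by (simp add: inner_commute)
  have G: "x \<in> carrier G" "x' \<in> carrier G" "y \<in> carrier G" using X_carrier D x y by auto
  have cl: "comm x y \<in> X (droot i k)" "comm x' y \<in> X (droot i k)"
    using comm_X[OF D(1,2) _ root_inners(1)[OF ap] _ y] D(3) x unfolding s' by auto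
  have "comm (x \<otimes> x') y = inv (comm y (x \<otimes> x'))" using G inv_comm by simp
  also have "\<dots> = inv (comm y x \<otimes> comm y x')" using comm_mult_right_X[OF D(2,1) s c y x] by simp
  also have "\<dots> = comm x' y \<otimes> comm x y" using G inv_comm by (simp add: inv_mult_group)
  also have "\<dots> = comm x y \<otimes> comm x' y" using X_abelian[OF ap(3) cl] by simp
  finally show ?thesis .
qed

text \<open>The three roots form a chain of type A3 with \<open>\<beta>\<close> in the middle. Then
  \<open>\<alpha> + \<beta>\<close> and \<open>\<gamma> + \<beta>\<close> are orthogonal, which
  supplies the second commutation needed in \<open>comm_swap\<close>.\<close>

lemma comm_swap_X:
  assumes D: "\<alpha> \<in> D_roots" "\<beta> \<in> D_roots" "\<gamma> \<in> D_roots" "\<alpha> + \<beta> \<in> D_roots" "\<gamma> + \<beta> \<in> D_roots"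
    and c: "\<alpha> \<bullet> \<gamma> = 0" "\<alpha> \<bullet> \<beta> = -1" "\<gamma> \<bullet> \<beta> = -1"
    and x: "x \<in> X \<alpha>" and y: "y \<in> X \<beta>" and z: "z \<in> X \<gamma>"
  shows "comm x (comm z y) = comm z (comm x y)"
proof (rule comm_swap)
  show "x \<in> carrier G" "y \<in> carrier G" "z \<in> carrier G" using X_carrier D x y z by auto
  show "x \<otimes> z = z \<otimes> x" using X_commute[OF D(1,3) _ x z] c by simp
  have "(\<alpha> + \<beta>) \<bullet> (\<gamma> + \<beta>) = 0"
    using c D_roots_inner_self[OF D(2)] by (simp add: inner_add_left inner_add_right inner_commute[of \<beta> \<gamma>])
  then show "comm x y \<otimes> comm z y = comm z y \<otimes> comm x y"
    using X_commute[OF D(4,5) _ comm_X[OF D(1,2,4) c(2) x y] comm_X[OF D(3,2,5) c(3) z y]] by simp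
qed

section \<open>The root subgroups as a bracket system\<close>

abbreviation Y :: "'n signed_index \<Rightarrow> 'n signed_index \<Rightarrow> 'a set" where
  "Y i j \<equiv> X (droot i j)"

lemma comm_Y:
  assumes ap: "apart i j" "apart j k" "apart i k" and x: "x \<in> Y i j" and y: "y \<in> Y j k"
  shows "comm x y \<in> Y i k"
  using comm_X[OF root_in_D_roots[OF ap(1)] root_in_D_roots[OF ap(2)] _ root_inners(1)[OF ap] x y]
    root_in_D_roots[OF ap(3)] by simp

text \<open>Both \<open>br_assoc\<close> and \<open>br_swap\<close> are instances of
  \<open>comm_swap_X\<close>. The first has \<open>y\<close> in the middle of the chain of roots for
  \<open>i, j\<close>, then \<open>j, k\<close>, then \<open>k, l\<close>; the second has
  \<open>x\<close> in the middle, with the orthogonal roots for \<open>j, k\<close> and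
  \<open>k, - j\<close> at its ends.\<close>

sublocale bracket_system Y "\<lambda>x y. x \<otimes> y" "\<lambda>x. inv x" \<one> comm
proof
  show "4 \<le> CARD('n)" using rank .
next
  fix i j :: "'n signed_index" assume ij: "apart i j"
  note D = root_in_D_roots[OF ij]
  fix x y z assume x: "x \<in> Y i j"
  show "inv x \<in> Y i j" using X_inv_closed[OF D x] .
  show "\<one> \<otimes> x = x" "inv x \<otimes> x = \<one>" using X_carrier[OF D x] by simp_all
  assume y: "y \<in> Y i j"
  show "x \<otimes> y \<in> Y i j" using X_m_closed[OF D x y] .
  show "x \<otimes> y = y \<otimes> x" using X_abelian[OF ij x y] .
  assume z: "z \<in> Y i j"
  show "x \<otimes> y \<otimes> z = x \<otimes> (y \<otimes> z)" using X_carrier[OF D] x y z by (simp add: m_assoc)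
next
  fix i j :: "'n signed_index" assume ij: "apart i j"
  note D = root_in_D_roots[OF ij]
  show "\<one> \<in> Y i j" using X_one_closed[OF D] .
  show "Y (- j) (- i) = Y i j" by simp
  obtain u where u: "u \<in> Y i j"
    and bij: "\<And>\<beta>. \<beta> \<in> D_roots \<Longrightarrow> droot i j \<bullet> \<beta> = -1 \<Longrightarrow> droot i j + \<beta> \<in> D_roots \<Longrightarrow>
      bij_betw (comm u) (X \<beta>) (X (droot i j + \<beta>))"
    using weyl_unit[OF D] by blast
  have uG: "u \<in> carrier G" using X_carrier[OF D u] .
  show "\<exists>u\<in>Y i j. \<forall>k. apart k i \<longrightarrow> apart k j \<longrightarrow>
      bij_betw (\<lambda>x. comm u x) (Y j k) (Y i k) \<and> bij_betw (\<lambda>x. comm x u) (Y k i) (Y k j)"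
  proof (intro bexI[OF _ u] allI impI conjI)
    fix k assume k: "apart k i" "apart k j"
    have ap: "apart j k" "apart i k" using k by (simp_all add: apart_commute)
    show "bij_betw (\<lambda>x. comm u x) (Y j k) (Y i k)"
      using bij[OF root_in_D_roots[OF ap(1)] root_inners(1)[OF ij ap]] root_in_D_roots[OF ap(2)] by simp
    note Dk = root_in_D_roots[OF k(1)] root_in_D_roots[OF k(2)]
    \<comment> \<open>The same \<open>u\<close> acts from the right: \<open>comm x u\<close> is the
      inverse of \<open>comm u x\<close>, and the root for \<open>k, i\<close> is at angle 120
      degrees to the one for \<open>i, j\<close> as well.\<close>
    have "droot i j \<bullet> droot k i = -1"
      using root_inners(1)[OF k(1) ij k(2)] by (simp add: inner_commute)
    then have b1: "bij_betw (comm u) (Y k i) (Y k j)" using bij[OF Dk(1)] Dk(2) by simp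
    have "bij_betw (\<lambda>x. inv x) (Y k j) (Y k j)"
      using X_inv_closed[OF Dk(2)] X_carrier[OF Dk(2)]
      by (intro bij_betwI[where g = "\<lambda>x. inv x"]) auto
    from bij_betw_trans[OF b1 this] have "bij_betw ((\<lambda>x. inv x) \<circ> comm u) (Y k i) (Y k j)" .
    moreover have "((\<lambda>x. inv x) \<circ> comm u) x = comm x u" if "x \<in> Y k i" for x
      using inv_comm[OF uG X_carrier[OF Dk(1) that]] by simp
    ultimately show "bij_betw (\<lambda>x. comm x u) (Y k i) (Y k j)"
      by (subst bij_betw_cong[where g = "(\<lambda>x. inv x) \<circ> comm u"]) auto
  qed
next
  fix i j k :: "'n signed_index" assume ap: "apart i j" "apart j k" "apart i k"
  note D = root_in_D_roots[OF ap(1)] root_in_D_roots[OF ap(2)] root_in_D_roots[OF ap(3)]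
  have s: "droot i j + droot j k \<in> D_roots" using D by simp
  fix x y assume x: "x \<in> Y i j" and y: "y \<in> Y j k"
  show "comm x y \<in> Y i k" using comm_Y[OF ap x y] .
  show "comm y x = inv (comm x y)" using inv_comm X_carrier D x y by simp
  show "comm (x \<otimes> x') y = comm x y \<otimes> comm x' y" if "x' \<in> Y i j" for x'
    using comm_mult_left_X[OF ap x that y] .
  show "comm x (y \<otimes> y') = comm x y \<otimes> comm x y'" if "y' \<in> Y j k" for y'
    using comm_mult_right_X[OF D(1,2) s root_inners(1)[OF ap] x y that] .
next
  fix i j k l :: "'n signed_index"
  assume ap: "apart i j" "apart j k" "apart i k" "apart i l" "apart j l" "apart k l"
  fix x y z assume x: "x \<in> Y i j" and y: "y \<in> Y j k" and z: "z \<in> Y k l"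
  note D = root_in_D_roots[OF ap(1)] root_in_D_roots[OF ap(2)] root_in_D_roots[OF ap(3)]
    root_in_D_roots[OF ap(4)] root_in_D_roots[OF ap(5)] root_in_D_roots[OF ap(6)]
  have G: "x \<in> carrier G" "y \<in> carrier G" "z \<in> carrier G" using X_carrier D x y z by auto
  have zy: "comm z y = inv (comm y z)" using inv_comm G by simp
  have yz: "comm y z \<in> Y j l" using comm_Y[OF ap(2,6,5) y z] .
  have s: "droot i j + droot j l \<in> D_roots" "droot i j + droot j k \<in> D_roots" "droot k l + droot j k \<in> D_roots"
    using D by simp_all
  have "comm z (comm x y) = comm x (comm z y)"
    using comm_swap_X[OF D(1,2,6) s(2,3) _ root_inners(1)[OF ap(1-3)] _ x y z]
      root_inners(4)[OF ap(3,4,2,5)] root_inners(1)[OF ap(2,6,5)] by (simp add: inner_commute)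
  also have "\<dots> = inv (comm x (comm y z))"
    unfolding zy using comm_inv_right_X[OF D(1,5) s(1) root_inners(1)[OF ap(1,5,4)] x yz] .
  finally have "inv (comm z (comm x y)) = comm x (comm y z)" using G by simp
  then show "comm (comm x y) z = comm x (comm y z)" using inv_comm G by simp
next
  fix j k l :: "'n signed_index"
  assume ap: "apart j k" "apart j l" "apart k l"
  fix x y z assume y: "y \<in> Y j k" and z: "z \<in> Y k (- j)" and x: "x \<in> Y (- j) l"
  have ap': "apart k (- j)" "apart (- j) l" "apart (- k) (- j)" "apart (- k) l"
    using ap by (simp_all add: apart_commute)
  note D = root_in_D_roots[OF ap(1)] root_in_D_roots[OF ap'(1)] root_in_D_roots[OF ap'(2)]
  have s: "droot j k + droot (- j) l \<in> D_roots" "droot k (- j) + droot (- j) l \<in> D_roots"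
    using root_in_D_roots[OF ap'(4)] root_in_D_roots[OF ap(3)] by (simp_all add: add.commute)
  have c: "droot j k \<bullet> droot (- j) l = -1"
    using root_inners(1)[OF ap'(3,2,4)] by simp
  show "comm y (comm z x) = comm z (comm y x)"
    using comm_swap_X[OF D(1,3,2) s root_inners(5)[OF ap(1)] c root_inners(1)[OF ap'(1,2) ap(3)] y x z] .
qed

end

section \<open>Coordinatization\<close>

context D_graded
begin

text \<open>Disjointness makes each of the four terms of the inner product of the two roots
  nonnegative. The values 0 and 1 leave an empty root interval, and the value 2 means that the roots
  coincide.\<close>

lemma Y_commute:
  assumes ap: "apart i j" "apart k l" and disj: "{- i, j} \<inter> {k, - l} = {}"
    and x: "x \<in> Y i j" and y: "y \<in> Y k l"
  shows "comm x y = \<one>"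
proof -
  note D = root_in_D_roots[OF ap(1)] root_in_D_roots[OF ap(2)]
  have G: "x \<in> carrier G" "y \<in> carrier G" using X_carrier D x y by auto
  have pos: "basis_vec p \<bullet> basis_vec q \<ge> 0" if "p \<noteq> - q" for p q :: "'n signed_index"
    using that basis_vec_inner_apart[of p q] by (cases "apart p q") (auto simp: apart_def)
  have "j \<noteq> k" "j \<noteq> - l" "i \<noteq> - k" "i \<noteq> l"
    using disj by auto
  then have "basis_vec j \<bullet> basis_vec l \<ge> 0" "basis_vec j \<bullet> basis_vec k \<le> 0"
    "basis_vec i \<bullet> basis_vec l \<le> 0" "basis_vec i \<bullet> basis_vec k \<ge> 0"
    using pos[of j l] pos[of j "- k"] pos[of i "- l"] pos[of i k] by simp_all
  then have "droot i j \<bullet> droot k l \<ge> 0" by (simp add: inner_diff_left inner_diff_right)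
  then consider "droot i j \<bullet> droot k l = 0 \<or> droot i j \<bullet> droot k l = 1" | "droot i j \<bullet> droot k l = 2"
    using D_roots_inner_cases[OF D] by auto
  then have "x \<otimes> y = y \<otimes> x"
  proof cases
    case 1
    then show ?thesis using X_commute[OF D _ x y] by blast
  next
    case 2
    define \<alpha> \<beta> where "\<alpha> = droot i j" and "\<beta> = droot k l"
    have "\<alpha> \<bullet> \<alpha> = 2" "\<beta> \<bullet> \<beta> = 2" "\<alpha> \<bullet> \<beta> = 2"
      using 2 D_roots_inner_self[OF D(1)] D_roots_inner_self[OF D(2)] by (simp_all only: \<alpha>_def \<beta>_def)
    then have "(\<alpha> - \<beta>) \<bullet> (\<alpha> - \<beta>) = 0"
      by (simp add: inner_diff_left inner_diff_right inner_commute[of \<beta> \<alpha>])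
    then have "\<alpha> = \<beta>" by simp
    then show ?thesis using X_abelian[OF ap(1) x] y by (simp add: \<alpha>_def \<beta>_def)
  qed
  then show ?thesis using comm_eq_one_iff G by simp
qed

lemma coordinatizationI:
  fixes K :: "'k ring"
  assumes K: "cring K" and \<phi>: "sto_family G K \<phi>"
    and bij: "\<And>i j. apart i j \<Longrightarrow> bij_betw (\<phi> i j) (carrier K) (Y i j)"
  obtains Q where "coordinatization G X K Q"
    "\<And>i j x. apart i j \<Longrightarrow> x \<in> carrier K \<Longrightarrow> Q (sto_t K i j x) = \<phi> i j x"
proof -
  interpret K: cring K by fact
  obtain Q where Q: "Q \<in> hom (StO K) G"
    "\<And>i j x. apart i j \<Longrightarrow> x \<in> carrier K \<Longrightarrow> Q (sto_t K i j x) = \<phi> i j x"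
    using sto_family_hom[OF is_group K \<phi>] by blast
  have "(\<lambda>x. Q (sto_t K i j x)) \<in> iso (add_monoid K) (G\<lparr>carrier := Y i j\<rparr>)" if ij: "apart i j" for i j
  proof -
    have "bij_betw (\<lambda>x. Q (sto_t K i j x)) (carrier K) (Y i j)"
      using bij[OF ij] Q(2)[OF ij] by (subst bij_betw_cong[where g = "\<phi> i j"]) auto
    moreover from this have "Q (sto_t K i j x) \<in> Y i j" if "x \<in> carrier K" for x
      using that bij_betw_apply by fastforce
    ultimately show ?thesis
      using Q(2)[OF ij] sto_family.add[OF \<phi> ij] by (auto simp: iso_def hom_def)
  qed
  then have "coordinatization G X K Q"
    unfolding coordinatization_def using K Q(1) by (auto simp: apart_def)
  then show thesis using that Q(2) by blast
qed

lemma coordinatizationD: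
  fixes K :: "'k ring"
  assumes "coordinatization G X K Q"
  shows "cring K" "sto_family G K (\<lambda>i j x. Q (sto_t K i j x))"
    "apart i j \<Longrightarrow> bij_betw (\<lambda>x. Q (sto_t K i j x)) (carrier K) (Y i j)"
proof -
  show K: "cring K" using assms by (simp add: coordinatization_def)
  show "sto_family G K (\<lambda>i j x. Q (sto_t K i j x))"
    using assms sto_family_hom_image[OF is_group group_StO _ sto_family_sto_t[OF K]]
    unfolding coordinatization_def by blast
  show "bij_betw (\<lambda>x. Q (sto_t K i j x)) (carrier K) (Y i j)" if "apart i j"
    using assms that by (simp add: coordinatization_def iso_def apart_def)
qed

theorem coordinatization_exists: "\<exists>(K :: 'a ring) Q. coordinatization G X K Q"
proof -
  obtain K :: "'a ring" and \<phi> where K: "cring K"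
    and bij: "\<And>i j. apart i j \<Longrightarrow> bij_betw (\<phi> i j) (carrier K) (Y i j)"
    and add: "\<And>i j f g. apart i j \<Longrightarrow> f \<in> carrier K \<Longrightarrow> g \<in> carrier K \<Longrightarrow>
      \<phi> i j (f \<oplus>\<^bsub>K\<^esub> g) = \<phi> i j f \<otimes> \<phi> i j g"
    and flip: "\<And>i j f. apart i j \<Longrightarrow> f \<in> carrier K \<Longrightarrow> \<phi> (- j) (- i) f = inv (\<phi> i j f)"
    and mult: "\<And>i j k f g. apart i j \<Longrightarrow> apart j k \<Longrightarrow> apart i k \<Longrightarrow> f \<in> carrier K \<Longrightarrow> g \<in> carrier K \<Longrightarrow>
      comm (\<phi> i j f) (\<phi> j k g) = \<phi> i k (f \<otimes>\<^bsub>K\<^esub> g)"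
    using coordinates_exist by blast
  interpret K: cring K by fact
  have cl: "\<phi> i j x \<in> Y i j" if "apart i j" "x \<in> carrier K" for i j x
    using bij_betw_apply[OF bij[OF that(1)] that(2)] .
  have clG: "\<phi> i j x \<in> carrier G" if "apart i j" "x \<in> carrier K" for i j x
    using X_carrier[OF root_in_D_roots[OF that(1)] cl[OF that]] .
  have neg: "\<phi> i j (\<ominus>\<^bsub>K\<^esub> x) = inv (\<phi> i j x)" if "apart i j" "x \<in> carrier K" for i j x
  proof -
    have "\<phi> i j \<zero>\<^bsub>K\<^esub> \<otimes> \<phi> i j \<zero>\<^bsub>K\<^esub> = \<phi> i j \<zero>\<^bsub>K\<^esub>"
      using add[OF that(1) K.zero_closed K.zero_closed] by simp
    then have "\<phi> i j \<zero>\<^bsub>K\<^esub> = \<one>" using clG[OF that(1) K.zero_closed] by simp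
    then have "\<phi> i j (\<ominus>\<^bsub>K\<^esub> x) \<otimes> \<phi> i j x = \<one>"
      using add[OF that(1) K.a_inv_closed[OF that(2)] that(2)] that(2) by (simp add: K.l_neg)
    then show ?thesis using inv_equality clG that by simp
  qed
  have "sto_family G K \<phi>"
  proof
    fix i j :: "'n signed_index" and x assume ij: "apart i j" and x: "x \<in> carrier K"
    show "\<phi> i j x \<in> carrier G" using clG[OF ij x] .
    show "\<phi> i j x = \<phi> (- j) (- i) (\<ominus>\<^bsub>K\<^esub> x)"
      using flip[OF ij K.a_inv_closed[OF x]] neg[OF ij x] clG[OF ij x] by simp
    fix y assume y: "y \<in> carrier K"
    show "\<phi> i j (x \<oplus>\<^bsub>K\<^esub> y) = \<phi> i j x \<otimes> \<phi> i j y" using add[OF ij x y] .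
    have ap: "apart (- i) j" "apart j i" using ij by (simp_all add: apart_commute)
    \<comment> \<open>This orthogonal pair is not covered by \<open>Y_commute\<close>: both index
      sets contain \<open>j\<close>.\<close>
    have "droot (- i) j \<bullet> droot j i = 0"
      using ij by (simp add: inner_diff_left inner_diff_right inner_add_left basis_vec_inner_apart apart_commute)
    then have "\<phi> (- i) j x \<otimes> \<phi> j i y = \<phi> j i y \<otimes> \<phi> (- i) j x"
      using X_commute[OF root_in_D_roots[OF ap(1)] root_in_D_roots[OF ap(2)] _ cl[OF ap(1) x] cl[OF ap(2) y]]
      by blast
    then show "comm (\<phi> (- i) j x) (\<phi> j i y) = \<one>"
      using comm_eq_one_iff[OF clG[OF ap(1) x] clG[OF ap(2) y]] by simp
  next
    fix i j k l :: "'n signed_index" and x y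
    assume "apart i j" "apart k l" "{- i, j} \<inter> {k, - l} = {}" "x \<in> carrier K" "y \<in> carrier K"
    then show "comm (\<phi> i j x) (\<phi> k l y) = \<one>"
      using Y_commute[of i j k l "\<phi> i j x" "\<phi> k l y"] cl by simp
  qed (use mult in simp)
  from coordinatizationI[OF K this bij] show ?thesis by metis
qed

section \<open>Changes of coordinates in a graded group\<close>

lemma coordinatization_pair:
  fixes K :: "'k ring" and L :: "'l ring"
  assumes "coordinatization G X K Q" "coordinatization G X L Q'"
  shows "coordinate_pair K L (\<lambda>i j x. Q (sto_t K i j x)) (\<lambda>i j x. Q' (sto_t L i j x)) Y G"
  using coordinatizationD[OF assms(1)] coordinatizationD[OF assms(2)] rank
  by (simp add: coordinate_pair_def coordinate_pair_axioms_def)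

lemma coordinate_change_exists:
  fixes K :: "'k ring" and L :: "'l ring"
  assumes "coordinatization G X K Q" "coordinatization G X L Q'"
  shows "\<exists>F a. coordinate_change L K F a \<and> changes_into L K F a Q Q'"
proof -
  interpret coordinate_pair K L "\<lambda>i j x. Q (sto_t K i j x)" "\<lambda>i j x. Q' (sto_t L i j x)" Y G
    by (rule coordinatization_pair[OF assms])
  obtain F a where "F \<in> ring_iso L K" "\<And>i. a i \<in> Units K"
    "\<And>i j. a i \<otimes>\<^bsub>K\<^esub> a (- i) = a j \<otimes>\<^bsub>K\<^esub> a (- j)"
    "\<And>i j x. apart i j \<Longrightarrow> x \<in> carrier L \<Longrightarrow>
      Q' (sto_t L i j x) = Q (sto_t K i j (F x \<otimes>\<^bsub>K\<^esub> (a i \<otimes>\<^bsub>K\<^esub> inv\<^bsub>K\<^esub> a j)))"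
    using coordinate_change_exists by blast
  then have "coordinate_change L K F a \<and> changes_into L K F a Q Q'"
    unfolding coordinate_change_def changes_into_def apart_def by blast
  then show ?thesis by blast
qed

text \<open>As \<open>Q\<close> is injective on root subgroups, the arguments
  \<open>F x (a i / a j)\<close> themselves are determined. The argument at
  \<open>x = \<one>\<close> yields the quotients \<open>a i / a j\<close>, and cancelling them
  yields \<open>F\<close>.\<close>

lemma coordinate_change_unique_iff:
  fixes K :: "'k ring" and L :: "'l ring"
  assumes Q: "coordinatization G X K Q" and L: "cring L"
    and Fa: "coordinate_change L K F a" "changes_into L K F a Q Q'"
  shows "coordinate_change L K F' a' \<and> changes_into L K F' a' Q Q' \<longleftrightarrow>
    (\<forall>x\<in>carrier L. F' x = F x) \<and> rescaled K a a'"
proof -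
  interpret K: cring K using coordinatizationD(1)[OF Q] .
  interpret L: cring L by fact
  have F: "F \<in> ring_iso L K" and a: "\<And>i. a i \<in> Units K"
    and aa: "\<And>i j. a i \<otimes>\<^bsub>K\<^esub> a (- i) = a j \<otimes>\<^bsub>K\<^esub> a (- j)"
    using Fa(1) unfolding coordinate_change_def by blast+
  have FQ: "Q' (sto_t L i j x) = Q (sto_t K i j (F x \<otimes>\<^bsub>K\<^esub> (a i \<otimes>\<^bsub>K\<^esub> inv\<^bsub>K\<^esub> a j)))"
    if "apart i j" "x \<in> carrier L" for i j x
    using Fa(2) that unfolding changes_into_def apart_def by blast
  have Fc: "F x \<in> carrier K" if "x \<in> carrier L" for x using ring_iso_memE(1)[OF F that] .
  note ac = K.Units_closed[OF a] and aic = K.Units_inv_closed[OF a]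
  have quot: "a i \<otimes>\<^bsub>K\<^esub> inv\<^bsub>K\<^esub> a j \<in> Units K" for i j
    using a by (intro K.Units_m_closed K.Units_inv_Units)
  show ?thesis
  proof
    assume "coordinate_change L K F' a' \<and> changes_into L K F' a' Q Q'"
    then have F': "F' \<in> ring_iso L K" and a': "\<And>i. a' i \<in> Units K"
      and FQ': "\<And>i j x. apart i j \<Longrightarrow> x \<in> carrier L \<Longrightarrow>
        Q' (sto_t L i j x) = Q (sto_t K i j (F' x \<otimes>\<^bsub>K\<^esub> (a' i \<otimes>\<^bsub>K\<^esub> inv\<^bsub>K\<^esub> a' j)))"
      unfolding coordinate_change_def changes_into_def apart_def by blast+
    have Fc': "F' x \<in> carrier K" if "x \<in> carrier L" for x using ring_iso_memE(1)[OF F' that] .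
    note ac' = K.Units_closed[OF a'] and aic' = K.Units_inv_closed[OF a']
    have eq: "F' x \<otimes>\<^bsub>K\<^esub> (a' i \<otimes>\<^bsub>K\<^esub> inv\<^bsub>K\<^esub> a' j) = F x \<otimes>\<^bsub>K\<^esub> (a i \<otimes>\<^bsub>K\<^esub> inv\<^bsub>K\<^esub> a j)"
      if ij: "apart i j" and x: "x \<in> carrier L" for i j x
    proof (rule inj_onD[OF bij_betw_imp_inj_on[OF coordinatizationD(3)[OF Q ij]]])
      show "Q (sto_t K i j (F' x \<otimes>\<^bsub>K\<^esub> (a' i \<otimes>\<^bsub>K\<^esub> inv\<^bsub>K\<^esub> a' j)))
          = Q (sto_t K i j (F x \<otimes>\<^bsub>K\<^esub> (a i \<otimes>\<^bsub>K\<^esub> inv\<^bsub>K\<^esub> a j)))"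
        using FQ[OF ij x] FQ'[OF ij x] by simp
    qed (use Fc[OF x] Fc'[OF x] ac ac' aic aic' in auto)
    have quot_eq: "a' i \<otimes>\<^bsub>K\<^esub> inv\<^bsub>K\<^esub> a' j = a i \<otimes>\<^bsub>K\<^esub> inv\<^bsub>K\<^esub> a j" if "apart i j" for i j
      using eq[OF that L.one_closed] ring_iso_memE(4)[OF F] ring_iso_memE(4)[OF F'] ac ac' aic aic' by simp
    have "F' x = F x" if x: "x \<in> carrier L" for x
    proof -
      obtain i j :: "'n signed_index" where ij: "apart i j" using apart_exists[OF rank] by blast
      have "(a i \<otimes>\<^bsub>K\<^esub> inv\<^bsub>K\<^esub> a j) \<otimes>\<^bsub>K\<^esub> F' x = (a i \<otimes>\<^bsub>K\<^esub> inv\<^bsub>K\<^esub> a j) \<otimes>\<^bsub>K\<^esub> F x"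
        using eq[OF ij x] quot_eq[OF ij] Fc[OF x] Fc'[OF x] K.Units_closed[OF quot[of i j]]
        by (simp add: K.m_comm)
      then show ?thesis using K.Units_cancel[OF quot Fc'[OF x] Fc[OF x]] by blast
    qed
    moreover have "rescaled K a a'"
    proof -
      \<comment> \<open>Equality of the quotients says that \<open>a' i / a i\<close> takes the same
        value at apart indices.\<close>
      define c where "c i = inv\<^bsub>K\<^esub> a i \<otimes>\<^bsub>K\<^esub> a' i" for i
      have c_unit: "c i \<in> Units K" for i
        unfolding c_def using a a' by (intro K.Units_m_closed K.Units_inv_Units)
      have ca: "a i \<otimes>\<^bsub>K\<^esub> c i = a' i" for i
        unfolding c_def using a[of i] ac aic ac' by (simp flip: K.m_assoc)
      have c_eq: "c i = c j" if ij: "apart i j" for i j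
      proof -
        have "a' i = (a' i \<otimes>\<^bsub>K\<^esub> inv\<^bsub>K\<^esub> a' j) \<otimes>\<^bsub>K\<^esub> a' j"
          using a'[of j] ac' aic' by (simp add: K.m_assoc)
        also have "\<dots> = a i \<otimes>\<^bsub>K\<^esub> c j"
          unfolding quot_eq[OF ij] c_def using ac aic ac' by (simp add: K.m_assoc)
        finally have "a i \<otimes>\<^bsub>K\<^esub> c i = a i \<otimes>\<^bsub>K\<^esub> c j" using ca by simp
        then show ?thesis
          using K.Units_cancel[OF a K.Units_closed[OF c_unit] K.Units_closed[OF c_unit]] by blast
      qed
      \<comment> \<open>Two indices of equal absolute value are compared with a third one apart from
        both.\<close>
      have "c i = c j" for i j
        using apart_exists[OF rank, of i j j] c_eq by metis
      then show ?thesis unfolding rescaled_def using c_unit ca by metis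
    qed
    ultimately show "(\<forall>x\<in>carrier L. F' x = F x) \<and> rescaled K a a'" by blast
  next
    assume "(\<forall>x\<in>carrier L. F' x = F x) \<and> rescaled K a a'"
    then obtain c where F': "\<And>x. x \<in> carrier L \<Longrightarrow> F' x = F x" and c: "c \<in> Units K"
      and a': "\<And>i. a' i = a i \<otimes>\<^bsub>K\<^esub> c"
      unfolding rescaled_def by blast
    have cc: "c \<in> carrier K" "inv\<^bsub>K\<^esub> c \<in> carrier K" using c by auto
    have "F' \<in> ring_iso L K"
    proof (rule ring_iso_memI)
      show "bij_betw F' (carrier L) (carrier K)"
        using ring_iso_memE(5)[OF F] F' by (subst bij_betw_cong) auto
    qed (use F' ring_iso_memE(1-4)[OF F] in auto)
    moreover have "a' i \<in> Units K" for i unfolding a' using a c by (rule K.Units_m_closed)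
    moreover have "a' i \<otimes>\<^bsub>K\<^esub> a' (- i) = a' j \<otimes>\<^bsub>K\<^esub> a' (- j)" for i j
    proof -
      have *: "a' k \<otimes>\<^bsub>K\<^esub> a' (- k) = (a k \<otimes>\<^bsub>K\<^esub> a (- k)) \<otimes>\<^bsub>K\<^esub> (c \<otimes>\<^bsub>K\<^esub> c)" for k
        unfolding a' using ac cc by (simp add: K.m_ac)
      show ?thesis unfolding * using aa by metis
    qed
    moreover have "a' i \<otimes>\<^bsub>K\<^esub> inv\<^bsub>K\<^esub> a' j = a i \<otimes>\<^bsub>K\<^esub> inv\<^bsub>K\<^esub> a j" for i j
    proof -
      have "a' j \<otimes>\<^bsub>K\<^esub> (inv\<^bsub>K\<^esub> a j \<otimes>\<^bsub>K\<^esub> inv\<^bsub>K\<^esub> c) = (a j \<otimes>\<^bsub>K\<^esub> inv\<^bsub>K\<^esub> a j) \<otimes>\<^bsub>K\<^esub> (c \<otimes>\<^bsub>K\<^esub> inv\<^bsub>K\<^esub> c)"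
        unfolding a' using ac aic cc by (simp add: K.m_ac)
      also have "\<dots> = \<one>\<^bsub>K\<^esub>" using a[of j] c by simp
      finally have "inv\<^bsub>K\<^esub> a' j = inv\<^bsub>K\<^esub> a j \<otimes>\<^bsub>K\<^esub> inv\<^bsub>K\<^esub> c"
        using ac aic cc by (intro K.comm_inv_char) (simp_all add: a')
      then have "a' i \<otimes>\<^bsub>K\<^esub> inv\<^bsub>K\<^esub> a' j = (a i \<otimes>\<^bsub>K\<^esub> inv\<^bsub>K\<^esub> a j) \<otimes>\<^bsub>K\<^esub> (c \<otimes>\<^bsub>K\<^esub> inv\<^bsub>K\<^esub> c)"
        unfolding a' using ac aic cc by (simp add: K.m_ac)
      then show ?thesis using c ac aic by simp
    qed
    ultimately show "coordinate_change L K F' a' \<and> changes_into L K F' a' Q Q'"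
      unfolding coordinate_change_def changes_into_def using F' FQ by (simp add: apart_def)
  qed
qed

text \<open>The elements \<open>F x (a i / a j)\<close> again obey the Steinberg relations: the
  quotients multiply along \<open>i, j, k\<close>, and the condition on \<open>a i a (- i)\<close>
  makes them invariant under the flip, as the second Steinberg relation demands.\<close>

lemma coordinate_change_realized:
  fixes K :: "'k ring" and L :: "'l ring"
  assumes Q: "coordinatization G X K Q" and L: "cring L" and Fa: "coordinate_change L K F a"
  shows "\<exists>Q'. coordinatization G X L Q' \<and> changes_into L K F a Q Q'"
proof -
  interpret K: cring K using coordinatizationD(1)[OF Q] .
  interpret L: cring L by fact
  have F: "F \<in> ring_iso L K" and a: "\<And>i. a i \<in> Units K"
    and aa: "\<And>i j. a i \<otimes>\<^bsub>K\<^esub> a (- i) = a j \<otimes>\<^bsub>K\<^esub> a (- j)"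
    using Fa unfolding coordinate_change_def by blast+
  interpret F: ring_hom_ring L K F
    using F by (intro ring_hom_ringI2 L.ring_axioms K.ring_axioms) (simp add: ring_iso_def)
  note ac = K.Units_closed[OF a] and aic = K.Units_inv_closed[OF a]
  define q where "q i j = a i \<otimes>\<^bsub>K\<^esub> inv\<^bsub>K\<^esub> a j" for i j
  have q_unit: "q i j \<in> Units K" for i j
    unfolding q_def using a by (intro K.Units_m_closed K.Units_inv_Units)
  note qc = K.Units_closed[OF q_unit]
  have q_flip: "q (- j) (- i) = q i j" for i j
  proof -
    have "a (- j) \<otimes>\<^bsub>K\<^esub> a j = a i \<otimes>\<^bsub>K\<^esub> a (- i)" using aa[of j i] ac by (simp add: K.m_comm)
    then have "(a (- j) \<otimes>\<^bsub>K\<^esub> a j) \<otimes>\<^bsub>K\<^esub> (inv\<^bsub>K\<^esub> a j \<otimes>\<^bsub>K\<^esub> inv\<^bsub>K\<^esub> a (- i))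
        = (a i \<otimes>\<^bsub>K\<^esub> a (- i)) \<otimes>\<^bsub>K\<^esub> (inv\<^bsub>K\<^esub> a j \<otimes>\<^bsub>K\<^esub> inv\<^bsub>K\<^esub> a (- i))" by simp
    moreover have "(a (- j) \<otimes>\<^bsub>K\<^esub> a j) \<otimes>\<^bsub>K\<^esub> (inv\<^bsub>K\<^esub> a j \<otimes>\<^bsub>K\<^esub> inv\<^bsub>K\<^esub> a (- i))
        = q (- j) (- i) \<otimes>\<^bsub>K\<^esub> (a j \<otimes>\<^bsub>K\<^esub> inv\<^bsub>K\<^esub> a j)"
      unfolding q_def using ac aic by (simp add: K.m_ac)
    moreover have "(a i \<otimes>\<^bsub>K\<^esub> a (- i)) \<otimes>\<^bsub>K\<^esub> (inv\<^bsub>K\<^esub> a j \<otimes>\<^bsub>K\<^esub> inv\<^bsub>K\<^esub> a (- i))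
        = q i j \<otimes>\<^bsub>K\<^esub> (a (- i) \<otimes>\<^bsub>K\<^esub> inv\<^bsub>K\<^esub> a (- i))"
      unfolding q_def using ac aic by (simp add: K.m_ac)
    ultimately show ?thesis using a qc by simp
  qed
  have q_mult: "q i j \<otimes>\<^bsub>K\<^esub> q j k = q i k" for i j k
  proof -
    have "q i j \<otimes>\<^bsub>K\<^esub> q j k = q i k \<otimes>\<^bsub>K\<^esub> (a j \<otimes>\<^bsub>K\<^esub> inv\<^bsub>K\<^esub> a j)"
      unfolding q_def using ac aic by (simp add: K.m_ac)
    then show ?thesis using a qc by simp
  qed
  interpret S: sto_family G K "\<lambda>i j x. Q (sto_t K i j x)" using coordinatizationD(2)[OF Q] .
  define \<phi> where "\<phi> i j x = Q (sto_t K i j (F x \<otimes>\<^bsub>K\<^esub> q i j))" for i j x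
  have arg: "F x \<otimes>\<^bsub>K\<^esub> q i j \<in> carrier K" if "x \<in> carrier L" for x i j using that qc by simp
  have "sto_family G L \<phi>"
  proof
    fix i j :: "'n signed_index" and x assume ij: "apart i j" and x: "x \<in> carrier L"
    show "\<phi> i j x \<in> carrier G" unfolding \<phi>_def by (rule S.closed[OF ij arg[OF x]])
    have "\<ominus>\<^bsub>K\<^esub> (F x \<otimes>\<^bsub>K\<^esub> q i j) = F (\<ominus>\<^bsub>L\<^esub> x) \<otimes>\<^bsub>K\<^esub> q (- j) (- i)"
      unfolding q_flip using x qc by (simp add: K.l_minus)
    then show "\<phi> i j x = \<phi> (- j) (- i) (\<ominus>\<^bsub>L\<^esub> x)"
      unfolding \<phi>_def using S.flip[OF ij arg[OF x]] by simp
    fix y assume y: "y \<in> carrier L"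
    have "F (x \<oplus>\<^bsub>L\<^esub> y) \<otimes>\<^bsub>K\<^esub> q i j = F x \<otimes>\<^bsub>K\<^esub> q i j \<oplus>\<^bsub>K\<^esub> F y \<otimes>\<^bsub>K\<^esub> q i j"
      using x y qc by (simp add: K.l_distr)
    then show "\<phi> i j (x \<oplus>\<^bsub>L\<^esub> y) = \<phi> i j x \<otimes> \<phi> i j y"
      unfolding \<phi>_def using S.add[OF ij arg[OF x] arg[OF y]] by simp
    show "comm (\<phi> (- i) j x) (\<phi> j i y) = \<one>"
      unfolding \<phi>_def by (rule S.commute'[OF ij arg[OF x] arg[OF y]])
  next
    fix i j k l :: "'n signed_index" and x y
    assume "apart i j" "apart k l" "{- i, j} \<inter> {k, - l} = {}" "x \<in> carrier L" "y \<in> carrier L"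
    then show "comm (\<phi> i j x) (\<phi> k l y) = \<one>"
      unfolding \<phi>_def by (intro S.commute arg)
  next
    fix i j k :: "'n signed_index" and x y
    assume ap: "apart i j" "apart j k" "apart i k" and x: "x \<in> carrier L" and y: "y \<in> carrier L"
    have "(F x \<otimes>\<^bsub>K\<^esub> q i j) \<otimes>\<^bsub>K\<^esub> (F y \<otimes>\<^bsub>K\<^esub> q j k) = (F x \<otimes>\<^bsub>K\<^esub> F y) \<otimes>\<^bsub>K\<^esub> (q i j \<otimes>\<^bsub>K\<^esub> q j k)"
      using x y qc by (simp add: K.m_ac)
    also have "\<dots> = F (x \<otimes>\<^bsub>L\<^esub> y) \<otimes>\<^bsub>K\<^esub> q i k" unfolding q_mult using x y by simp
    finally show "comm (\<phi> i j x) (\<phi> j k y) = \<phi> i k (x \<otimes>\<^bsub>L\<^esub> y)"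
      unfolding \<phi>_def using S.mult[OF ap arg[OF x] arg[OF y]] by simp
  qed
  moreover have "bij_betw (\<phi> i j) (carrier L) (Y i j)" if ij: "apart i j" for i j
  proof -
    have qi: "inv\<^bsub>K\<^esub> q i j \<in> carrier K" using q_unit by blast
    have "bij_betw (\<lambda>x. x \<otimes>\<^bsub>K\<^esub> q i j) (carrier K) (carrier K)"
      using qc qi q_unit[of i j] by (intro bij_betwI[where g = "\<lambda>x. x \<otimes>\<^bsub>K\<^esub> inv\<^bsub>K\<^esub> q i j"]) (auto simp: K.m_assoc)
    from bij_betw_trans[OF bij_betw_trans[OF ring_iso_memE(5)[OF F] this] coordinatizationD(3)[OF Q ij]]
    show ?thesis unfolding \<phi>_def comp_def .
  qed
  ultimately obtain Q' where "coordinatization G X L Q'"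
    "\<And>i j x. apart i j \<Longrightarrow> x \<in> carrier L \<Longrightarrow> Q' (sto_t L i j x) = \<phi> i j x"
    using coordinatizationI[OF L] by metis
  then show ?thesis unfolding changes_into_def \<phi>_def q_def apart_def by blast
qed

end

text \<open>The ring in the existence clause has its elements in \<open>'a\<close> because it is
  carried by one of the root subgroups; the remaining clauses compare rings over arbitrary
  types.\<close>

theorem theorem3:
  fixes G :: "('a, 'm) monoid_scheme"
    and X :: "real ^ 'n::finite \<Rightarrow> 'a set"
  assumes "4 \<le> CARD('n)"
    and "graded_group G D_roots X"
  shows "(\<exists>(K :: 'a ring) Q. coordinatization G X K Q) \<and>
    (\<forall>(K :: 'k ring) Q. coordinatization G X K Q \<longrightarrow>
      (\<forall>(K' :: 'l ring) Q'. coordinatization G X K' Q' \<longrightarrow>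
        (\<exists>F a. coordinate_change K' K F a \<and> changes_into K' K F a Q Q') \<and>
        (\<forall>F a. coordinate_change K' K F a \<and> changes_into K' K F a Q Q' \<longrightarrow>
          (\<forall>F' a'. coordinate_change K' K F' a' \<and> changes_into K' K F' a' Q Q' \<longleftrightarrow>
            (\<forall>x\<in>carrier K'. F' x = F x) \<and> rescaled K a a'))) \<and>
      (\<forall>(K' :: 'l ring) F a. cring K' \<and> coordinate_change K' K F a \<longrightarrow>
        (\<exists>Q'. coordinatization G X K' Q' \<and> changes_into K' K F a Q Q')))"
proof -
  interpret D_graded G X
    using assms by (auto simp: graded_group_def D_graded_def D_graded_axioms_def)
  show ?thesis
  proof (intro conjI allI impI)
    show "\<exists>(K :: 'a ring) Q. coordinatization G X K Q" by (rule coordinatization_exists)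
  next
    fix K :: "'k ring" and Q and K' :: "'l ring" and Q'
    assume Q: "coordinatization G X K Q" and Q': "coordinatization G X K' Q'"
    show "\<exists>F a. coordinate_change K' K F a \<and> changes_into K' K F a Q Q'"
      by (rule coordinate_change_exists[OF Q Q'])
    fix F F' :: "'l \<Rightarrow> 'k" and a a' :: "'n signed_index \<Rightarrow> 'k"
    assume "coordinate_change K' K F a \<and> changes_into K' K F a Q Q'"
    then show "coordinate_change K' K F' a' \<and> changes_into K' K F' a' Q Q' \<longleftrightarrow>
        (\<forall>x\<in>carrier K'. F' x = F x) \<and> rescaled K a a'"
      using coordinate_change_unique_iff[OF Q coordinatizationD(1)[OF Q']] by blast
  next
    fix K :: "'k ring" and Q and K' :: "'l ring" and F :: "'l \<Rightarrow> 'k" and a :: "'n signed_index \<Rightarrow> 'k"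
    assume Q: "coordinatization G X K Q" and "cring K' \<and> coordinate_change K' K F a"
    then show "\<exists>Q'. coordinatization G X K' Q' \<and> changes_into K' K F a Q Q'"
      using coordinate_change_realized[OF Q] by blast
  qed
qed

end
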